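(* Let $K$ be a semitopological semihypergroup. Then the following properties are equivalent. (1) $K$ admits a topological left-invariant mean (TLIM). (2) There exists a net $\{\nu_\alpha\}$ in $P(K)$ such that for each $\nu\in P(K)$ the net $\{\nu*\nu_\alpha-\nu_\alpha\}$ converges to $0$ in the norm topology of $M(K)$. (3) For each $\mu\in M(K)$ we have $|\mu(K)|=\inf\{\|\mu*\nu\| : \nu\in P(K)\}$. (4) $K$ is topological right stationary. (5) $M(K)$ is left amenable as an F-algebra.
   Context: All topologies are Hausdorff. For a locally compact Hausdorff space $X$: $M(X)$ is the space of regular complex Borel measures on $X$ with total variation norm; $M^+(X)$ and $P(X)$ are its subsets of finite non-negative measures and of probability measures; $p_x$ is the Dirac measure at $x$; $C_c^+(X)$ is the set of non-negative compactly supported continuous functions on $X$. The cone topology on $M^+(X)$ is the weakest topology making $\mu\mapsto\int_X f\,d\mu$ continuous for every $f\in C_c^+(X)\cup\{1_X\}$, where $1_X$ is the characteristic function of $X$. $\mathfrak{C}(X)$ is the set of compact subsets of $X$ with the Michael topology, generated by the sub-basis of sets $\{C\in\mathfrak{C}(X): C\cap U\neq\emptyset,\ C\subset V\}$, with $U,V$ open in $X$. Semitopological semihypergroup: a pair $(K,* )$ where (A1) $K$ is a locally compact Hausdorff space and $*$ is a binary operation on $M(K)$ making $(M(K),* )$ an associative algebra (so $*$ is bilinear); (A2$'$) $*$ is positive (it maps $M^+(K)\times M^+(K)$ into $M^+(K)$) and separately continuous on $M^+(K)\times M^+(K)$ for the cone topology; (A3) for all $x,y\in K$, $p_x*p_y$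 is a probability measure with compact support; (A4$'$) the map $(x,y)\mapsto \operatorname{supp}(p_x*p_y)$ from $K\times K$ to $\mathfrak{C}(K)$ is separately continuous. With the total variation norm, $M(K)$ is an associative Banach algebra. Translates: for $\mu\in M(K)$ and $\phi\in M(K)^*$, define $L_\mu\phi, R_\mu\phi\in M(K)^*$ by $L_\mu\phi(\nu)=\phi(\mu*\nu)$ and $R_\mu\phi(\nu)=\phi(\nu*\mu)$ for $\nu\in M(K)$. Let $\mathbb{1}\in M(K)^*$ be the functional $\mu\mapsto\mu(K)$. Means: a mean is a functional $m\in M(K)^{**}$ with $\|m\|=1$ that is positive, i.e. $m(\phi)\ge 0$ whenever $\phi\in M(K)^*$ satisfies $\phi\ge 0$ (meaning $\phi(\nu)\ge 0$ for all $\nu\in M^+(K)$). Equivalently, $\|m\|=m(\mathbb{1})=1$. A mean $m$ is a topological left-invariant mean (TLIM) if $m(L_\nu\phi)=m(\phi)$ for all $\nu\in P(K)$ and $\phi\in M(K)^*$. Topological right stationary: $K$ is topological right stationary if there is a net $\{\nu_\alpha\}\subset P(K)$ such that for each $\phi\in M(K)^*$ there is a scalar $c_0\in\mathbb{C}$ with $R_{\nu_\alpha}\phi\to c_0\mathbb{1}$ in the weak$^*$ topology of $M(K)^*$. F-algebras: a Banach algebra $A$ is an F-algebra if it is the (unique) predual of a W$^*$-algebra $M$ whose identity $e_M$ is a multiplicative linear functional on $A$. $M(K)$ is an F-algebra, with $M=M(K)^*$ and $e_M=\mathbb{1}$. For a Banach $A$-bimodule $X$, the dual $X^*$ is a Banach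 $A$-bimodule via $(a\cdot\phi)(x)=\phi(x\cdot a)$ and $(\phi\cdot a)(x)=\phi(a\cdot x)$. A derivation from $A$ into a Banach $A$-bimodule $Y$ is a linear map $D:A\to Y$ with $D(ab)=D(a)\cdot b+a\cdot D(b)$; it is inner if there is $y\in Y$ with $D(a)=a\cdot y-y\cdot a$ for all $a\in A$. The F-algebra $A$ is left amenable if for each Banach $A$-bimodule $X$ whose left module action is $a\cdot x=\langle a,e_M\rangle x$ for all $a\in A$, $x\in X$, every bounded derivation from $A$ into $X^*$ is inner. (For $A=M(K)$, the condition on the left action reads $\mu\cdot x=\mu(K)\,x$.) *)

theory Defs
  imports "HOL-Analysis.Analysis"
begin

section \<open>Nets\<close>

definition directed_set :: "'i set \<Rightarrow> ('i \<Rightarrow> 'i \<Rightarrow> bool) \<Rightarrow> bool" where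
  "directed_set I le \<longleftrightarrow>
     I \<noteq> {} \<and>
     (\<forall>i\<in>I. le i i) \<and>
     (\<forall>i\<in>I. \<forall>j\<in>I. \<forall>k\<in>I. le i j \<longrightarrow> le j k \<longrightarrow> le i k) \<and>
     (\<forall>i\<in>I. \<forall>j\<in>I. \<exists>k\<in>I. le i k \<and> le j k)"

text \<open>The filter of tails: \<open>P\<close> holds eventually iff it holds on all indices beyond some index.
  A net \<open>n\<close> indexed by \<open>I\<close> converges to \<open>l\<close> iff \<open>n\<close> tends to \<open>l\<close> along this filter.\<close>

definition tails :: "'i set \<Rightarrow> ('i \<Rightarrow> 'i \<Rightarrow> bool) \<Rightarrow> 'i filter" where
  "tails I le = (INF i\<in>I. principal {j\<in>I. le i j})"

lemma eventually_tails:
  assumes "directed_set I le"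
  shows "eventually P (tails I le) \<longleftrightarrow> (\<exists>i\<in>I. \<forall>j\<in>I. le i j \<longrightarrow> P j)"
proof -
  have "eventually P (tails I le) \<longleftrightarrow> (\<exists>i\<in>I. eventually P (principal {j\<in>I. le i j}))"
    unfolding tails_def
  proof (rule eventually_INF_base)
    show "I \<noteq> {}" using assms by (simp add: directed_set_def)
    fix a b assume ab: "a \<in> I" "b \<in> I"
    with assms obtain k where k: "k \<in> I" "le a k" "le b k"
      unfolding directed_set_def by blast
    moreover have "{j\<in>I. le k j} \<subseteq> {j\<in>I. le a j} \<inter> {j\<in>I. le b j}"
      using assms k ab unfolding directed_set_def by blast
    ultimately show "\<exists>x\<in>I. principal {j\<in>I. le x j}
        \<le> inf (principal {j\<in>I. le a j}) (principal {j\<in>I. le b j})"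
      by auto
  qed
  then show ?thesis by (auto simp: eventually_principal)
qed

text \<open>Existence of a net needs an index type. The type \<open>'x \<times> 'x set\<close> suffices for nets of
  elements of \<open>'x\<close>: every proper filter on \<open>'x\<close> that contains \<open>S\<close> is the tail filter of a net in
  \<open>S\<close> over this index type, and so every net with any index type can be replaced by one over this
  index type having the same tail filter of values.\<close>

lemma filter_as_net:
  fixes F :: "'x filter"
  assumes "F \<noteq> bot" and S: "eventually (\<lambda>x. x \<in> S) F"
  shows "\<exists>(I :: ('x \<times> 'x set) set) le n.
           directed_set I le \<and> (\<forall>i\<in>I. n i \<in> S) \<and> filtermap n (tails I le) = F"
proof -
  define I where "I = {(x, A). x \<in> A \<and> A \<subseteq> S \<and> eventually (\<lambda>y. y \<in> A) F}"
  define le :: "'x \<times> 'x set \<Rightarrow> 'x \<times> 'x set \<Rightarrow> bool" where "le = (\<lambda>i j. snd j \<subseteq> snd i)"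
  have ne: "\<exists>x. x \<in> A" if "eventually (\<lambda>y. y \<in> A) F" for A
    using that assms(1) by (metis eventually_happens)
  have dir: "directed_set I le"
    unfolding directed_set_def
  proof (intro conjI ballI impI)
    show "I \<noteq> {}" using ne[OF S] S by (auto simp: I_def)
    fix i j assume "i \<in> I" "j \<in> I"
    then have ev: "eventually (\<lambda>y. y \<in> snd i \<inter> snd j) F"
      by (auto simp: I_def intro: eventually_conj)
    then obtain x where "x \<in> snd i \<inter> snd j" using ne by blast
    then have "(x, snd i \<inter> snd j) \<in> I" using ev \<open>i \<in> I\<close> by (auto simp: I_def)
    moreover have "le i (x, snd i \<inter> snd j)" "le j (x, snd i \<inter> snd j)" by (simp_all add: le_def)
    ultimately show "\<exists>k\<in>I. le i k \<and> le j k" by blast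
  qed (auto simp: le_def)
  have "eventually P (filtermap fst (tails I le)) \<longleftrightarrow> eventually P F" for P
  proof
    assume "eventually P (filtermap fst (tails I le))"
    then obtain i where i: "i \<in> I" "\<forall>j\<in>I. le i j \<longrightarrow> P (fst j)"
      unfolding eventually_filtermap eventually_tails[OF dir] by blast
    have "P y" if "y \<in> snd i" for y
      using i that by (auto simp: I_def le_def)
    moreover have "eventually (\<lambda>y. y \<in> snd i) F" using i by (auto simp: I_def)
    ultimately show "eventually P F" by (auto elim: eventually_mono)
  next
    assume P: "eventually P F"
    define A where "A = {y\<in>S. P y}"
    have A: "eventually (\<lambda>y. y \<in> A) F" using P S by (auto simp: A_def intro: eventually_conj)
    then obtain x where "x \<in> A" using ne by blast
    then have "(x, A) \<in> I" using A by (auto simp: I_def A_def)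
    moreover have "\<forall>j\<in>I. le (x, A) j \<longrightarrow> P (fst j)"
      by (auto simp: I_def le_def A_def)
    ultimately show "eventually P (filtermap fst (tails I le))"
      unfolding eventually_filtermap eventually_tails[OF dir] by blast
  qed
  then have "filtermap fst (tails I le) = F" by (simp add: filter_eq_iff)
  moreover have "\<forall>i\<in>I. fst i \<in> S" by (auto simp: I_def)
  ultimately show ?thesis using dir by blast
qed

lemma net_reindex:
  fixes n :: "'i \<Rightarrow> 'x"
  assumes "directed_set I le" "\<forall>i\<in>I. n i \<in> S"
  shows "\<exists>(J :: ('x \<times> 'x set) set) le' n'.
           directed_set J le' \<and> (\<forall>j\<in>J. n' j \<in> S) \<and>
           filtermap n' (tails J le') = filtermap n (tails I le)"
proof (rule filter_as_net)
  obtain i where i: "i \<in> I" "le i i" using assms(1) unfolding directed_set_def by blast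
  then show "eventually (\<lambda>x. x \<in> S) (filtermap n (tails I le))"
    unfolding eventually_filtermap eventually_tails[OF assms(1)] using assms(2) by blast
  have "\<forall>i\<in>I. le i i" using assms(1) unfolding directed_set_def by blast
  then have "\<not> eventually (\<lambda>_. False) (tails I le)"
    unfolding eventually_tails[OF assms(1)] by blast
  then show "filtermap n (tails I le) \<noteq> bot"
    unfolding trivial_limit_def eventually_filtermap .
qed


section \<open>Complex normed spaces with explicit carriers\<close>

record 'v cnspace =
  carr :: "'v set"
  vadd :: "'v \<Rightarrow> 'v \<Rightarrow> 'v"
  vzero :: "'v"
  vscale :: "complex \<Rightarrow> 'v \<Rightarrow> 'v"
  vnorm :: "'v \<Rightarrow> real"

definition vdiff :: "'v cnspace \<Rightarrow> 'v \<Rightarrow> 'v \<Rightarrow> 'v" where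
  "vdiff V x y = vadd V x (vscale V (-1) y)"

definition complex_space :: "complex cnspace" where
  "complex_space = \<lparr>carr = UNIV, vadd = (+), vzero = 0, vscale = (*), vnorm = cmod\<rparr>"

definition complex_normed_space :: "'v cnspace \<Rightarrow> bool" where
  "complex_normed_space V \<longleftrightarrow>
     vzero V \<in> carr V \<and>
     (\<forall>x\<in>carr V. \<forall>y\<in>carr V. vadd V x y \<in> carr V) \<and>
     (\<forall>c. \<forall>x\<in>carr V. vscale V c x \<in> carr V) \<and>
     (\<forall>x\<in>carr V. \<forall>y\<in>carr V. \<forall>z\<in>carr V. vadd V (vadd V x y) z = vadd V x (vadd V y z)) \<and>
     (\<forall>x\<in>carr V. \<forall>y\<in>carr V. vadd V x y = vadd V y x) \<and>
     (\<forall>x\<in>carr V. vadd V x (vzero V) = x) \<and>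
     (\<forall>x\<in>carr V. vdiff V x x = vzero V) \<and>
     (\<forall>x\<in>carr V. vscale V 1 x = x) \<and>
     (\<forall>c d. \<forall>x\<in>carr V. vscale V c (vscale V d x) = vscale V (c * d) x) \<and>
     (\<forall>c. \<forall>x\<in>carr V. \<forall>y\<in>carr V. vscale V c (vadd V x y) = vadd V (vscale V c x) (vscale V c y)) \<and>
     (\<forall>c d. \<forall>x\<in>carr V. vscale V (c + d) x = vadd V (vscale V c x) (vscale V d x)) \<and>
     (\<forall>x\<in>carr V. 0 \<le> vnorm V x) \<and>
     (\<forall>x\<in>carr V. vnorm V x = 0 \<longleftrightarrow> x = vzero V) \<and>
     (\<forall>c. \<forall>x\<in>carr V. vnorm V (vscale V c x) = cmod c * vnorm V x) \<and>
     (\<forall>x\<in>carr V. \<forall>y\<in>carr V. vnorm V (vadd V x y) \<le> vnorm V x + vnorm V y)"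

definition complex_banach_space :: "'v cnspace \<Rightarrow> bool" where
  "complex_banach_space V \<longleftrightarrow>
     complex_normed_space V \<and>
     (\<forall>s :: nat \<Rightarrow> 'v.
        (\<forall>n. s n \<in> carr V) \<longrightarrow>
        (\<forall>e>0. \<exists>N. \<forall>m\<ge>N. \<forall>n\<ge>N. vnorm V (vdiff V (s m) (s n)) < e) \<longrightarrow>
        (\<exists>l\<in>carr V. (\<lambda>n. vnorm V (vdiff V (s n) l)) \<longlonglongrightarrow> 0))"

definition linear_map :: "'v cnspace \<Rightarrow> 'w cnspace \<Rightarrow> ('v \<Rightarrow> 'w) \<Rightarrow> bool" where
  "linear_map V W T \<longleftrightarrow>
     (\<forall>x\<in>carr V. T x \<in> carr W) \<and>
     (\<forall>x\<in>carr V. \<forall>y\<in>carr V. T (vadd V x y) = vadd W (T x) (T y)) \<and>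
     (\<forall>c. \<forall>x\<in>carr V. T (vscale V c x) = vscale W c (T x))"

definition bounded_map :: "'v cnspace \<Rightarrow> 'w cnspace \<Rightarrow> ('v \<Rightarrow> 'w) \<Rightarrow> bool" where
  "bounded_map V W T \<longleftrightarrow> (\<exists>B. \<forall>x\<in>carr V. vnorm W (T x) \<le> B * vnorm V x)"

definition bilinear_map ::
    "'u cnspace \<Rightarrow> 'v cnspace \<Rightarrow> 'w cnspace \<Rightarrow> ('u \<Rightarrow> 'v \<Rightarrow> 'w) \<Rightarrow> bool" where
  "bilinear_map U V W b \<longleftrightarrow>
     (\<forall>x\<in>carr U. linear_map V W (b x)) \<and> (\<forall>y\<in>carr V. linear_map U W (\<lambda>x. b x y))"

definition bounded_bilinear_map ::
    "'u cnspace \<Rightarrow> 'v cnspace \<Rightarrow> 'w cnspace \<Rightarrow> ('u \<Rightarrow> 'v \<Rightarrow> 'w) \<Rightarrow> bool" where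
  "bounded_bilinear_map U V W b \<longleftrightarrow>
     bilinear_map U V W b \<and>
     (\<exists>B. \<forall>x\<in>carr U. \<forall>y\<in>carr V. vnorm W (b x y) \<le> B * vnorm U x * vnorm V y)"

text \<open>Functionals are normalised to vanish off the carrier, so that equality in the dual space is
  equality of functions.\<close>

definition dual :: "'v cnspace \<Rightarrow> ('v \<Rightarrow> complex) cnspace" where
  "dual V = \<lparr>
     carr = {\<phi>. linear_map V complex_space \<phi> \<and> bounded_map V complex_space \<phi> \<and>
               (\<forall>x. x \<notin> carr V \<longrightarrow> \<phi> x = 0)},
     vadd = (\<lambda>\<phi> \<psi> x. \<phi> x + \<psi> x),
     vzero = (\<lambda>x. 0),
     vscale = (\<lambda>c \<phi> x. c * \<phi> x),
     vnorm = (\<lambda>\<phi>. Sup {cmod (\<phi> x) | x. x \<in> carr V \<and> vnorm V x \<le> 1})\<rparr>"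

definition weak_star_topology :: "'v cnspace \<Rightarrow> ('v \<Rightarrow> complex) topology" where
  "weak_star_topology V =
     topology_generated_by {{\<phi> \<in> carr (dual V). \<phi> x \<in> U} | x U. x \<in> carr V \<and> open U}"


section \<open>Bimodules, derivations, left amenability\<close>

definition assoc_algebra :: "'v cnspace \<Rightarrow> ('v \<Rightarrow> 'v \<Rightarrow> 'v) \<Rightarrow> bool" where
  "assoc_algebra A mul \<longleftrightarrow>
     bilinear_map A A A mul \<and>
     (\<forall>a\<in>carr A. \<forall>b\<in>carr A. \<forall>c\<in>carr A. mul (mul a b) c = mul a (mul b c))"

definition banach_bimodule ::
    "'v cnspace \<Rightarrow> ('v \<Rightarrow> 'v \<Rightarrow> 'v) \<Rightarrow>
     'x cnspace \<Rightarrow> ('v \<Rightarrow> 'x \<Rightarrow> 'x) \<Rightarrow> ('x \<Rightarrow> 'v \<Rightarrow> 'x) \<Rightarrow> bool" where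
  "banach_bimodule A mul X lact ract \<longleftrightarrow>
     complex_banach_space X \<and>
     bounded_bilinear_map A X X lact \<and>
     bounded_bilinear_map X A X ract \<and>
     (\<forall>a\<in>carr A. \<forall>b\<in>carr A. \<forall>x\<in>carr X.
        lact (mul a b) x = lact a (lact b x) \<and>
        ract x (mul a b) = ract (ract x a) b \<and>
        ract (lact a x) b = lact a (ract x b))"

definition dual_lact ::
    "'x cnspace \<Rightarrow> ('x \<Rightarrow> 'v \<Rightarrow> 'x) \<Rightarrow> 'v \<Rightarrow> ('x \<Rightarrow> complex) \<Rightarrow> ('x \<Rightarrow> complex)" where
  "dual_lact X ract a \<phi> = (\<lambda>x. if x \<in> carr X then \<phi> (ract x a) else 0)"

definition dual_ract ::
    "'x cnspace \<Rightarrow> ('v \<Rightarrow> 'x \<Rightarrow> 'x) \<Rightarrow> ('x \<Rightarrow> complex) \<Rightarrow> 'v \<Rightarrow> ('x \<Rightarrow> complex)" where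
  "dual_ract X lact \<phi> a = (\<lambda>x. if x \<in> carr X then \<phi> (lact a x) else 0)"

definition derivation ::
    "'v cnspace \<Rightarrow> ('v \<Rightarrow> 'v \<Rightarrow> 'v) \<Rightarrow>
     'y cnspace \<Rightarrow> ('v \<Rightarrow> 'y \<Rightarrow> 'y) \<Rightarrow> ('y \<Rightarrow> 'v \<Rightarrow> 'y) \<Rightarrow> ('v \<Rightarrow> 'y) \<Rightarrow> bool" where
  "derivation A mul Y lact ract D \<longleftrightarrow>
     linear_map A Y D \<and>
     (\<forall>a\<in>carr A. \<forall>b\<in>carr A. D (mul a b) = vadd Y (ract (D a) b) (lact a (D b)))"

definition inner_derivation ::
    "'v cnspace \<Rightarrow> 'y cnspace \<Rightarrow> ('v \<Rightarrow> 'y \<Rightarrow> 'y) \<Rightarrow> ('y \<Rightarrow> 'v \<Rightarrow> 'y) \<Rightarrow> ('v \<Rightarrow> 'y) \<Rightarrow> bool" where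
  "inner_derivation A Y lact ract D \<longleftrightarrow>
     (\<exists>y\<in>carr Y. \<forall>a\<in>carr A. D a = vdiff Y (lact a y) (ract y a))"

text \<open>Left amenability of an F-algebra \<open>A\<close> (with product \<open>mul\<close>, and \<open>e\<close> the identity of the
  dual W*-algebra, viewed as a functional on \<open>A\<close>), tested on the bimodules whose carrier is a set of
  elements of type \<open>'x\<close>. Left amenability proper is the conjunction over all types \<open>'x\<close>.\<close>

definition left_amenable ::
    "'x itself \<Rightarrow> 'v cnspace \<Rightarrow> ('v \<Rightarrow> 'v \<Rightarrow> 'v) \<Rightarrow> ('v \<Rightarrow> complex) \<Rightarrow> bool" where
  "left_amenable (_ :: 'x itself) A mul e \<longleftrightarrow>
     (\<forall>(X :: 'x cnspace) lact ract D.
        banach_bimodule A mul X lact ract \<longrightarrow>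
        (\<forall>a\<in>carr A. \<forall>x\<in>carr X. lact a x = vscale X (e a) x) \<longrightarrow>
        derivation A mul (dual X) (dual_lact X ract) (dual_ract X lact) D \<longrightarrow>
        bounded_map A (dual X) D \<longrightarrow>
        inner_derivation A (dual X) (dual_lact X ract) (dual_ract X lact) D)"


section \<open>Regular complex Borel measures\<close>

text \<open>Set functions are normalised to vanish on non-Borel sets.\<close>

type_synonym 'a cmeas = "'a set \<Rightarrow> complex"

definition total_variation :: "'a::topological_space cmeas \<Rightarrow> 'a set \<Rightarrow> real" where
  "total_variation \<mu> E =
     Sup {\<Sum>A\<in>P. cmod (\<mu> A) | P. finite P \<and> P \<subseteq> sets borel \<and> disjoint P \<and> \<Union>P = E}"

definition complex_measures :: "'a::topological_space cmeas set" where
  "complex_measures = {\<mu>.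
     (\<forall>A. A \<notin> sets borel \<longrightarrow> \<mu> A = 0) \<and>
     (\<forall>A :: nat \<Rightarrow> 'a set. range A \<subseteq> sets borel \<longrightarrow> disjoint_family A \<longrightarrow>
        (\<lambda>n. \<mu> (A n)) sums \<mu> (\<Union>n. A n))}"

definition regular_measure :: "'a::topological_space cmeas \<Rightarrow> bool" where
  "regular_measure \<mu> \<longleftrightarrow>
     (\<forall>E\<in>sets borel. \<forall>e>0. \<exists>C U. compact C \<and> open U \<and> C \<subseteq> E \<and> E \<subseteq> U \<and>
        total_variation \<mu> (U - C) < e)"

definition MK :: "'a::topological_space cmeas cnspace" where
  "MK = \<lparr>
     carr = {\<mu> \<in> complex_measures. regular_measure \<mu>},
     vadd = (\<lambda>\<mu> \<nu> A. \<mu> A + \<nu> A),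
     vzero = (\<lambda>A. 0),
     vscale = (\<lambda>c \<mu> A. c * \<mu> A),
     vnorm = (\<lambda>\<mu>. total_variation \<mu> UNIV)\<rparr>"

definition MK_pos :: "'a::topological_space cmeas set" where
  "MK_pos = {\<mu> \<in> carr MK. \<forall>A. \<mu> A \<in> \<real>\<^sub>\<ge>\<^sub>0}"

definition PK :: "'a::topological_space cmeas set" where
  "PK = {\<mu> \<in> MK_pos. \<mu> UNIV = 1}"

definition dirac :: "'a::topological_space \<Rightarrow> 'a cmeas" where
  "dirac x = (\<lambda>A. if A \<in> sets borel \<and> x \<in> A then 1 else 0)"

definition supp :: "'a::topological_space cmeas \<Rightarrow> 'a set" where
  "supp \<mu> = {x. \<forall>U. open U \<longrightarrow> x \<in> U \<longrightarrow> total_variation \<mu> U > 0}"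

text \<open>The library measure corresponding to an element of \<open>MK_pos\<close>; used only for integration.\<close>

definition to_measure :: "'a::topological_space cmeas \<Rightarrow> 'a measure" where
  "to_measure \<mu> = measure_of UNIV (sets borel) (\<lambda>A. ennreal (Re (\<mu> A)))"

definition Cc_pos :: "('a::topological_space \<Rightarrow> real) set" where
  "Cc_pos = {f. continuous_on UNIV f \<and> (\<forall>x. 0 \<le> f x) \<and> compact (closure {x. f x \<noteq> 0})}"

definition cone_topology :: "'a::topological_space cmeas topology" where
  "cone_topology = topology_generated_by
     {{\<mu> \<in> MK_pos. (LINT x|to_measure \<mu>. f x) \<in> W} | f W. f \<in> Cc_pos \<union> {\<lambda>x. 1} \<and> open W}"

text \<open>The whole space is added to the sub-basis, so that the empty set (which lies in no set of
  the given sub-basis) is still a point of the space.\<close>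

definition michael_topology :: "'a::topological_space set topology" where
  "michael_topology = topology_generated_by
     (insert {C. compact C}
       {{C. compact C \<and> C \<inter> U \<noteq> {} \<and> C \<subseteq> V} | U V. open U \<and> open V})"


section \<open>Semitopological semihypergroups\<close>

definition semitop_semihypergroup ::
    "('a::t2_space cmeas \<Rightarrow> 'a cmeas \<Rightarrow> 'a cmeas) \<Rightarrow> bool" where
  "semitop_semihypergroup conv \<longleftrightarrow>
     locally_compact_space (euclidean :: 'a topology) \<and>
     assoc_algebra MK conv \<and>
     (\<forall>\<mu>\<in>MK_pos. \<forall>\<nu>\<in>MK_pos. conv \<mu> \<nu> \<in> MK_pos) \<and>
     (\<forall>\<mu>\<in>MK_pos. continuous_map cone_topology cone_topology (\<lambda>\<nu>. conv \<mu> \<nu>)) \<and>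
     (\<forall>\<nu>\<in>MK_pos. continuous_map cone_topology cone_topology (\<lambda>\<mu>. conv \<mu> \<nu>)) \<and>
     (\<forall>x y. conv (dirac x) (dirac y) \<in> PK \<and> compact (supp (conv (dirac x) (dirac y)))) \<and>
     (\<forall>x. continuous_map euclidean michael_topology (\<lambda>y. supp (conv (dirac x) (dirac y)))) \<and>
     (\<forall>y. continuous_map euclidean michael_topology (\<lambda>x. supp (conv (dirac x) (dirac y))))"

definition left_translate ::
    "('a::topological_space cmeas \<Rightarrow> 'a cmeas \<Rightarrow> 'a cmeas) \<Rightarrow> 'a cmeas \<Rightarrow>
     ('a cmeas \<Rightarrow> complex) \<Rightarrow> ('a cmeas \<Rightarrow> complex)" where
  "left_translate conv \<mu> \<phi> = (\<lambda>\<nu>. if \<nu> \<in> carr MK then \<phi> (conv \<mu> \<nu>) else 0)"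

definition right_translate ::
    "('a::topological_space cmeas \<Rightarrow> 'a cmeas \<Rightarrow> 'a cmeas) \<Rightarrow> 'a cmeas \<Rightarrow>
     ('a cmeas \<Rightarrow> complex) \<Rightarrow> ('a cmeas \<Rightarrow> complex)" where
  "right_translate conv \<mu> \<phi> = (\<lambda>\<nu>. if \<nu> \<in> carr MK then \<phi> (conv \<nu> \<mu>) else 0)"

definition one_functional :: "'a::topological_space cmeas \<Rightarrow> complex" where
  "one_functional = (\<lambda>\<mu>. if \<mu> \<in> carr MK then \<mu> UNIV else 0)"

definition is_mean :: "(('a::topological_space cmeas \<Rightarrow> complex) \<Rightarrow> complex) \<Rightarrow> bool" where
  "is_mean m \<longleftrightarrow>
     m \<in> carr (dual (dual MK)) \<and> vnorm (dual (dual MK)) m = 1 \<and>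
     (\<forall>\<phi>\<in>carr (dual MK). (\<forall>\<nu>\<in>MK_pos. \<phi> \<nu> \<in> \<real>\<^sub>\<ge>\<^sub>0) \<longrightarrow> m \<phi> \<in> \<real>\<^sub>\<ge>\<^sub>0)"

definition TLIM ::
    "('a::topological_space cmeas \<Rightarrow> 'a cmeas \<Rightarrow> 'a cmeas) \<Rightarrow>
     (('a cmeas \<Rightarrow> complex) \<Rightarrow> complex) \<Rightarrow> bool" where
  "TLIM conv m \<longleftrightarrow>
     is_mean m \<and> (\<forall>\<nu>\<in>PK. \<forall>\<phi>\<in>carr (dual MK). m (left_translate conv \<nu> \<phi>) = m \<phi>)"

definition topological_right_stationary ::
    "('a::topological_space cmeas \<Rightarrow> 'a cmeas \<Rightarrow> 'a cmeas) \<Rightarrow> bool" where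
  "topological_right_stationary conv \<longleftrightarrow>
     (\<exists>(I :: ('a cmeas \<times> 'a cmeas set) set) le n.
        directed_set I le \<and> (\<forall>i\<in>I. n i \<in> PK) \<and>
        (\<forall>\<phi>\<in>carr (dual MK). \<exists>c.
           limitin (weak_star_topology MK) (\<lambda>i. right_translate conv (n i) \<phi>)
             (vscale (dual MK) c one_functional) (tails I le)))"

end

(* A measure n of mass one whose defects nu * n - n are small is obtained from an invariant functional
   by a Hahn-Banach argument on a finite power of M(K): otherwise a multiple of one_functional would be
   a finite sum of differences L_nu phi - phi. The normalised variation of the real part of n is then an
   almost invariant probability measure, because nu * |r| dominates |nu * r| while |r| and nu * |r| have
   the same mass. So the functional need not be positive, and the one obtained from (5) will do. For (3)
   almost invariant probability measures are found by making finitely many measures of mass zero small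
   one after the other. Conversely a weak* cluster point of almost invariant probability measures is a
   TLIM.
   Multiplicativity of the total mass comes from the density of the nonnegative combinations of point
   masses in the cone topology. *)

theory Submission
  imports Defs "HOL-Library.Function_Algebras"
begin

section \<open>The Hahn-Banach theorem for sublinear functionals\<close>

text \<open>The functional extracted from (4) is assembled from limits chosen separately for each
  functional on M(K), so that no norm bound is at hand, whereas (5) needs a bounded one. All
  conditions are therefore compared through an algebraic linear form that is invariant and equal to
  1 at \<open>one_functional\<close>. Such a form suffices for a statement about finitely many
  measures, since only finitely many functionals occur in it; boundedness returns as soon as
  evaluations at probability measures have a limit.

  Almost invariant measures are gathered in a filter and not in a net: a limit is reached by
  refining the filter, and no index type has to change.

  The extension argument is real, because the quantity to be bounded from below is a real part;
  complex functionals are rebuilt from their real parts afterwards.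

  The axioms control the mass of a product only for point masses. The constant 1 is among the test
  functions of the cone topology, hence the total mass is continuous and no mass can escape in a
  limit. Since continuity is separate, one factor is treated at a time.\<close>

locale real_subspace = vector_space scale
  for scale :: "real \<Rightarrow> 'v::ab_group_add \<Rightarrow> 'v" +
  fixes V :: "'v set"
  assumes subspace_V: "subspace V"
begin

lemmas V_zero [simp] = subspace_0[OF subspace_V]
lemmas V_add [simp] = subspace_add[OF subspace_V]
lemmas V_scale [simp] = subspace_scale[OF subspace_V]
lemmas V_neg [simp] = subspace_neg[OF subspace_V]

text \<open>Relative to \<open>V\<close>, because the ambient type of the application also contains
  set functions that are not measures, for which no norm inequality is available.\<close>

definition sublinear :: "('v \<Rightarrow> real) \<Rightarrow> bool" where
  "sublinear p \<longleftrightarrow> (\<forall>x\<in>V. \<forall>y\<in>V. p (x + y) \<le> p x + p y) \<and> (\<forall>t>0. \<forall>x\<in>V. p (scale t x) \<le> t * p x)"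

lemma sublinear_add: "sublinear p \<Longrightarrow> x \<in> V \<Longrightarrow> y \<in> V \<Longrightarrow> p (x + y) \<le> p x + p y"
  by (simp add: sublinear_def)

text \<open>The reverse inequality is the defining one for the factor \<open>1/t\<close> at the
  vector \<open>scale t x\<close>.\<close>

lemma sublinear_scale:
  assumes "sublinear p" "t > 0" "x \<in> V"
  shows "p (scale t x) = t * p x"
proof (rule antisym)
  show "p (scale t x) \<le> t * p x" using assms by (simp add: sublinear_def)
  have "p (scale (1/t) (scale t x)) \<le> (1/t) * p (scale t x)"
    using assms(1,3) \<open>t > 0\<close> unfolding sublinear_def by (metis V_scale zero_less_divide_1_iff)
  then show "t * p x \<le> p (scale t x)" using \<open>t > 0\<close> by (simp add: field_simps)
qed

lemma sublinear_zero: "sublinear p \<Longrightarrow> p 0 = 0"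
  using sublinear_scale[of p 2 0] by simp

lemma sublinear_neg: "sublinear p \<Longrightarrow> x \<in> V \<Longrightarrow> - p (- x) \<le> p x"
  using sublinear_add[of p x "- x"] sublinear_zero[of p] by simp

text \<open>A linear \<open>f\<close> below \<open>p\<close> with \<open>r \<le> f v\<close> on
  \<Gamma> satisfies \<open>f x = f (x + v) - f v \<le> p (x + v) - r\<close>. The infimum of the
  right-hand side is thus a bound that has the constraints built in. It is finite, because
  \<open>r \<le> p v\<close> keeps it above \<open>- p (- x)\<close>. The construction serves twice:
  for the linearity of minimal functionals and for the extension theorem with constraints.\<close>

lemma sublinear_inf_cone:
  assumes p: "sublinear p"
    and \<Gamma>: "\<Gamma> \<subseteq> V \<times> UNIV" "(0, 0) \<in> \<Gamma>"
      "\<And>v r w s. (v, r) \<in> \<Gamma> \<Longrightarrow> (w, s) \<in> \<Gamma> \<Longrightarrow> (v + w, r + s) \<in> \<Gamma>"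
      "\<And>t v r. t > 0 \<Longrightarrow> (v, r) \<in> \<Gamma> \<Longrightarrow> (scale t v, t * r) \<in> \<Gamma>"
    and le: "\<And>v r. (v, r) \<in> \<Gamma> \<Longrightarrow> r \<le> p v"
  shows "\<exists>q. sublinear q \<and> (\<forall>x\<in>V. \<forall>(v, r)\<in>\<Gamma>. q x \<le> p (x + v) - r)"
proof -
  define q where "q x = (INF (v, r)\<in>\<Gamma>. p (x + v) - r)" for x
  have bound: "- p (- x) \<le> p (x + v) - r" if "x \<in> V" "(v, r) \<in> \<Gamma>" for x v r
  proof -
    have "v \<in> V" using that \<Gamma>(1) by auto
    then have "p v \<le> p (x + v) + p (- x)"
      using sublinear_add[OF p, of "x + v" "- x"] that by simp
    then show ?thesis using le[OF that(2)] by simp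
  qed
  have q_le: "q x \<le> p (x + v) - r" if "x \<in> V" "(v, r) \<in> \<Gamma>" for x v r
  proof -
    have "bdd_below ((\<lambda>(v, r). p (x + v) - r) ` \<Gamma>)"
      by (rule bdd_belowI2[of _ "- p (- x)"]) (use bound that in auto)
    then show ?thesis unfolding q_def using cINF_lower[OF _ that(2)] by fastforce
  qed
  have q_ge: "c \<le> q x" if "\<And>v r. (v, r) \<in> \<Gamma> \<Longrightarrow> c \<le> p (x + v) - r" for c x
    unfolding q_def by (rule cINF_greatest) (use \<Gamma>(2) that in auto)
  have "q (x + y) \<le> q x + q y" if xy: "x \<in> V" "y \<in> V" for x y
  proof -
    \<comment> \<open>The two infima are taken one at a time: \<open>(w, s)\<close> is held fixed
      while \<open>(v, r)\<close> varies, and the sum of the pairs is again in \<Gamma>.\<close>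
    have "q (x + y) - (p (y + w) - s) \<le> q x" if ws: "(w, s) \<in> \<Gamma>" for w s
    proof (rule q_ge)
      fix v r assume vr: "(v, r) \<in> \<Gamma>"
      have V: "v \<in> V" "w \<in> V" using vr ws \<Gamma>(1) by auto
      have "q (x + y) \<le> p ((x + y) + (v + w)) - (r + s)"
        using q_le[OF _ \<Gamma>(3)[OF vr ws], of "x + y"] xy by simp
      also have "(x + y) + (v + w) = (x + v) + (y + w)" by (simp add: algebra_simps)
      also have "p \<dots> \<le> p (x + v) + p (y + w)" using sublinear_add[OF p] V xy by simp
      finally show "q (x + y) - (p (y + w) - s) \<le> p (x + v) - r" by simp
    qed
    then have "q (x + y) - q x \<le> q y"
      by (intro q_ge) (simp add: algebra_simps)
    then show ?thesis by simp
  qed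
  moreover have "q (scale t x) \<le> t * q x" if t: "t > 0" and x: "x \<in> V" for t x
  proof -
    have "q (scale t x) / t \<le> q x"
    proof (rule q_ge)
      fix v r assume vr: "(v, r) \<in> \<Gamma>"
      then have "v \<in> V" using \<Gamma>(1) by auto
      have "q (scale t x) \<le> p (scale t x + scale t v) - t * r"
        using q_le[OF _ \<Gamma>(4)[OF t vr]] x by simp
      also have "scale t x + scale t v = scale t (x + v)" by (simp add: scale_right_distrib)
      also have "p \<dots> = t * p (x + v)" using sublinear_scale[OF p t] x \<open>v \<in> V\<close> by simp
      finally show "q (scale t x) / t \<le> p (x + v) - r" using t by (simp add: field_simps)
    qed
    then show ?thesis using t by (simp add: field_simps)
  qed
  ultimately have "sublinear q" by (simp add: sublinear_def)
  then show ?thesis using q_le by blast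
qed

text \<open>Zorn's lemma in the reversed pointwise order. The pointwise infimum of a chain is finite
  because every member lies above \<open>- p (- x)\<close>.\<close>

lemma minimal_sublinear_exists:
  assumes p: "sublinear p"
  shows "\<exists>q. sublinear q \<and> (\<forall>x\<in>V. q x \<le> p x) \<and>
    (\<forall>r. sublinear r \<longrightarrow> (\<forall>x\<in>V. r x \<le> q x) \<longrightarrow> (\<forall>x\<in>V. r x = q x))"
proof -
  \<comment> \<open>Functionals vanish off \<open>V\<close>, so that pointwise agreement on
    \<open>V\<close> is equality and the order is antisymmetric.\<close>
  define A where "A = {q. sublinear q \<and> (\<forall>x\<in>V. q x \<le> p x) \<and> (\<forall>x. x \<notin> V \<longrightarrow> q x = 0)}"
  define P where "P q r \<longleftrightarrow> (\<forall>x\<in>V. r x \<le> q x)" for q r :: "'v \<Rightarrow> real"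
  have cut: "(\<lambda>x. if x \<in> V then q x else 0) \<in> A" if "sublinear q" "\<forall>x\<in>V. q x \<le> p x" for q
    using that by (auto simp: A_def sublinear_def)
  have "\<exists>m\<in>A. \<forall>a\<in>A. P m a \<longrightarrow> a = m"
  proof (rule predicate_Zorn)
    have "a = b" if "a \<in> A" "b \<in> A" "P a b" "P b a" for a b
    proof
      show "a x = b x" for x
        using that by (cases "x \<in> V") (auto simp: A_def P_def intro: antisym)
    qed
    then show "partial_order_on A (relation_of P A)"
      by (intro partial_order_on_relation_ofI) (auto simp: P_def intro: order_trans)
  next
    fix C assume C: "C \<in> Chains (relation_of P A)"
    then have CA: "C \<subseteq> A"
      using Chains_relation_of by blast
    have chain: "P q r \<or> P r q" if "q \<in> C" "r \<in> C" for q r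
      using C that unfolding Chains_def relation_of_def by auto
    show "\<exists>u\<in>A. \<forall>a\<in>C. P a u"
    proof (cases "C = {}")
      case True
      then show ?thesis using cut[OF p] by auto
    next
      case False
      define u where "u x = (INF q\<in>C. q x)" for x
      have low: "- p (- x) \<le> q x" if "x \<in> V" "q \<in> C" for x q
      proof -
        have "sublinear q" "q (- x) \<le> p (- x)" using that CA by (auto simp: A_def)
        then show ?thesis using sublinear_neg[of q x] that by simp
      qed
      have u_le: "u x \<le> q x" if "x \<in> V" "q \<in> C" for x q
        unfolding u_def using that low by (intro cINF_lower bdd_belowI2[of _ "- p (- x)"]) auto
      have u_ge: "c \<le> u x" if "\<And>q. q \<in> C \<Longrightarrow> c \<le> q x" for c x
        unfolding u_def using False that by (rule cINF_greatest)
      have sub: "sublinear q" if "q \<in> C" for q using that CA by (auto simp: A_def)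
      have "u (x + y) \<le> u x + u y" if xy: "x \<in> V" "y \<in> V" for x y
      proof -
        have "u (x + y) \<le> q x + r y" if qr: "q \<in> C" "r \<in> C" for q r
        proof -
          \<comment> \<open>The smaller of the two chain members works at both points; this is what
            makes an infimum of sublinear functionals subadditive.\<close>
          obtain s where s: "s \<in> C" "s x \<le> q x" "s y \<le> r y"
            using chain[OF qr] qr xy unfolding P_def by blast
          have "u (x + y) \<le> s x + s y"
            using u_le[of "x + y" s] sublinear_add[OF sub[OF s(1)]] xy s(1) by fastforce
          then show ?thesis using s by simp
        qed
        then have "u (x + y) - r y \<le> u x" if "r \<in> C" for r
          using that by (intro u_ge) (simp add: algebra_simps)
        then have "u (x + y) - u x \<le> u y"
          by (intro u_ge) (simp add: algebra_simps)
        then show ?thesis by simp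
      qed
      moreover have "u (scale t x) \<le> t * u x" if "t > 0" "x \<in> V" for t x
      proof -
        have "u (scale t x) / t \<le> u x"
        proof (rule u_ge)
          fix q assume "q \<in> C"
          then show "u (scale t x) / t \<le> q x"
            using u_le[of "scale t x" q] sublinear_scale[OF sub, of q t x] that
            by (simp add: field_simps)
        qed
        then show ?thesis using that by (simp add: field_simps)
      qed
      ultimately have "sublinear u" by (simp add: sublinear_def)
      moreover have "\<forall>x\<in>V. u x \<le> p x"
      proof
        fix x assume "x \<in> V"
        obtain q where "q \<in> C" using False by blast
        then show "u x \<le> p x" using u_le[OF \<open>x \<in> V\<close> \<open>q \<in> C\<close>] CA \<open>x \<in> V\<close> by (force simp: A_def)
      qed
      ultimately have "(\<lambda>x. if x \<in> V then u x else 0) \<in> A" by (rule cut)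
      moreover have "\<forall>a\<in>C. P a (\<lambda>x. if x \<in> V then u x else 0)"
        using u_le by (simp add: P_def)
      ultimately show ?thesis by blast
    qed
  qed
  then obtain m where m: "m \<in> A" "\<And>a. a \<in> A \<Longrightarrow> P m a \<Longrightarrow> a = m" by blast
  have "\<forall>x\<in>V. r x = m x" if r: "sublinear r" "\<forall>x\<in>V. r x \<le> m x" for r
  proof -
    let ?r = "\<lambda>x. if x \<in> V then r x else 0"
    have "\<forall>x\<in>V. m x \<le> p x" using m(1) by (simp add: A_def)
    then have "\<forall>x\<in>V. r x \<le> p x" using r(2) by (meson order_trans)
    then have "?r = m" using m(2)[of ?r] cut[OF r(1)] r(2) by (simp add: P_def)
    show ?thesis
    proof
      show "r x = m x" if "x \<in> V" for x using fun_cong[OF \<open>?r = m\<close>, of x] that by simp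
    qed
  qed
  then show ?thesis using m(1) by (auto simp: A_def)
qed

definition linear_functional :: "('v \<Rightarrow> real) \<Rightarrow> bool" where
  "linear_functional f \<longleftrightarrow>
     (\<forall>x\<in>V. \<forall>y\<in>V. f (x + y) = f x + f y) \<and> (\<forall>t. \<forall>x\<in>V. f (scale t x) = t * f x)"

text \<open>A minimal sublinear functional \<open>q\<close> is linear. With \<Gamma> the ray through
  \<open>(y, q y)\<close>, the functional from \<open>sublinear_inf_cone\<close> is below
  \<open>q\<close> (parameter 0), hence equal to it by minimality, and parameter 1 gives
  \<open>q x \<le> q (x + y) - q y\<close>.\<close>

theorem Hahn_Banach_sublinear:
  assumes p: "sublinear p"
  shows "\<exists>f. linear_functional f \<and> (\<forall>x\<in>V. f x \<le> p x)"
proof -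
  obtain q where q: "sublinear q" "\<And>x. x \<in> V \<Longrightarrow> q x \<le> p x"
    and min: "\<And>r. sublinear r \<Longrightarrow> \<forall>x\<in>V. r x \<le> q x \<Longrightarrow> \<forall>x\<in>V. r x = q x"
    using minimal_sublinear_exists[OF p] by blast
  have add: "q (x + y) = q x + q y" if xy: "x \<in> V" "y \<in> V" for x y
  proof -
    define \<Gamma> where "\<Gamma> = {(scale t y, t * q y) | t. t \<ge> 0}"
    have mem: "(scale t y, t * q y) \<in> \<Gamma>" if "t \<ge> 0" for t using that by (auto simp: \<Gamma>_def)
    obtain r where r: "sublinear r" "\<forall>x\<in>V. \<forall>(v, s)\<in>\<Gamma>. r x \<le> q (x + v) - s"
    proof (rule exE[OF sublinear_inf_cone[OF q(1), of \<Gamma>]])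
      show "\<Gamma> \<subseteq> V \<times> UNIV" using xy by (auto simp: \<Gamma>_def)
      show "(0, 0) \<in> \<Gamma>" using mem[of 0] by simp
      show "(v + w, a + b) \<in> \<Gamma>" if "(v, a) \<in> \<Gamma>" "(w, b) \<in> \<Gamma>" for v a w b
      proof -
        from that obtain t s where ts: "t \<ge> 0" "s \<ge> 0" "v = scale t y" "a = t * q y"
            "w = scale s y" "b = s * q y"
          by (auto simp: \<Gamma>_def)
        then show ?thesis using mem[of "t + s"] by (simp add: scale_left_distrib algebra_simps)
      qed
      show "(scale t v, t * a) \<in> \<Gamma>" if t: "t > 0" and va: "(v, a) \<in> \<Gamma>" for t v a
      proof -
        from va obtain s where "s \<ge> 0" "v = scale s y" "a = s * q y" by (auto simp: \<Gamma>_def)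
        then show ?thesis using mem[of "t * s"] t by (simp add: algebra_simps)
      qed
      show "a \<le> q v" if va: "(v, a) \<in> \<Gamma>" for v a
      proof -
        from va obtain t where t: "t \<ge> 0" "v = scale t y" "a = t * q y" by (auto simp: \<Gamma>_def)
        then show ?thesis
          using sublinear_scale[OF q(1), of t y] sublinear_zero[OF q(1)] xy by (cases "t = 0") auto
      qed
    qed blast
    have rle: "r z \<le> q (z + scale t y) - t * q y" if "z \<in> V" "t \<ge> 0" for z t
      using r(2) that mem by fastforce
    have "\<forall>x\<in>V. r x \<le> q x" using rle[of _ 0] by simp
    then have "\<forall>x\<in>V. r x = q x" by (rule min[OF r(1)])
    then have "q x \<le> q (x + y) - q y" using rle[of x 1] xy by simp
    then show ?thesis using sublinear_add[OF q(1)] xy by (simp add: order_antisym)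
  qed
  have neg: "q (- x) = - q x" if "x \<in> V" for x
    using add[of x "- x"] sublinear_zero[OF q(1)] that by simp
  have "q (scale t x) = t * q x" if x: "x \<in> V" for t x
  proof (cases t "0 :: real" rule: linorder_cases)
    case less
    then have "q (scale (- t) x) = - t * q x" using sublinear_scale[OF q(1), of "- t" x] x by simp
    then show ?thesis using neg[of "scale t x"] x by simp
  qed (use sublinear_scale[OF q(1)] sublinear_zero[OF q(1)] x in auto)
  then have "linear_functional q" using add by (simp add: linear_functional_def)
  then show ?thesis using q(2) by blast
qed

text \<open>A linear \<open>f\<close> below the sharpened bound \<open>q\<close> obeys the
  constraints, since \<open>f (- v) \<le> q (- v) \<le> p 0 - r = - r\<close>.\<close>

theorem Hahn_Banach_cone:
  assumes p: "sublinear p"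
    and \<Gamma>: "\<Gamma> \<subseteq> V \<times> UNIV" "(0, 0) \<in> \<Gamma>"
      "\<And>v r w s. (v, r) \<in> \<Gamma> \<Longrightarrow> (w, s) \<in> \<Gamma> \<Longrightarrow> (v + w, r + s) \<in> \<Gamma>"
      "\<And>t v r. t > 0 \<Longrightarrow> (v, r) \<in> \<Gamma> \<Longrightarrow> (scale t v, t * r) \<in> \<Gamma>"
    and le: "\<And>v r. (v, r) \<in> \<Gamma> \<Longrightarrow> r \<le> p v"
  shows "\<exists>f. linear_functional f \<and> (\<forall>x\<in>V. f x \<le> p x) \<and> (\<forall>(v, r)\<in>\<Gamma>. r \<le> f v)"
proof -
  obtain q where q: "sublinear q" "\<And>x v r. x \<in> V \<Longrightarrow> (v, r) \<in> \<Gamma> \<Longrightarrow> q x \<le> p (x + v) - r"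
    using sublinear_inf_cone[OF assms] by fast
  obtain f where f: "linear_functional f" "\<And>x. x \<in> V \<Longrightarrow> f x \<le> q x"
    using Hahn_Banach_sublinear[OF q(1)] by blast
  have "f x \<le> p x" if "x \<in> V" for x
    using f(2)[OF that] q(2)[OF that \<Gamma>(2)] by simp
  moreover have "r \<le> f v" if "(v, r) \<in> \<Gamma>" for v r
  proof -
    have v: "v \<in> V" using that \<Gamma>(1) by auto
    have "f (scale (- 1) v) = - f v" using f(1) v by (simp add: linear_functional_def del: scale_minus_left)
    then have "f (- v) = - f v" by simp
    then show ?thesis using f(2)[of "- v"] q(2)[of "- v", OF _ that] sublinear_zero[OF p] v by simp
  qed
  ultimately show ?thesis using f(1) by blast
qed

end

section \<open>Total variation\<close>

abbreviation tv :: "'a::topological_space cmeas \<Rightarrow> 'a set \<Rightarrow> real" where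
  "tv \<equiv> total_variation"

lemma complex_measuresI:
  assumes "\<And>A. A \<notin> sets borel \<Longrightarrow> \<mu> A = 0"
    and "\<And>A :: nat \<Rightarrow> 'a::topological_space set. range A \<subseteq> sets borel \<Longrightarrow> disjoint_family A \<Longrightarrow>
        (\<lambda>n. \<mu> (A n)) sums \<mu> (\<Union>n. A n)"
  shows "\<mu> \<in> complex_measures"
  using assms by (simp add: complex_measures_def)

lemma cm_outside: "\<mu> \<in> complex_measures \<Longrightarrow> A \<notin> sets borel \<Longrightarrow> \<mu> A = 0"
  by (simp add: complex_measures_def)

lemma cm_sums:
  "\<mu> \<in> complex_measures \<Longrightarrow> range A \<subseteq> sets borel \<Longrightarrow> disjoint_family A \<Longrightarrow>
    (\<lambda>n. \<mu> (A n)) sums \<mu> (\<Union>n. A n)" for A :: "nat \<Rightarrow> _"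
  by (simp add: complex_measures_def)

text \<open>The constant sequence of empty sets is disjoint, so a series with constant terms
  converges.\<close>

lemma cm_empty [simp]:
  assumes "\<mu> \<in> complex_measures"
  shows "\<mu> {} = 0"
proof -
  have "(\<lambda>n::nat. \<mu> {}) sums \<mu> {}"
    using cm_sums[OF assms, of "\<lambda>_. {}"] by (simp add: disjoint_family_on_def)
  then have "(\<lambda>n::nat. \<mu> {}) \<longlonglongrightarrow> 0" by (rule summable_LIMSEQ_zero[OF sums_summable])
  then show ?thesis by (simp add: LIMSEQ_const_iff)
qed

lemma cm_Un:
  assumes "\<mu> \<in> complex_measures" "A \<in> sets borel" "B \<in> sets borel" "A \<inter> B = {}"
  shows "\<mu> (A \<union> B) = \<mu> A + \<mu> B"
proof -
  have "disjoint_family (binaryset A B)"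
    using assms(4) by (auto simp: disjoint_family_on_def binaryset_def)
  moreover have "range (binaryset A B) \<subseteq> sets borel"
    using assms(2,3) by (simp add: range_binaryset_eq)
  ultimately have "(\<lambda>n. \<mu> (binaryset A B n)) sums \<mu> (A \<union> B)"
    using cm_sums[OF assms(1)] UN_binaryset_eq by metis
  moreover have "(\<lambda>n. \<mu> (binaryset A B n)) sums (\<mu> A + \<mu> B)"
    by (rule binaryset_sums) (simp add: assms(1))
  ultimately show ?thesis by (rule sums_unique2)
qed

lemma cm_Diff:
  assumes "\<mu> \<in> complex_measures" "A \<in> sets borel" "E \<in> sets borel" "A \<subseteq> E"
  shows "\<mu> (E - A) = \<mu> E - \<mu> A"
  using cm_Un[OF assms(1), of A "E - A"] assms(2-4) by (simp add: Un_absorb1)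

lemma cm_UN:
  assumes "\<mu> \<in> complex_measures" "finite I" "disjoint_family_on B I" "\<And>i. i \<in> I \<Longrightarrow> B i \<in> sets borel"
  shows "\<mu> (\<Union>i\<in>I. B i) = (\<Sum>i\<in>I. \<mu> (B i))"
  using assms(2-4)
proof (induction I)
  case empty
  then show ?case by (simp add: assms(1))
next
  case (insert i I)
  have "B i \<inter> (\<Union>i\<in>I. B i) = {}"
    using insert by (auto simp: disjoint_family_on_def)
  moreover have "(\<Union>i\<in>I. B i) \<in> sets borel" using insert by (intro sets.finite_UN) auto
  ultimately have "\<mu> (B i \<union> (\<Union>i\<in>I. B i)) = \<mu> (B i) + \<mu> (\<Union>i\<in>I. B i)"
    using insert by (intro cm_Un[OF assms(1)]) auto
  then show ?case using insert by (simp add: disjoint_family_on_def)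
qed

text \<open>If \<mu> were unbounded on the subsets of \<open>E\<close>, then \<open>E\<close> would
  split into a part on which it is still unbounded and a part of modulus above 1. Repeating this on
  the unbounded part leaves disjoint pieces of modulus above 1, whereas the values on a disjoint
  sequence are the terms of a convergent series.\<close>

lemma cm_bounded:
  fixes \<mu> :: "'a::topological_space cmeas"
  assumes \<mu>: "\<mu> \<in> complex_measures"
  shows "\<exists>M. \<forall>A\<in>sets borel. cmod (\<mu> A) \<le> M"
proof (rule ccontr)
  define bad where "bad E \<longleftrightarrow> E \<in> sets borel \<and> (\<forall>M. \<exists>A\<in>sets borel. A \<subseteq> E \<and> cmod (\<mu> A) > M)"
    for E
  assume "\<not> ?thesis"
  then have bad_UNIV: "bad UNIV" by (force simp: bad_def not_le)
  have step: "\<exists>F. bad F \<and> F \<subseteq> E \<and> cmod (\<mu> (E - F)) > 1" if "bad E" for E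
  proof -
    have E: "E \<in> sets borel" using that by (simp add: bad_def)
    have "\<forall>M. \<exists>A\<in>sets borel. A \<subseteq> E \<and> cmod (\<mu> A) > M" using that by (simp add: bad_def)
    \<comment> \<open>Exceeding \<open>cmod (\<mu> E) + 1\<close> makes the value on
      \<open>E - A\<close> larger than 1 in modulus too, so it does not matter which of the two
      parts is the unbounded one.\<close>
    from spec[OF this, of "cmod (\<mu> E) + 1"] obtain A
      where A: "A \<in> sets borel" "A \<subseteq> E" "cmod (\<mu> A) > cmod (\<mu> E) + 1" by blast
    have diff: "\<mu> (E - A) = \<mu> E - \<mu> A" by (rule cm_Diff[OF \<mu> A(1) E A(2)])
    have "cmod (\<mu> A) > 1" using A(3) norm_ge_zero[of "\<mu> E"] by linarith
    with diff have big: "cmod (\<mu> (E - A)) > 1" "cmod (\<mu> (E - (E - A))) > 1"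
      using A norm_triangle_ineq2[of "\<mu> A" "\<mu> E"]
      by (simp_all add: norm_minus_commute double_diff)
    have "bad A \<or> bad (E - A)"
    proof (rule ccontr)
      assume "\<not> ?thesis"
      moreover have "E - A \<in> sets borel" using A E by blast
      ultimately have "\<exists>M. \<forall>B\<in>sets borel. B \<subseteq> A \<longrightarrow> cmod (\<mu> B) \<le> M"
          "\<exists>M. \<forall>B\<in>sets borel. B \<subseteq> E - A \<longrightarrow> cmod (\<mu> B) \<le> M"
        using A(1) unfolding bad_def by (meson not_less)+
      then obtain M N where
        MN: "\<And>B. B \<in> sets borel \<Longrightarrow> B \<subseteq> A \<Longrightarrow> cmod (\<mu> B) \<le> M"
          "\<And>B. B \<in> sets borel \<Longrightarrow> B \<subseteq> E - A \<Longrightarrow> cmod (\<mu> B) \<le> N"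
        by metis
      have "cmod (\<mu> B) \<le> M + N" if B: "B \<in> sets borel" "B \<subseteq> E" for B
      proof -
        have "\<mu> ((B \<inter> A) \<union> (B - A)) = \<mu> (B \<inter> A) + \<mu> (B - A)"
          using A B by (intro cm_Un[OF \<mu>]) auto
        moreover have "(B \<inter> A) \<union> (B - A) = B" by blast
        moreover have "cmod (\<mu> (B \<inter> A)) \<le> M" "cmod (\<mu> (B - A)) \<le> N"
          using A B by (auto intro!: MN)
        ultimately show ?thesis using norm_triangle_ineq[of "\<mu> (B \<inter> A)" "\<mu> (B - A)"] by simp
      qed
      then show False using that unfolding bad_def by (meson not_less)
    qed
    then show ?thesis using big A by blast
  qed
  have "\<exists>E. \<forall>n::nat. bad (E n) \<and> E (Suc n) \<subseteq> E n \<and> cmod (\<mu> (E n - E (Suc n))) > 1"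
    by (rule dependent_nat_choice) (use bad_UNIV step in blast)+
  then obtain E where E: "\<And>n::nat. bad (E n)" "\<And>n. E (Suc n) \<subseteq> E n"
      "\<And>n. cmod (\<mu> (E n - E (Suc n))) > 1" by blast
  define D where "D n = E n - E (Suc n)" for n
  have anti: "E m \<subseteq> E n" if "n \<le> m" for n m
    using lift_Suc_antimono_le[of E, OF E(2) that] .
  have "D m \<inter> D n = {}" if "m < n" for m n
    using anti[of "Suc m" n] that by (auto simp: D_def)
  then have "disjoint_family D"
    unfolding disjoint_family_on_def by (metis inf_commute linorder_neqE_nat)
  moreover have "range D \<subseteq> sets borel" using E(1) by (auto simp: D_def bad_def)
  ultimately have "(\<lambda>n. \<mu> (D n)) sums \<mu> (\<Union>n. D n)" by (intro cm_sums[OF \<mu>])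
  then have "(\<lambda>n. \<mu> (D n)) \<longlonglongrightarrow> 0" by (rule summable_LIMSEQ_zero[OF sums_summable])
  then have "eventually (\<lambda>n. cmod (\<mu> (D n)) < 1) sequentially"
    using order_tendstoD(2)[OF tendsto_norm_zero zero_less_one] by blast
  then obtain n where "cmod (\<mu> (D n)) < 1" by (auto simp: eventually_sequentially)
  then show False using E(3)[of n] by (simp add: D_def)
qed

abbreviation partition_sums :: "'a::topological_space cmeas \<Rightarrow> 'a set \<Rightarrow> real set" where
  "partition_sums \<mu> E \<equiv>
     {\<Sum>A\<in>P. cmod (\<mu> A) | P. finite P \<and> P \<subseteq> sets borel \<and> disjoint P \<and> \<Union>P = E}"

text \<open>Over cells on which the real (or imaginary) part has a fixed sign, the absolute values
  add up to that of the union, which is bounded by \<open>M\<close>. Two parts with two signs each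
  give \<open>4 * M\<close>.\<close>

lemma partition_sums_bounded:
  fixes \<mu> :: "'a::topological_space cmeas"
  assumes \<mu>: "\<mu> \<in> complex_measures"
  shows "\<exists>M. \<forall>P. finite P \<and> P \<subseteq> sets borel \<and> disjoint P \<longrightarrow> (\<Sum>A\<in>P. cmod (\<mu> A)) \<le> M"
proof -
  obtain M where M: "\<And>A. A \<in> sets borel \<Longrightarrow> cmod (\<mu> A) \<le> M" using cm_bounded[OF \<mu>] by blast
  have part: "(\<Sum>A\<in>P. \<bar>f (\<mu> A)\<bar>) \<le> 2 * M"
    if P: "finite P" "P \<subseteq> sets borel" "disjoint P" and f: "linear f" "\<And>z. \<bar>f z\<bar> \<le> cmod z"
    for P and f :: "complex \<Rightarrow> real"
  proof -
    define Q where "Q = {A\<in>P. f (\<mu> A) \<ge> 0}"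
    have bnd: "\<bar>\<Sum>A\<in>R. f (\<mu> A)\<bar> \<le> M" if "R \<subseteq> P" for R
    proof -
      have R: "finite R" "R \<subseteq> sets borel" "disjoint R"
        using that P by (auto intro: finite_subset pairwise_subset)
      have "\<mu> (\<Union>A\<in>R. A) = (\<Sum>A\<in>R. \<mu> A)"
        using R by (intro cm_UN[OF \<mu>]) (auto simp: disjoint_family_on_def pairwise_def disjnt_def)
      then have "(\<Sum>A\<in>R. f (\<mu> A)) = f (\<mu> (\<Union>R))" using f(1) by (simp add: linear_sum)
      also have "\<bar>\<dots>\<bar> \<le> M" using f(2) M[of "\<Union>R"] R by (meson order_trans sets.finite_Union)
      finally show ?thesis .
    qed
    have "(\<Sum>A\<in>P. \<bar>f (\<mu> A)\<bar>) = (\<Sum>A\<in>Q. \<bar>f (\<mu> A)\<bar>) + (\<Sum>A\<in>P - Q. \<bar>f (\<mu> A)\<bar>)"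
      using P(1) by (subst sum.subset_diff[of Q P]) (auto simp: Q_def)
    also have "(\<Sum>A\<in>Q. \<bar>f (\<mu> A)\<bar>) = (\<Sum>A\<in>Q. f (\<mu> A))"
      by (rule sum.cong) (auto simp: Q_def)
    also have "(\<Sum>A\<in>P - Q. \<bar>f (\<mu> A)\<bar>) = - (\<Sum>A\<in>P - Q. f (\<mu> A))"
      unfolding sum_negf[symmetric] by (rule sum.cong) (auto simp: Q_def)
    finally show ?thesis using bnd[of Q] bnd[of "P - Q"] by (auto simp: Q_def)
  qed
  have "(\<Sum>A\<in>P. cmod (\<mu> A)) \<le> 4 * M" if P: "finite P" "P \<subseteq> sets borel" "disjoint P" for P
  proof -
    have "(\<Sum>A\<in>P. cmod (\<mu> A)) \<le> (\<Sum>A\<in>P. \<bar>Re (\<mu> A)\<bar> + \<bar>Im (\<mu> A)\<bar>)"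
      by (intro sum_mono cmod_le)
    also have "\<dots> \<le> 2 * M + 2 * M"
      unfolding sum.distrib
      using part[OF P, of Re] part[OF P, of Im] abs_Re_le_cmod abs_Im_le_cmod
      by (intro add_mono) (auto intro: bounded_linear.linear bounded_linear_Re bounded_linear_Im)
    finally show ?thesis by simp
  qed
  then show ?thesis by blast
qed

lemma tv_bdd:
  assumes "\<mu> \<in> complex_measures"
  shows "bdd_above (partition_sums \<mu> E)"
proof -
  obtain M where "\<forall>P. finite P \<and> P \<subseteq> sets borel \<and> disjoint P \<longrightarrow> (\<Sum>A\<in>P. cmod (\<mu> A)) \<le> M"
    using partition_sums_bounded[OF assms] by blast
  then show ?thesis by (intro bdd_aboveI[of _ M]) blast
qed

text \<open>The definition of \<open>total_variation\<close> admits exact partitions only. A family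
  is completed by the remainder \<open>R\<close>, and its empty members are dropped to make the
  indexing of cells injective.\<close>

lemma tv_family_le:
  assumes \<mu>: "\<mu> \<in> complex_measures" and E: "E \<in> sets borel" and I: "finite I"
    and B: "disjoint_family_on B I" "\<And>i. i \<in> I \<Longrightarrow> B i \<in> sets borel" "\<And>i. i \<in> I \<Longrightarrow> B i \<subseteq> E"
  shows "(\<Sum>i\<in>I. cmod (\<mu> (B i))) \<le> tv \<mu> E"
proof -
  define J where "J = {i\<in>I. B i \<noteq> {}}"
  define R where "R = E - (\<Union>i\<in>I. B i)"
  have R: "R \<in> sets borel" using E I B(2) by (auto simp: R_def intro!: sets.finite_UN)
  define P where "P = insert R (B ` J)"
  have inj: "inj_on B J"
    using B(1) by (auto simp: inj_on_def J_def disjoint_family_on_def)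
  have "R \<notin> B ` J" by (auto simp: R_def J_def)
  have "disjoint (B ` J)"
    using B(1) unfolding pairwise_def disjnt_def J_def disjoint_family_on_def by fast
  then have "disjoint P"
    by (auto simp: P_def R_def J_def pairwise_insert disjnt_def)
  moreover have "finite P" "P \<subseteq> sets borel" "\<Union>P = E"
    using I B(2,3) R by (auto simp: P_def J_def R_def)
  ultimately have "(\<Sum>A\<in>P. cmod (\<mu> A)) \<in> partition_sums \<mu> E" by blast
  then have le: "(\<Sum>A\<in>P. cmod (\<mu> A)) \<le> tv \<mu> E"
    unfolding total_variation_def by (rule cSup_upper[OF _ tv_bdd[OF \<mu>]])
  have "(\<Sum>i\<in>I. cmod (\<mu> (B i))) = (\<Sum>i\<in>J. cmod (\<mu> (B i)))"
    using I \<mu> by (intro sum.mono_neutral_right) (auto simp: J_def)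
  also have "\<dots> = (\<Sum>A\<in>B ` J. cmod (\<mu> A))" using inj by (simp add: sum.reindex)
  also have "\<dots> \<le> (\<Sum>A\<in>P. cmod (\<mu> A))"
    by (rule sum_mono2) (use I in \<open>auto simp: P_def J_def\<close>)
  finally show ?thesis using le by simp
qed

text \<open>The partition consisting of the Borel set \<open>E\<close> alone ensures that the
  supremum is over a nonempty set.\<close>

lemma tv_least:
  assumes E: "E \<in> sets borel"
    and le: "\<And>P. finite P \<Longrightarrow> P \<subseteq> sets borel \<Longrightarrow> disjoint P \<Longrightarrow> \<Union>P = E \<Longrightarrow> (\<Sum>A\<in>P. cmod (\<mu> A)) \<le> c"
  shows "tv \<mu> E \<le> c"
  unfolding total_variation_def
proof (rule cSup_least)
  have "cmod (\<mu> E) \<in> partition_sums \<mu> E"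
    using E by (intro CollectI exI[of _ "{E}"]) auto
  then show "partition_sums \<mu> E \<noteq> {}" by blast
qed (use le in blast)

lemma tv_ge: "\<mu> \<in> complex_measures \<Longrightarrow> E \<in> sets borel \<Longrightarrow> cmod (\<mu> E) \<le> tv \<mu> E"
  using tv_family_le[of \<mu> E "{()}" "\<lambda>_. E"] by (simp add: disjoint_family_on_def)

lemma tv_nonneg: "\<mu> \<in> complex_measures \<Longrightarrow> E \<in> sets borel \<Longrightarrow> 0 \<le> tv \<mu> E"
  using tv_ge[of \<mu> E] norm_ge_zero order_trans by blast

lemma tv_mono:
  assumes "\<mu> \<in> complex_measures" "A \<in> sets borel" "E \<in> sets borel" "A \<subseteq> E"
  shows "tv \<mu> A \<le> tv \<mu> E"
proof (rule tv_least[OF assms(2)])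
  fix P assume P: "finite P" "P \<subseteq> sets borel" "disjoint P" "\<Union>P = A"
  then show "(\<Sum>A\<in>P. cmod (\<mu> A)) \<le> tv \<mu> E"
    using assms by (intro tv_family_le) (auto simp: disjoint_family_on_def pairwise_def disjnt_def)
qed

text \<open>For one inequality, nearly optimal partitions of the sets \<open>A n\<close> are put
  together; for the other, a partition of the union is cut along the sets \<open>A n\<close> and
  countable additivity of \<mu> is used on each cell.\<close>

lemma tv_sums:
  fixes \<mu> :: "'a::topological_space cmeas" and A :: "nat \<Rightarrow> 'a set"
  assumes \<mu>: "\<mu> \<in> complex_measures" and A: "range A \<subseteq> sets borel" "disjoint_family A"
  shows "(\<lambda>n. tv \<mu> (A n)) sums tv \<mu> (\<Union>n. A n)"
proof -
  let ?E = "\<Union>n. A n"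
  have E: "?E \<in> sets borel" using A(1) by (intro sets.countable_UN) auto
  have An: "A n \<in> sets borel" for n using A(1) by blast
  have partial: "(\<Sum>n<N. tv \<mu> (A n)) \<le> tv \<mu> ?E" for N
  proof (rule field_le_epsilon)
    fix e :: real assume e: "e > 0"
    \<comment> \<open>\<open>N\<close> errors of size \<open>d\<close> amount to at most
      \<open>e\<close>; the successor keeps the denominator positive for
      \<open>N = 0\<close>.\<close>
    define d where "d = e / Suc N"
    have d: "d > 0" using e by (simp add: d_def)
    have "\<exists>P. finite P \<and> P \<subseteq> sets borel \<and> disjoint P \<and> \<Union>P = A n \<and>
        tv \<mu> (A n) - d < (\<Sum>B\<in>P. cmod (\<mu> B))" for n
    proof (rule ccontr)
      assume "\<not> ?thesis"
      then have "tv \<mu> (A n) \<le> tv \<mu> (A n) - d"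
        by (intro tv_least[OF An]) (force simp: not_less)
      then show False using d by simp
    qed
    then obtain P where P: "\<And>n. finite (P n)" "\<And>n. P n \<subseteq> sets borel" "\<And>n. disjoint (P n)"
        "\<And>n. \<Union>(P n) = A n" "\<And>n. tv \<mu> (A n) - d < (\<Sum>B\<in>P n. cmod (\<mu> B))"
      by metis
    \<comment> \<open>Cells are indexed by pairs, since the empty set may be a cell of several
      partitions.\<close>
    define I where "I = (SIGMA n:{..<N}. P n)"
    have "(\<Sum>i\<in>I. cmod (\<mu> (snd i))) \<le> tv \<mu> ?E"
    proof (rule tv_family_le[OF \<mu> E])
      show "finite I" using P(1) by (simp add: I_def)
      show "disjoint_family_on snd I"
        unfolding disjoint_family_on_def
      proof (intro ballI impI)
        fix i j assume ij: "i \<in> I" "j \<in> I" "i \<noteq> j"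
        show "snd i \<inter> snd j = {}"
        proof (cases "fst i = fst j")
          case True
          then have "snd i \<noteq> snd j" "snd i \<in> P (fst j)" "snd j \<in> P (fst j)"
            using ij by (auto simp: I_def prod_eq_iff)
          then show ?thesis using P(3)[of "fst j"] by (simp add: pairwise_def disjnt_def)
        next
          case False
          then have "A (fst i) \<inter> A (fst j) = {}" using A(2) by (simp add: disjoint_family_on_def)
          moreover have "snd i \<subseteq> A (fst i)" "snd j \<subseteq> A (fst j)"
            unfolding P(4)[symmetric] using ij by (auto simp: I_def)
          ultimately show ?thesis by blast
        qed
      qed
      show "snd i \<in> sets borel" "snd i \<subseteq> ?E" if "i \<in> I" for i
        using that P(2,4) by (fastforce simp: I_def)+
    qed
    moreover have "(\<Sum>i\<in>I. cmod (\<mu> (snd i))) = (\<Sum>n<N. \<Sum>B\<in>P n. cmod (\<mu> B))"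
      unfolding I_def using P(1) by (subst sum.Sigma) (auto simp: split_def)
    moreover have "(\<Sum>n<N. tv \<mu> (A n)) \<le> (\<Sum>n<N. (\<Sum>B\<in>P n. cmod (\<mu> B)) + d)"
      using P(5) by (intro sum_mono) (simp add: less_imp_le algebra_simps)
    moreover have "(\<Sum>n<N. (\<Sum>B\<in>P n. cmod (\<mu> B)) + d) \<le> (\<Sum>n<N. \<Sum>B\<in>P n. cmod (\<mu> B)) + e"
    proof -
      have "real N * d \<le> e" using e by (simp add: d_def field_simps)
      then show ?thesis by (simp add: sum.distrib)
    qed
    ultimately show "(\<Sum>n<N. tv \<mu> (A n)) \<le> tv \<mu> ?E + e" by linarith
  qed
  have pos: "0 \<le> tv \<mu> (A n)" for n by (rule tv_nonneg[OF \<mu> An])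
  have sm: "summable (\<lambda>n. tv \<mu> (A n))"
    by (rule summableI_nonneg_bounded[OF pos partial])
  have "(\<Sum>n. tv \<mu> (A n)) \<le> tv \<mu> ?E"
    by (rule suminf_le_const[OF sm partial])
  moreover have "tv \<mu> ?E \<le> (\<Sum>n. tv \<mu> (A n))"
  proof (rule tv_least[OF E])
    fix P assume P: "finite P" "P \<subseteq> sets borel" "disjoint P" "\<Union>P = ?E"
    have fam: "(\<Sum>B\<in>P. cmod (\<mu> (B \<inter> A n))) \<le> tv \<mu> (A n)" for n
      using P An by (intro tv_family_le[OF \<mu>])
        (auto simp: disjoint_family_on_def pairwise_def disjnt_def)
    have smB: "summable (\<lambda>n. cmod (\<mu> (B \<inter> A n)))" if "B \<in> P" for B
    proof (rule summable_comparison_test'[OF sm, of 0])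
      show "norm (cmod (\<mu> (B \<inter> A n))) \<le> tv \<mu> (A n)" for n
        using member_le_sum[of B P "\<lambda>B. cmod (\<mu> (B \<inter> A n))"] fam[of n] that P(1) by simp
    qed
    have "cmod (\<mu> B) \<le> (\<Sum>n. cmod (\<mu> (B \<inter> A n)))" if B: "B \<in> P" for B
    proof -
      have "disjoint_family (\<lambda>n. B \<inter> A n)" using A(2) unfolding disjoint_family_on_def by blast
      then have "(\<lambda>n. \<mu> (B \<inter> A n)) sums \<mu> (\<Union>n. B \<inter> A n)"
        using B P(2) An by (intro cm_sums[OF \<mu>]) auto
      moreover have "(\<Union>n. B \<inter> A n) = B" using B P(4) by blast
      ultimately have "\<mu> B = (\<Sum>n. \<mu> (B \<inter> A n))" by (simp add: sums_iff)
      then show ?thesis using summable_norm[OF smB[OF B]] by simp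
    qed
    then have "(\<Sum>B\<in>P. cmod (\<mu> B)) \<le> (\<Sum>B\<in>P. \<Sum>n. cmod (\<mu> (B \<inter> A n)))"
      by (rule sum_mono)
    also have "\<dots> = (\<Sum>n. \<Sum>B\<in>P. cmod (\<mu> (B \<inter> A n)))"
      using smB by (simp add: suminf_sum)
    also have "\<dots> \<le> (\<Sum>n. tv \<mu> (A n))"
      using fam smB sm by (intro suminf_le summable_sum) auto
    finally show "(\<Sum>B\<in>P. cmod (\<mu> B)) \<le> (\<Sum>n. tv \<mu> (A n))" .
  qed
  ultimately show ?thesis using sm by (simp add: sums_iff)
qed

text \<open>With a pointwise bound as premise it covers sums and also the recovery of a measure from
  another one and their difference.\<close>

lemma tv_triangle:
  assumes "\<mu> \<in> complex_measures" "\<nu> \<in> complex_measures" "E \<in> sets borel"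
    and le: "\<And>A. A \<in> sets borel \<Longrightarrow> cmod (\<rho> A) \<le> cmod (\<mu> A) + cmod (\<nu> A)"
  shows "tv \<rho> E \<le> tv \<mu> E + tv \<nu> E"
proof (rule tv_least[OF assms(3)])
  fix P assume P: "finite P" "P \<subseteq> sets borel" "disjoint P" "\<Union>P = E"
  have "(\<Sum>A\<in>P. cmod (\<rho> A)) \<le> (\<Sum>A\<in>P. cmod (\<mu> A)) + (\<Sum>A\<in>P. cmod (\<nu> A))"
    unfolding sum.distrib[symmetric] using P by (intro sum_mono le) auto
  also have "\<dots> \<le> tv \<mu> E + tv \<nu> E"
    using P assms by (intro add_mono tv_family_le) (auto simp: disjoint_family_on_def pairwise_def disjnt_def)
  finally show "(\<Sum>A\<in>P. cmod (\<rho> A)) \<le> tv \<mu> E + tv \<nu> E" .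
qed

lemma tv_le_scaled:
  assumes "\<mu> \<in> complex_measures" "E \<in> sets borel" "c \<ge> 0"
    and le: "\<And>A. A \<in> sets borel \<Longrightarrow> A \<subseteq> E \<Longrightarrow> cmod (\<rho> A) \<le> c * cmod (\<mu> A)"
  shows "tv \<rho> E \<le> c * tv \<mu> E"
proof (rule tv_least[OF assms(2)])
  fix P assume P: "finite P" "P \<subseteq> sets borel" "disjoint P" "\<Union>P = E"
  have "(\<Sum>A\<in>P. cmod (\<rho> A)) \<le> c * (\<Sum>A\<in>P. cmod (\<mu> A))"
    unfolding sum_distrib_left using P by (intro sum_mono le) auto
  also have "\<dots> \<le> c * tv \<mu> E"
    using P assms by (intro mult_left_mono tv_family_le) (auto simp: disjoint_family_on_def pairwise_def disjnt_def)
  finally show "(\<Sum>A\<in>P. cmod (\<rho> A)) \<le> c * tv \<mu> E" .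
qed

text \<open>Bounds on the cells add up to the value of the additive \<rho> on the union: the
  variation is the least measure above the moduli.\<close>

lemma tv_dominated:
  assumes "\<rho> \<in> complex_measures" "E \<in> sets borel"
    and le: "\<And>A. A \<in> sets borel \<Longrightarrow> A \<subseteq> E \<Longrightarrow> cmod (\<mu> A) \<le> Re (\<rho> A)"
  shows "tv \<mu> E \<le> Re (\<rho> E)"
proof (rule tv_least[OF assms(2)])
  fix P assume P: "finite P" "P \<subseteq> sets borel" "disjoint P" "\<Union>P = E"
  have "(\<Sum>A\<in>P. cmod (\<mu> A)) \<le> (\<Sum>A\<in>P. Re (\<rho> A))"
    using P by (intro sum_mono le) auto
  also have "\<dots> = Re (\<rho> (\<Union>A\<in>P. A))"
    using P by (subst cm_UN[OF assms(1)]) (auto simp: disjoint_family_on_def pairwise_def disjnt_def)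
  finally show "(\<Sum>A\<in>P. cmod (\<mu> A)) \<le> Re (\<rho> E)" using P by simp
qed

section \<open>The normed space of regular measures\<close>

lemma MK_simps [simp]:
  "vadd MK \<mu> \<nu> = (\<lambda>A. \<mu> A + \<nu> A)"
  "vzero MK = (\<lambda>A. 0)"
  "vscale MK c \<mu> = (\<lambda>A. c * \<mu> A)"
  "vnorm MK \<mu> = tv \<mu> UNIV"
  "vdiff MK \<mu> \<nu> = (\<lambda>A. \<mu> A - \<nu> A)"
  by (simp_all add: MK_def vdiff_def)

lemma MK_cm: "\<mu> \<in> carr MK \<Longrightarrow> \<mu> \<in> complex_measures"
  by (simp add: MK_def)

lemma cm_add: "\<mu> \<in> complex_measures \<Longrightarrow> \<nu> \<in> complex_measures \<Longrightarrow> (\<lambda>A. \<mu> A + \<nu> A) \<in> complex_measures"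
  by (rule complex_measuresI) (auto simp: cm_outside intro!: sums_add cm_sums)

lemma cm_scale: "\<mu> \<in> complex_measures \<Longrightarrow> (\<lambda>A. c * \<mu> A) \<in> complex_measures"
  by (rule complex_measuresI) (auto simp: cm_outside intro!: sums_mult cm_sums)

lemma borel_open_minus_compact:
  fixes U C :: "'a::t2_space set"
  shows "open U \<Longrightarrow> compact C \<Longrightarrow> U - C \<in> sets borel"
  by (intro sets.Diff) (auto intro: borel_closed compact_imp_closed)

lemma MK_E:
  assumes "\<mu> \<in> carr MK" "E \<in> sets borel" "e > 0"
  obtains C U where "compact C" "open U" "C \<subseteq> E" "E \<subseteq> U" "tv \<mu> (U - C) < e"
proof -
  have "regular_measure \<mu>" using assms(1) by (simp add: MK_def)
  then have "\<exists>C U. compact C \<and> open U \<and> C \<subseteq> E \<and> E \<subseteq> U \<and> tv \<mu> (U - C) < e"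
    using assms(2,3) unfolding regular_measure_def by simp
  then show ?thesis using that by metis
qed

text \<open>Regularity passes down along domination of variations. Uniting the inner sets and
  intersecting the outer ones shrinks the gap for both measures at once.\<close>

lemma MK_dominated2:
  fixes \<mu> \<nu> \<rho> :: "'a::t2_space cmeas"
  assumes \<mu>: "\<mu> \<in> carr MK" and \<nu>: "\<nu> \<in> carr MK" and \<rho>: "\<rho> \<in> complex_measures"
    and le: "\<And>E. E \<in> sets borel \<Longrightarrow> tv \<rho> E \<le> tv \<mu> E + tv \<nu> E"
  shows "\<rho> \<in> carr MK"
proof -
  have "\<exists>C U. compact C \<and> open U \<and> C \<subseteq> E \<and> E \<subseteq> U \<and> tv \<rho> (U - C) < e"
    if E: "E \<in> sets borel" "e > 0" for E e
  proof -
    have e2: "e / 2 > 0" using E by simp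
    obtain C U where CU: "compact C" "open U" "C \<subseteq> E" "E \<subseteq> U" "tv \<mu> (U - C) < e / 2"
      by (rule MK_E[OF \<mu> E(1) e2])
    obtain D V where DV: "compact D" "open V" "D \<subseteq> E" "E \<subseteq> V" "tv \<nu> (V - D) < e / 2"
      by (rule MK_E[OF \<nu> E(1) e2])
    have o: "open (U \<inter> V)" "compact (C \<union> D)" using CU DV by auto
    have "tv \<mu> (U \<inter> V - (C \<union> D)) \<le> tv \<mu> (U - C)"
      "tv \<nu> (U \<inter> V - (C \<union> D)) \<le> tv \<nu> (V - D)"
      using CU DV o MK_cm[OF \<mu>] MK_cm[OF \<nu>] by (auto intro!: tv_mono borel_open_minus_compact)
    then have "tv \<rho> (U \<inter> V - (C \<union> D)) < e"
      using le[OF borel_open_minus_compact[OF o]] CU(5) DV(5) by linarith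
    then show ?thesis using CU DV o by (intro exI[of _ "C \<union> D"] exI[of _ "U \<inter> V"]) auto
  qed
  then show ?thesis using \<rho> by (simp add: MK_def regular_measure_def)
qed

lemma MK_dominated:
  fixes \<mu> \<rho> :: "'a::t2_space cmeas"
  assumes \<mu>: "\<mu> \<in> carr MK" and \<rho>: "\<rho> \<in> complex_measures" and c: "c \<ge> 0"
    and le: "\<And>E. E \<in> sets borel \<Longrightarrow> tv \<rho> E \<le> c * tv \<mu> E"
  shows "\<rho> \<in> carr MK"
proof -
  have "\<exists>C U. compact C \<and> open U \<and> C \<subseteq> E \<and> E \<subseteq> U \<and> tv \<rho> (U - C) < e"
    if E: "E \<in> sets borel" "e > 0" for E e
  proof -
    \<comment> \<open>The denominator is \<open>c + 1\<close> to allow for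
      \<open>c = 0\<close>.\<close>
    obtain C U where CU: "compact C" "open U" "C \<subseteq> E" "E \<subseteq> U"
        "tv \<mu> (U - C) < e / (c + 1)"
      by (rule MK_E[OF \<mu> E(1), of "e / (c + 1)"]) (use E c in auto)
    have b: "U - C \<in> sets borel" by (rule borel_open_minus_compact) fact+
    have "c * tv \<mu> (U - C) \<le> (c + 1) * tv \<mu> (U - C)"
      using tv_nonneg[OF MK_cm[OF \<mu>] b] by (intro mult_right_mono) auto
    also have "\<dots> < e" using CU(5) c by (simp add: field_simps)
    finally show ?thesis using le[OF b] CU by fastforce
  qed
  then show ?thesis using \<rho> by (simp add: MK_def regular_measure_def)
qed

lemma tv_zero [simp]:
  assumes "E \<in> sets borel"
  shows "tv (\<lambda>A. 0) E = 0"
proof -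
  have "(\<lambda>A. 0) \<in> complex_measures" by (rule complex_measuresI) auto
  then show ?thesis
    by (intro antisym tv_least tv_nonneg assms) auto
qed

lemma MK_zero [simp]: "(\<lambda>A. 0) \<in> carr (MK :: 'a::t2_space cmeas cnspace)"
proof -
  have "regular_measure ((\<lambda>A. 0) :: 'a cmeas)"
    unfolding regular_measure_def
  proof (intro ballI allI impI)
    fix E :: "'a set" and e :: real assume "e > 0"
    then show "\<exists>C U. compact C \<and> open U \<and> C \<subseteq> E \<and> E \<subseteq> U \<and> tv (\<lambda>A. 0) (U - C) < e"
      by (intro exI[of _ "{}"] exI[of _ UNIV]) auto
  qed
  moreover have "(\<lambda>A. 0) \<in> complex_measures" by (rule complex_measuresI) auto
  ultimately show ?thesis by (simp add: MK_def)
qed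

lemma tv_add:
  "\<mu> \<in> complex_measures \<Longrightarrow> \<nu> \<in> complex_measures \<Longrightarrow> E \<in> sets borel \<Longrightarrow>
    tv (\<lambda>A. \<mu> A + \<nu> A) E \<le> tv \<mu> E + tv \<nu> E"
  by (rule tv_triangle) (auto intro: norm_triangle_ineq)

lemma tv_scale_le:
  "\<mu> \<in> complex_measures \<Longrightarrow> E \<in> sets borel \<Longrightarrow>
    tv (\<lambda>A. c * \<mu> A) E \<le> cmod c * tv \<mu> E"
  by (rule tv_le_scaled) (auto simp: norm_mult)

lemma MK_add [simp]:
  fixes \<mu> \<nu> :: "'a::t2_space cmeas"
  shows "\<mu> \<in> carr MK \<Longrightarrow> \<nu> \<in> carr MK \<Longrightarrow> (\<lambda>A. \<mu> A + \<nu> A) \<in> carr MK"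
  by (rule MK_dominated2[of \<mu> \<nu>]) (auto intro: cm_add tv_add dest: MK_cm)

lemma MK_scale [simp]:
  fixes \<mu> :: "'a::t2_space cmeas"
  shows "\<mu> \<in> carr MK \<Longrightarrow> (\<lambda>A. c * \<mu> A) \<in> carr MK"
  by (rule MK_dominated[of \<mu> _ "cmod c"]) (auto intro: cm_scale tv_scale_le dest: MK_cm)

lemma MK_uminus [simp]:
  fixes \<mu> :: "'a::t2_space cmeas"
  shows "\<mu> \<in> carr MK \<Longrightarrow> (\<lambda>A. - \<mu> A) \<in> carr MK"
  using MK_scale[of \<mu> "-1"] by simp

lemma MK_diff [simp]:
  fixes \<mu> \<nu> :: "'a::t2_space cmeas"
  shows "\<mu> \<in> carr MK \<Longrightarrow> \<nu> \<in> carr MK \<Longrightarrow> (\<lambda>A. \<mu> A - \<nu> A) \<in> carr MK"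
  using MK_add[of \<mu> "\<lambda>A. - \<nu> A"] by simp

lemma MK_sum [simp]:
  fixes f :: "'i \<Rightarrow> 'a::t2_space cmeas"
  shows "(\<And>i. i \<in> I \<Longrightarrow> f i \<in> carr MK) \<Longrightarrow> (\<lambda>A. \<Sum>i\<in>I. f i A) \<in> carr MK"
  by (induction I rule: infinite_finite_induct) auto

text \<open>The reverse inequality is the same estimate for the factor \<open>1 / c\<close>.\<close>

lemma tv_scale:
  assumes \<mu>: "\<mu> \<in> complex_measures" and E: "E \<in> sets borel"
  shows "tv (\<lambda>A. c * \<mu> A) E = cmod c * tv \<mu> E"
proof (cases "c = 0")
  case False
  have "tv \<mu> E \<le> cmod (1 / c) * tv (\<lambda>A. c * \<mu> A) E"
    using tv_scale_le[OF cm_scale[OF \<mu>] E, of "1 / c" c] False by simp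
  then have "cmod c * tv \<mu> E \<le> tv (\<lambda>A. c * \<mu> A) E"
    using False by (simp add: norm_divide field_simps)
  then show ?thesis using tv_scale_le[OF \<mu> E, of c] by simp
qed (use E in simp)

lemma MK_norm_ge:
  fixes \<mu> :: "'a::t2_space cmeas"
  assumes "\<mu> \<in> carr MK"
  shows "cmod (\<mu> A) \<le> tv \<mu> UNIV"
proof (cases "A \<in> sets borel")
  case True
  then show ?thesis using tv_ge[of \<mu> A] tv_mono[of \<mu> A UNIV] MK_cm[OF assms] by fastforce
next
  case False
  then show ?thesis using tv_nonneg[of \<mu> UNIV] cm_outside[of \<mu> A] MK_cm[OF assms] by simp
qed

lemma complex_normed_MK: "complex_normed_space (MK :: 'a::t2_space cmeas cnspace)"
proof -
  have "tv x UNIV = 0 \<longleftrightarrow> x = (\<lambda>A. 0)" if "x \<in> carr MK" for x :: "'a cmeas"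
    using MK_norm_ge[OF that] by (auto intro!: ext)
  then show ?thesis
    unfolding complex_normed_space_def
    by (auto simp: algebra_simps MK_cm tv_scale tv_add tv_nonneg)
qed

section \<open>Real part, variation and Jordan decomposition\<close>

definition re_part :: "'a cmeas \<Rightarrow> 'a cmeas" where
  "re_part \<mu> = (\<lambda>A. of_real (Re (\<mu> A)))"

text \<open>The variation as an element of M(K), so that it can be convolved.\<close>

definition tv_measure :: "'a::topological_space cmeas \<Rightarrow> 'a cmeas" where
  "tv_measure \<mu> = (\<lambda>A. if A \<in> sets borel then of_real (tv \<mu> A) else 0)"

lemma re_part_cm: "\<mu> \<in> complex_measures \<Longrightarrow> re_part \<mu> \<in> complex_measures"
  unfolding re_part_def
  by (rule complex_measuresI) (auto simp: cm_outside intro!: sums_of_real sums_Re cm_sums)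

lemma tv_measure_cm: "\<mu> \<in> complex_measures \<Longrightarrow> tv_measure \<mu> \<in> complex_measures"
proof (rule complex_measuresI)
  fix A :: "nat \<Rightarrow> 'a set"
  assume "\<mu> \<in> complex_measures" and A: "range A \<subseteq> sets borel" "disjoint_family A"
  then have "(\<lambda>n. complex_of_real (tv \<mu> (A n))) sums of_real (tv \<mu> (\<Union>n. A n))"
    by (intro sums_of_real tv_sums)
  moreover have "(\<Union>n. A n) \<in> sets borel" using A by (intro sets.countable_UN) auto
  ultimately show "(\<lambda>n. tv_measure \<mu> (A n)) sums tv_measure \<mu> (\<Union>n. A n)"
    using A by (simp add: tv_measure_def range_subsetD)
qed (simp add: tv_measure_def)

lemma re_part_MK [simp]:
  fixes \<mu> :: "'a::t2_space cmeas"
  assumes "\<mu> \<in> carr MK"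
  shows "re_part \<mu> \<in> carr MK"
proof (rule MK_dominated[OF assms])
  show "re_part \<mu> \<in> complex_measures" using assms by (intro re_part_cm MK_cm)
  show "tv (re_part \<mu>) E \<le> 1 * tv \<mu> E" if "E \<in> sets borel" for E
    by (rule tv_le_scaled[OF MK_cm[OF assms] that]) (simp_all add: re_part_def abs_Re_le_cmod)
qed simp

lemma re_part_norm_le:
  fixes \<mu> :: "'a::t2_space cmeas"
  assumes "\<mu> \<in> carr MK"
  shows "tv (re_part \<mu>) UNIV \<le> tv \<mu> UNIV"
  using tv_le_scaled[OF MK_cm[OF assms], of UNIV 1 "re_part \<mu>"]
  by (simp add: re_part_def abs_Re_le_cmod)

lemma MK_posD:
  assumes "\<mu> \<in> MK_pos"
  shows "\<mu> \<in> carr MK" "0 \<le> Re (\<mu> A)" "Im (\<mu> A) = 0" "\<mu> A = of_real (Re (\<mu> A))" "cmod (\<mu> A) = Re (\<mu> A)"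
  using assms by (auto simp: MK_pos_def complex_nonneg_Reals_iff complex_eq_iff cmod_def)

lemma MK_posI: "\<mu> \<in> carr MK \<Longrightarrow> (\<And>A. 0 \<le> Re (\<mu> A)) \<Longrightarrow> (\<And>A. Im (\<mu> A) = 0) \<Longrightarrow> \<mu> \<in> MK_pos"
  by (simp add: MK_pos_def complex_nonneg_Reals_iff)

lemma tv_pos:
  fixes \<mu> :: "'a::t2_space cmeas"
  assumes "\<mu> \<in> MK_pos" "E \<in> sets borel"
  shows "tv \<mu> E = Re (\<mu> E)"
proof (rule antisym)
  show "tv \<mu> E \<le> Re (\<mu> E)"
    by (rule tv_dominated) (use assms MK_posD[OF assms(1)] MK_cm in auto)
  show "Re (\<mu> E) \<le> tv \<mu> E"
    using tv_ge[of \<mu> E] assms MK_posD[OF assms(1)] by (simp add: MK_cm)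
qed

text \<open>Regularity is inherited from \<mu>: by domination, the variation of the variation does
  not exceed the variation itself.\<close>

lemma tv_measure_pos [simp]:
  fixes \<mu> :: "'a::t2_space cmeas"
  assumes \<mu>: "\<mu> \<in> carr MK"
  shows "tv_measure \<mu> \<in> MK_pos"
proof (rule MK_posI)
  have "tv (tv_measure \<mu>) E \<le> tv \<mu> E" if "E \<in> sets borel" for E
    using tv_dominated[OF tv_measure_cm[OF MK_cm[OF \<mu>]] that, of "tv_measure \<mu>"] that MK_cm[OF \<mu>]
    by (simp add: tv_measure_def tv_nonneg)
  then show "tv_measure \<mu> \<in> carr MK"
    using MK_dominated[of \<mu> "tv_measure \<mu>" 1] \<mu> by (simp add: tv_measure_cm MK_cm)
qed (auto simp: tv_measure_def tv_nonneg MK_cm[OF \<mu>])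

lemma MK_pos_add: "\<mu> \<in> MK_pos \<Longrightarrow> \<nu> \<in> MK_pos \<Longrightarrow> (\<lambda>A. \<mu> A + \<nu> A) \<in> MK_pos"
  for \<mu> \<nu> :: "'a::t2_space cmeas"
  by (rule MK_posI) (auto simp: MK_posD(1-3))

lemma MK_pos_scale: "\<mu> \<in> MK_pos \<Longrightarrow> 0 \<le> r \<Longrightarrow> (\<lambda>A. complex_of_real r * \<mu> A) \<in> MK_pos"
  for \<mu> :: "'a::t2_space cmeas"
  by (rule MK_posI) (auto simp: MK_posD(1-3))

text \<open>The parts are half of the variation plus and minus the real part \<open>r\<close>. Both
  are nonnegative because the variation of \<open>r\<close> dominates its modulus, and both have
  mass at most that of the variation.\<close>

lemma jordan_real:
  fixes \<mu> :: "'a::t2_space cmeas"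
  assumes \<mu>: "\<mu> \<in> carr MK"
  obtains p q where "p \<in> MK_pos" "q \<in> MK_pos" "re_part \<mu> = (\<lambda>A. p A - q A)"
    "Re (p UNIV) \<le> tv \<mu> UNIV" "Re (q UNIV) \<le> tv \<mu> UNIV"
proof -
  define r where "r = re_part \<mu>"
  have r: "r \<in> carr MK" using \<mu> by (simp add: r_def)
  define h where "h s A = (1/2) * (tv_measure r A + complex_of_real s * r A)" for s :: real and A
  have tvr: "tv_measure r \<in> carr MK" using MK_posD(1)[OF tv_measure_pos[OF r]] .
  have hpos: "h s \<in> MK_pos" if s: "s = 1 \<or> s = - 1" for s
  proof (rule MK_posI)
    have "(\<lambda>A. complex_of_real s * r A) \<in> carr MK" by (rule MK_scale[OF r])
    from MK_scale[OF MK_add[OF tvr this], of "1/2"] show "h s \<in> carr MK"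
      by (simp add: h_def[abs_def])
    have "\<bar>Re (r A)\<bar> \<le> Re (tv_measure r A)" for A
    proof (cases "A \<in> sets borel")
      case True
      then show ?thesis using tv_ge[OF MK_cm[OF r] True] abs_Re_le_cmod[of "r A"]
        by (simp add: tv_measure_def)
    qed (simp add: cm_outside[OF MK_cm[OF r]] tv_measure_def)
    from abs_le_D1[OF this] abs_le_D2[OF this] show "0 \<le> Re (h s A)" for A
      using s by (auto simp: h_def add_nonneg_nonneg) (smt (verit))+
    show "Im (h s A) = 0" for A by (simp add: h_def r_def re_part_def tv_measure_def)
  qed
  have hle: "Re (h s UNIV) \<le> tv \<mu> UNIV" if s: "s = 1 \<or> s = - 1" for s
  proof -
    have "\<bar>Re (r UNIV)\<bar> \<le> tv r UNIV"
      using tv_ge[OF MK_cm[OF r], of UNIV] abs_Re_le_cmod[of "r UNIV"] by simp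
    then have "Re (h s UNIV) \<le> tv r UNIV"
      using s by (auto simp: h_def tv_measure_def)
    also have "\<dots> \<le> tv \<mu> UNIV" unfolding r_def by (rule re_part_norm_le[OF \<mu>])
    finally show ?thesis .
  qed
  have "re_part \<mu> = (\<lambda>A. h 1 A - h (- 1) A)"
    by (auto simp: r_def[symmetric] h_def field_simps)
  then show ?thesis by (intro that[of "h 1" "h (- 1)"] hpos hle) auto
qed

text \<open>The imaginary part of a measure is the real part of its product with -i, so two real
  decompositions give four nonnegative parts. The bound on their masses is what later bounds the
  product.\<close>

lemma jordan_complex:
  fixes \<mu> :: "'a::t2_space cmeas"
  assumes \<mu>: "\<mu> \<in> carr MK"
  obtains p :: "nat \<Rightarrow> 'a cmeas" where "\<And>k. p k \<in> MK_pos" "\<mu> = (\<lambda>A. \<Sum>k<4. \<i> ^ k * p k A)"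
    "\<And>k. Re (p k UNIV) \<le> tv \<mu> UNIV"
proof -
  let ?\<nu> = "\<lambda>A. - \<i> * \<mu> A"
  have \<nu>: "?\<nu> \<in> carr MK" using \<mu> by (rule MK_scale)
  have tv\<nu>: "tv ?\<nu> UNIV = tv \<mu> UNIV"
    using tv_scale[OF MK_cm[OF \<mu>], of UNIV "- \<i>"] by simp
  obtain a b where ab: "a \<in> MK_pos" "b \<in> MK_pos" "re_part \<mu> = (\<lambda>A. a A - b A)"
    "Re (a UNIV) \<le> tv \<mu> UNIV" "Re (b UNIV) \<le> tv \<mu> UNIV"
    by (rule jordan_real[OF \<mu>])
  obtain c d where cd: "c \<in> MK_pos" "d \<in> MK_pos" "re_part ?\<nu> = (\<lambda>A. c A - d A)"
    "Re (c UNIV) \<le> tv \<mu> UNIV" "Re (d UNIV) \<le> tv \<mu> UNIV"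
    by (rule jordan_real[OF \<nu>, unfolded tv\<nu>])
  \<comment> \<open>The order follows the coefficients 1, i, -1, -i, hence positive parts come
    before negative ones. All indices from 3 on give \<open>d\<close>, so the properties hold for
    every \<open>k\<close>.\<close>
  define p where "p k = (if k = 0 then a else if k = 1 then c else if k = 2 then b else d)" for k :: nat
  have "\<mu> A = (\<Sum>k<4. \<i> ^ k * p k A)" for A
  proof -
    have "\<mu> A = re_part \<mu> A + \<i> * re_part ?\<nu> A"
      by (simp add: re_part_def complex_eq_iff)
    also have "\<dots> = (\<Sum>k<4. \<i> ^ k * p k A)"
      unfolding ab(3) cd(3) by (simp add: p_def numeral_eq_Suc algebra_simps)
    finally show ?thesis .
  qed
  then show ?thesis using ab cd by (intro that[of p]) (auto simp: p_def)
qed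

section \<open>Point masses and probability measures\<close>

lemma dirac_cm: "dirac x \<in> complex_measures"
proof (rule complex_measuresI)
  fix A :: "nat \<Rightarrow> 'a set"
  assume A: "range A \<subseteq> sets borel" "disjoint_family A"
  then have U: "(\<Union>n. A n) \<in> sets borel" by (intro sets.countable_UN) auto
  show "(\<lambda>n. dirac x (A n)) sums dirac x (\<Union>n. A n)"
  proof (cases "\<exists>n. x \<in> A n")
    case True
    then obtain n where n: "x \<in> A n" by blast
    then have "x \<notin> A m" if "m \<noteq> n" for m using A(2) that unfolding disjoint_family_on_def by blast
    then have "dirac x (A m) = (if m = n then 1 else 0)" for m
      using n A(1) by (auto simp: dirac_def)
    moreover have "dirac x (\<Union>n. A n) = 1" using n U by (auto simp: dirac_def)
    ultimately show ?thesis using sums_single[of n "\<lambda>_. 1 :: complex"] by simp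
  next
    case False
    then show ?thesis by (simp add: dirac_def)
  qed
qed (simp add: dirac_def)

lemma dirac_PK [simp]: "dirac x \<in> (PK :: 'a::t2_space cmeas set)"
proof -
  have "\<exists>C U. compact C \<and> open U \<and> C \<subseteq> E \<and> E \<subseteq> U \<and> tv (dirac x) (U - C) < e"
    if e: "e > 0" for E and e :: real
  proof -
    \<comment> \<open>In both cases \<open>U - C\<close> misses \<open>x\<close>, and so the point
      mass has no variation there.\<close>
    define C where "C = (if x \<in> E then {x} else {})"
    define U where "U = (if x \<in> E then UNIV else - {x})"
    have CU: "compact C" "open U" by (auto simp: C_def U_def)
    have "tv (dirac x) (U - C) \<le> 0"
      by (rule tv_least[OF borel_open_minus_compact[OF CU(2,1)]])
         (auto simp: dirac_def C_def U_def intro!: sum_nonpos split: if_splits)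
    then show ?thesis using CU e by (intro exI[of _ C] exI[of _ U]) (auto simp: C_def U_def)
  qed
  then have "dirac x \<in> carr MK" by (simp add: MK_def regular_measure_def dirac_cm)
  then show ?thesis
    by (auto simp: PK_def MK_pos_def) (auto simp: dirac_def)
qed

lemma PK_D: assumes "\<mu> \<in> PK" shows "\<mu> \<in> MK_pos" "\<mu> \<in> carr MK" "\<mu> UNIV = 1"
  using assms by (auto simp: PK_def MK_pos_def)

lemma PK_norm [simp]: "\<mu> \<in> PK \<Longrightarrow> tv \<mu> UNIV = 1" for \<mu> :: "'a::t2_space cmeas"
  using tv_pos[of \<mu> UNIV] PK_D[of \<mu>] by simp

section \<open>Dual spaces\<close>

text \<open>The vector has norm 0 by homogeneity, and the norm is definite.\<close>

lemma cns_zero_scale: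
  assumes V: "complex_normed_space V" and x: "x \<in> carr V"
  shows "vscale V 0 x = vzero V"
proof -
  have "vscale V 0 x \<in> carr V" "vnorm V (vscale V 0 x) = cmod 0 * vnorm V x"
    using V x unfolding complex_normed_space_def by simp_all
  then show ?thesis using V unfolding complex_normed_space_def by simp
qed

lemma cnsD:
  assumes "complex_normed_space V"
  shows "vzero V \<in> carr V" "\<And>x y. x \<in> carr V \<Longrightarrow> y \<in> carr V \<Longrightarrow> vadd V x y \<in> carr V"
    "\<And>c x. x \<in> carr V \<Longrightarrow> vscale V c x \<in> carr V"
    "\<And>x. x \<in> carr V \<Longrightarrow> 0 \<le> vnorm V x"
    "\<And>x. x \<in> carr V \<Longrightarrow> vnorm V x = 0 \<Longrightarrow> x = vzero V"
    "\<And>c x. x \<in> carr V \<Longrightarrow> vnorm V (vscale V c x) = cmod c * vnorm V x"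
    "vnorm V (vzero V) = 0"
  using assms unfolding complex_normed_space_def by simp_all

lemma cns_subspace:
  assumes "complex_normed_space V" "S \<subseteq> carr V" "vzero V \<in> S"
    "\<And>x y. x \<in> S \<Longrightarrow> y \<in> S \<Longrightarrow> vadd V x y \<in> S" "\<And>c x. x \<in> S \<Longrightarrow> vscale V c x \<in> S"
  shows "complex_normed_space (V\<lparr>carr := S\<rparr>)"
proof -
  have S: "\<And>x. x \<in> S \<Longrightarrow> x \<in> carr V" using assms(2) by blast
  note V = assms(1)[unfolded complex_normed_space_def vdiff_def]
  have "\<forall>x\<in>carr V. \<forall>y\<in>carr V. \<forall>z\<in>carr V. vadd V (vadd V x y) z = vadd V x (vadd V y z)"
    using V by (elim conjE)
  then have assoc: "vadd V (vadd V x y) z = vadd V x (vadd V y z)" if "x \<in> S" "y \<in> S" "z \<in> S" for x y z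
    using S[OF that(1)] S[OF that(2)] S[OF that(3)] by blast
  show ?thesis
    unfolding complex_normed_space_def vdiff_def
    by (intro conjI ballI allI) ((simp add: assms(3-5) S V; fail) | (simp add: assoc; fail))+
qed

lemma dual_simps [simp]:
  "vadd (dual V) \<phi> \<psi> = (\<lambda>x. \<phi> x + \<psi> x)"
  "vzero (dual V) = (\<lambda>x. 0)"
  "vscale (dual V) c \<phi> = (\<lambda>x. c * \<phi> x)"
  "vdiff (dual V) \<phi> \<psi> = (\<lambda>x. \<phi> x - \<psi> x)"
  by (simp_all add: dual_def vdiff_def)

lemma dual_iff:
  "\<phi> \<in> carr (dual V) \<longleftrightarrow>
     (\<forall>x\<in>carr V. \<forall>y\<in>carr V. \<phi> (vadd V x y) = \<phi> x + \<phi> y) \<and>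
     (\<forall>c. \<forall>x\<in>carr V. \<phi> (vscale V c x) = c * \<phi> x) \<and>
     (\<exists>B. \<forall>x\<in>carr V. cmod (\<phi> x) \<le> B * vnorm V x) \<and> (\<forall>x. x \<notin> carr V \<longrightarrow> \<phi> x = 0)"
  by (auto simp: dual_def linear_map_def bounded_map_def complex_space_def)

lemma dualI:
  assumes "\<And>x y. x \<in> carr V \<Longrightarrow> y \<in> carr V \<Longrightarrow> \<phi> (vadd V x y) = \<phi> x + \<phi> y"
    "\<And>c x. x \<in> carr V \<Longrightarrow> \<phi> (vscale V c x) = c * \<phi> x"
    "\<And>x. x \<in> carr V \<Longrightarrow> cmod (\<phi> x) \<le> B * vnorm V x" "\<And>x. x \<notin> carr V \<Longrightarrow> \<phi> x = 0"
  shows "\<phi> \<in> carr (dual V)"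
  using assms unfolding dual_iff by blast

lemma dualD:
  assumes "\<phi> \<in> carr (dual V)"
  shows "x \<in> carr V \<Longrightarrow> y \<in> carr V \<Longrightarrow> \<phi> (vadd V x y) = \<phi> x + \<phi> y"
    "x \<in> carr V \<Longrightarrow> \<phi> (vscale V c x) = c * \<phi> x" "x \<notin> carr V \<Longrightarrow> \<phi> x = 0"
  using assms by (auto simp: dual_iff)

lemma dual_at_zero: "complex_normed_space V \<Longrightarrow> \<phi> \<in> carr (dual V) \<Longrightarrow> \<phi> (vzero V) = 0"
  using dualD(2)[of \<phi> V "vzero V" 0] cns_zero_scale[of V "vzero V"] cnsD(1)[of V] by simp

lemma dual_norm_le:
  assumes V: "complex_normed_space V" and B: "B \<ge> 0" "\<And>x. x \<in> carr V \<Longrightarrow> cmod (\<phi> x) \<le> B * vnorm V x"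
  shows "vnorm (dual V) \<phi> \<le> B"
proof -
  have "Sup {cmod (\<phi> x) | x. x \<in> carr V \<and> vnorm V x \<le> 1} \<le> B"
  proof (rule cSup_least)
    show "{cmod (\<phi> x) | x. x \<in> carr V \<and> vnorm V x \<le> 1} \<noteq> {}"
      using cnsD(1,7)[OF V] by force
    fix y assume "y \<in> {cmod (\<phi> x) | x. x \<in> carr V \<and> vnorm V x \<le> 1}"
    then obtain x where x: "y = cmod (\<phi> x)" "x \<in> carr V" "vnorm V x \<le> 1" by blast
    then have "B * vnorm V x \<le> B" using B(1) by (simp add: mult_left_le)
    then show "y \<le> B" using B(2)[OF x(2)] x(1) by simp
  qed
  then show ?thesis by (simp add: dual_def)
qed

lemma dual_norm_upper:
  assumes V: "complex_normed_space V" and \<phi>: "\<phi> \<in> carr (dual V)" and x: "x \<in> carr V" "vnorm V x \<le> 1"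
  shows "cmod (\<phi> x) \<le> vnorm (dual V) \<phi>"
proof -
  obtain B where B: "\<And>x. x \<in> carr V \<Longrightarrow> cmod (\<phi> x) \<le> B * vnorm V x"
    using \<phi> unfolding dual_iff by blast
  have "cmod (\<phi> y) \<le> max B 0" if "y \<in> carr V" "vnorm V y \<le> 1" for y
  proof -
    have "B * vnorm V y \<le> max B 0 * vnorm V y" using cnsD(4)[OF V that(1)] by (simp add: mult_right_mono)
    also have "\<dots> \<le> max B 0" using that by (simp add: mult_left_le)
    finally show ?thesis using B[OF that(1)] by simp
  qed
  then have "bdd_above {cmod (\<phi> x) | x. x \<in> carr V \<and> vnorm V x \<le> 1}"
    by (intro bdd_aboveI[of _ "max B 0"]) auto
  then have "cmod (\<phi> x) \<le> Sup {cmod (\<phi> x) | x. x \<in> carr V \<and> vnorm V x \<le> 1}"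
    using x by (intro cSup_upper) auto
  then show ?thesis by (simp add: dual_def)
qed

lemma dual_norm_nonneg: "complex_normed_space V \<Longrightarrow> \<phi> \<in> carr (dual V) \<Longrightarrow> 0 \<le> vnorm (dual V) \<phi>"
  using dual_norm_upper[of V \<phi> "vzero V"] cnsD(1,7)[of V] by (simp add: dual_at_zero)

lemma dual_bound:
  assumes V: "complex_normed_space V" and \<phi>: "\<phi> \<in> carr (dual V)" and x: "x \<in> carr V"
  shows "cmod (\<phi> x) \<le> vnorm (dual V) \<phi> * vnorm V x"
proof (cases "vnorm V x = 0")
  case True
  then have "x = vzero V" using cnsD(5)[OF V x] by simp
  then show ?thesis using True dual_at_zero[OF V \<phi>] by simp
next
  case False
  then have pos: "vnorm V x > 0" using cnsD(4)[OF V x] by simp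
  let ?c = "complex_of_real (1 / vnorm V x)"
  have "vnorm V (vscale V ?c x) = 1" using pos cnsD(6)[OF V x, of ?c] by (simp add: norm_divide)
  then have "cmod (\<phi> (vscale V ?c x)) \<le> vnorm (dual V) \<phi>"
    using dual_norm_upper[OF V \<phi> cnsD(3)[OF V x], of ?c] by simp
  then show ?thesis using pos dualD(2)[OF \<phi> x] by (simp add: norm_mult norm_divide field_simps)
qed

lemma dual_add:
  assumes V: "complex_normed_space V" and "\<phi> \<in> carr (dual V)" "\<psi> \<in> carr (dual V)"
  shows "(\<lambda>x. \<phi> x + \<psi> x) \<in> carr (dual V)"
proof (rule dualI)
  show "cmod (\<phi> x + \<psi> x) \<le> (vnorm (dual V) \<phi> + vnorm (dual V) \<psi>) * vnorm V x" if "x \<in> carr V" for x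
    using norm_triangle_ineq[of "\<phi> x" "\<psi> x"] dual_bound[OF V assms(2) that] dual_bound[OF V assms(3) that]
    by (simp add: algebra_simps)
qed (simp_all add: dualD[OF assms(2)] dualD[OF assms(3)] algebra_simps)

lemma dual_scale:
  assumes V: "complex_normed_space V" and "\<phi> \<in> carr (dual V)"
  shows "(\<lambda>x. c * \<phi> x) \<in> carr (dual V)"
proof (rule dualI)
  show "cmod (c * \<phi> x) \<le> (cmod c * vnorm (dual V) \<phi>) * vnorm V x" if "x \<in> carr V" for x
    using dual_bound[OF V assms(2) that] by (simp add: norm_mult mult.assoc mult_left_mono)
qed (simp_all add: dualD[OF assms(2)] algebra_simps)

lemma dual_zero: "complex_normed_space V \<Longrightarrow> (\<lambda>x. 0) \<in> carr (dual V)"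
  by (rule dualI[of _ _ 0]) auto

lemma dual_diff:
  assumes V: "complex_normed_space V" and "\<phi> \<in> carr (dual V)" "\<psi> \<in> carr (dual V)"
  shows "(\<lambda>x. \<phi> x - \<psi> x) \<in> carr (dual V)"
  using dual_add[OF V assms(2) dual_scale[OF V assms(3), of "- 1"]] by simp

lemma dual_sum:
  assumes V: "complex_normed_space V" and "\<And>i. i \<in> I \<Longrightarrow> f i \<in> carr (dual V)"
  shows "(\<lambda>x. \<Sum>i\<in>I. f i x) \<in> carr (dual V)"
  using assms(2)
  by (induction I rule: infinite_finite_induct) (auto intro: dual_zero[OF V] dual_add[OF V])

lemma complex_normed_dual:
  assumes V: "complex_normed_space V"
  shows "complex_normed_space (dual V)"
proof -
  have zero_iff: "vnorm (dual V) \<phi> = 0 \<longleftrightarrow> \<phi> = (\<lambda>x. 0)" if \<phi>: "\<phi> \<in> carr (dual V)" for \<phi>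
  proof
    assume 0: "vnorm (dual V) \<phi> = 0"
    have "\<phi> x = 0" for x
      using dual_bound[OF V \<phi>, of x] 0 dualD(3)[OF \<phi>, of x] by (cases "x \<in> carr V") auto
    then show "\<phi> = (\<lambda>x. 0)" by blast
  next
    assume "\<phi> = (\<lambda>x. 0)"
    then have "vnorm (dual V) \<phi> \<le> 0" by (intro dual_norm_le[OF V]) auto
    then show "vnorm (dual V) \<phi> = 0" using dual_norm_nonneg[OF V \<phi>] by simp
  qed
  have scale_le: "vnorm (dual V) (\<lambda>x. c * \<phi> x) \<le> cmod c * vnorm (dual V) \<phi>"
    if \<phi>: "\<phi> \<in> carr (dual V)" for \<phi> c
    using dual_bound[OF V \<phi>] dual_norm_nonneg[OF V \<phi>]
    by (intro dual_norm_le[OF V]) (auto simp: norm_mult mult.assoc mult_left_mono)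
  have scale: "vnorm (dual V) (\<lambda>x. c * \<phi> x) = cmod c * vnorm (dual V) \<phi>"
    if \<phi>: "\<phi> \<in> carr (dual V)" for \<phi> c
  proof (cases "c = 0")
    case True
    then show ?thesis using zero_iff[OF dual_zero[OF V]] by simp
  next
    case False
    have "vnorm (dual V) \<phi> \<le> cmod (1 / c) * vnorm (dual V) (\<lambda>x. c * \<phi> x)"
      using scale_le[OF dual_scale[OF V \<phi>], of "1 / c" c] False by simp
    then have "cmod c * vnorm (dual V) \<phi> \<le> vnorm (dual V) (\<lambda>x. c * \<phi> x)"
      using False by (simp add: norm_divide field_simps)
    then show ?thesis using scale_le[OF \<phi>, of c] by simp
  qed
  have tri: "vnorm (dual V) (\<lambda>x. \<phi> x + \<psi> x) \<le> vnorm (dual V) \<phi> + vnorm (dual V) \<psi>"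
    if "\<phi> \<in> carr (dual V)" "\<psi> \<in> carr (dual V)" for \<phi> \<psi>
  proof (rule dual_norm_le[OF V])
    fix x assume x: "x \<in> carr V"
    show "cmod (\<phi> x + \<psi> x) \<le> (vnorm (dual V) \<phi> + vnorm (dual V) \<psi>) * vnorm V x"
      using norm_triangle_ineq[of "\<phi> x" "\<psi> x"] dual_bound[OF V that(1) x] dual_bound[OF V that(2) x]
      by (simp add: algebra_simps)
  qed (use that dual_norm_nonneg[OF V] in auto)
  show ?thesis
    unfolding complex_normed_space_def
    by (simp add: zero_iff scale tri dual_zero[OF V] dual_add[OF V] dual_scale[OF V]
          dual_norm_nonneg[OF V] algebra_simps)
qed

text \<open>Provides the Banach space on which left amenability is tested. Limits are taken
  pointwise; the Cauchy estimate survives the limit uniformly relative to the norm of the argument,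
  and vanishing at \<open>z\<close> is a pointwise condition.\<close>

lemma banach_dual_annihilator:
  assumes V: "complex_normed_space V" and z: "z \<in> carr V"
  shows "complex_banach_space ((dual V)\<lparr>carr := {\<phi> \<in> carr (dual V). \<phi> z = 0}\<rparr>)" (is "complex_banach_space ?X")
proof -
  have normed: "complex_normed_space ?X"
    by (rule cns_subspace[OF complex_normed_dual[OF V]])
       (auto intro: dual_zero[OF V] dual_add[OF V] dual_scale[OF V])
  have X: "vdiff ?X \<phi> \<psi> = (\<lambda>x. \<phi> x - \<psi> x)" "vnorm ?X \<phi> = vnorm (dual V) \<phi>" for \<phi> \<psi>
    by (simp_all add: vdiff_def)
  have "\<exists>l\<in>carr ?X. (\<lambda>n. vnorm ?X (vdiff ?X (s n) l)) \<longlonglongrightarrow> 0"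
    if s: "\<And>n::nat. s n \<in> carr ?X"
      and cauchy: "\<And>e. e > 0 \<Longrightarrow> \<exists>N. \<forall>m\<ge>N. \<forall>n\<ge>N. vnorm ?X (vdiff ?X (s m) (s n)) < e" for s
  proof -
    have sd: "s n \<in> carr (dual V)" "s n z = 0" for n using s[of n] by auto
    have diff: "cmod (s m x - s n x) \<le> vnorm (dual V) (\<lambda>x. s m x - s n x) * vnorm V x"
      if "x \<in> carr V" for m n x
      using dual_bound[OF V dual_diff[OF V sd(1) sd(1)] that] .
    have unif: "\<exists>N. \<forall>m\<ge>N. \<forall>n\<ge>N. \<forall>x\<in>carr V. cmod (s m x - s n x) \<le> e * vnorm V x" if e: "e > 0" for e
    proof -
      obtain N where N: "\<And>m n. m \<ge> N \<Longrightarrow> n \<ge> N \<Longrightarrow> vnorm (dual V) (\<lambda>x. s m x - s n x) < e"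
        using cauchy[OF e] unfolding X by blast
      have "cmod (s m x - s n x) \<le> e * vnorm V x" if "m \<ge> N" "n \<ge> N" "x \<in> carr V" for m n x
        using diff[OF that(3), of m n] N[OF that(1,2)] cnsD(4)[OF V that(3)]
          mult_right_mono[of "vnorm (dual V) (\<lambda>x. s m x - s n x)" e "vnorm V x"] by linarith
      then show ?thesis by blast
    qed
    have "Cauchy (\<lambda>n. s n x)" for x
    proof (cases "x \<in> carr V")
      case False
      then show ?thesis using dualD(3)[OF sd(1)] by (simp add: Cauchy_def)
    next
      case True
      show ?thesis
        unfolding Cauchy_def dist_norm
      proof (intro allI impI)
        fix e :: real assume "e > 0"
        \<comment> \<open>Adding 1 covers \<open>vnorm V x = 0\<close> and makes the resulting
          inequality strict.\<close>
        define d where "d = e / (vnorm V x + 1)"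
        have "d > 0" using \<open>e > 0\<close> cnsD(4)[OF V True] by (simp add: d_def)
        have "d * vnorm V x < d * (vnorm V x + 1)" using \<open>d > 0\<close> by simp
        also have "\<dots> = e" using cnsD(4)[OF V True] by (simp add: d_def)
        finally have "d * vnorm V x < e" .
        then show "\<exists>M. \<forall>m\<ge>M. \<forall>n\<ge>M. norm (s m x - s n x) < e"
          using unif[OF \<open>d > 0\<close>] True by (meson order_le_less_trans)
      qed
    qed
    then have conv: "convergent (\<lambda>n. s n x)" for x by (simp add: Cauchy_convergent_iff)
    define l where "l x = lim (\<lambda>n. s n x)" for x
    have l: "(\<lambda>n. s n x) \<longlonglongrightarrow> l x" for x
      using conv[of x] by (simp add: l_def convergent_LIMSEQ_iff)
    have lim_unif: "\<exists>N. \<forall>n\<ge>N. \<forall>x\<in>carr V. cmod (s n x - l x) \<le> e * vnorm V x" if e: "e > 0" for e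
    proof -
      obtain N where N: "\<And>m n x. m \<ge> N \<Longrightarrow> n \<ge> N \<Longrightarrow> x \<in> carr V \<Longrightarrow> cmod (s m x - s n x) \<le> e * vnorm V x"
        using unif[OF e] by blast
      have "cmod (s n x - l x) \<le> e * vnorm V x" if "n \<ge> N" "x \<in> carr V" for n x
      proof (rule tendsto_upperbound)
        show "(\<lambda>m. cmod (s n x - s m x)) \<longlonglongrightarrow> cmod (s n x - l x)" by (intro tendsto_intros l)
        show "\<forall>\<^sub>F m in sequentially. cmod (s n x - s m x) \<le> e * vnorm V x"
          using N that by (auto simp: eventually_sequentially)
      qed simp
      then show ?thesis by blast
    qed
    \<comment> \<open>A single member at distance at most 1 already shows that the limit is
      bounded.\<close>
    obtain N where N: "\<And>x. x \<in> carr V \<Longrightarrow> cmod (s N x - l x) \<le> 1 * vnorm V x"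
      using lim_unif[of 1] by auto
    have ld: "l \<in> carr (dual V)"
    proof (rule dualI)
      show "l (vadd V x y) = l x + l y" if "x \<in> carr V" "y \<in> carr V" for x y
        using LIMSEQ_unique[OF l[of "vadd V x y"]] tendsto_add[OF l[of x] l[of y]] dualD(1)[OF sd(1) that]
        by simp
      show "l (vscale V c x) = c * l x" if "x \<in> carr V" for c x
        using LIMSEQ_unique[OF l[of "vscale V c x"]] tendsto_mult[OF tendsto_const[of c] l[of x]]
          dualD(2)[OF sd(1) that] by simp
      show "cmod (l x) \<le> (vnorm (dual V) (s N) + 1) * vnorm V x" if "x \<in> carr V" for x
        using N[OF that] dual_bound[OF V sd(1)[of N] that] norm_triangle_ineq4[of "s N x" "s N x - l x"]
        by (simp add: algebra_simps)
      show "l x = 0" if "x \<notin> carr V" for x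
        using LIMSEQ_unique[OF l[of x]] dualD(3)[OF sd(1) that] tendsto_const[of "0::complex"] by simp
    qed
    moreover have "l z = 0"
      using LIMSEQ_unique[OF l[of z]] sd(2) tendsto_const[of "0::complex"] by simp
    moreover have "(\<lambda>n. vnorm (dual V) (\<lambda>x. s n x - l x)) \<longlonglongrightarrow> 0"
    proof (rule LIMSEQ_I)
      fix r :: real assume r: "r > 0"
      \<comment> \<open>Half of \<open>r\<close>, because passing to the supremum turns a strict
        bound into a weak one.\<close>
      obtain N where N: "\<And>n x. n \<ge> N \<Longrightarrow> x \<in> carr V \<Longrightarrow> cmod (s n x - l x) \<le> r / 2 * vnorm V x"
        using lim_unif[of "r / 2"] r by auto
      have "vnorm (dual V) (\<lambda>x. s n x - l x) \<le> r / 2" if "n \<ge> N" for n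
        using r N[OF that] by (intro dual_norm_le[OF V]) auto
      then show "\<exists>no. \<forall>n\<ge>no. norm (vnorm (dual V) (\<lambda>x. s n x - l x) - 0) < r"
        using r dual_norm_nonneg[OF V dual_diff[OF V sd(1) ld]] by (intro exI[of _ N]) fastforce
    qed
    ultimately show ?thesis unfolding X by (intro bexI[of _ l]) auto
  qed
  then show ?thesis unfolding complex_banach_space_def using normed by blast
qed

section \<open>The cone topology\<close>

lemma
  fixes \<mu> :: "'a::t2_space cmeas"
  assumes \<mu>: "\<mu> \<in> MK_pos"
  shows sets_to_measure: "sets (to_measure \<mu>) = sets borel"
    and space_to_measure: "space (to_measure \<mu>) = UNIV"
    and emeasure_to_measure: "A \<in> sets borel \<Longrightarrow> emeasure (to_measure \<mu>) A = ennreal (Re (\<mu> A))"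
proof -
  show s: "sets (to_measure \<mu>) = sets borel"
    using sets.sigma_sets_eq[of "borel :: 'a measure"] by (simp add: to_measure_def sets_measure_of)
  show "space (to_measure \<mu>) = UNIV" by (simp add: to_measure_def space_measure_of)
  assume A: "A \<in> sets borel"
  show "emeasure (to_measure \<mu>) A = ennreal (Re (\<mu> A))"
  proof (rule emeasure_measure_of[OF to_measure_def])
    show "positive (sets (to_measure \<mu>)) (\<lambda>A. ennreal (Re (\<mu> A)))"
      using MK_posD(1)[OF \<mu>] by (simp add: positive_def MK_cm)
    show "countably_additive (sets (to_measure \<mu>)) (\<lambda>A. ennreal (Re (\<mu> A)))"
      unfolding countably_additive_def s
    proof (intro allI impI)
      fix A :: "nat \<Rightarrow> 'a set"
      assume "range A \<subseteq> sets borel" "disjoint_family A"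
      then have "(\<lambda>n. Re (\<mu> (A n))) sums Re (\<mu> (\<Union>n. A n))"
        using MK_posD(1)[OF \<mu>] by (intro sums_Re cm_sums MK_cm)
      then show "(\<Sum>n. ennreal (Re (\<mu> (A n)))) = ennreal (Re (\<mu> (\<Union>n. A n)))"
        using MK_posD(2)[OF \<mu>] by (intro suminf_ennreal_eq)
    qed
  qed (use A s in auto)
qed

lemma finite_to_measure: "\<mu> \<in> MK_pos \<Longrightarrow> finite_measure (to_measure \<mu>)"
  for \<mu> :: "'a::t2_space cmeas"
  by (rule finite_measureI) (simp add: space_to_measure emeasure_to_measure)

lemma measure_to_measure:
  "\<mu> \<in> MK_pos \<Longrightarrow> A \<in> sets borel \<Longrightarrow> measure (to_measure \<mu>) A = Re (\<mu> A)" for \<mu> :: "'a::t2_space cmeas"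
  by (simp add: measure_def emeasure_to_measure MK_posD(2))

lemma integral_one_to_measure: "\<mu> \<in> MK_pos \<Longrightarrow> (LINT x|to_measure \<mu>. 1) = Re (\<mu> UNIV)"
  for \<mu> :: "'a::t2_space cmeas"
  by (simp add: measure_to_measure space_to_measure)

lemma Cc_pos_bounded:
  assumes "f \<in> Cc_pos \<union> {\<lambda>x. 1}"
  shows "continuous_on UNIV f" "\<exists>B. \<forall>x. 0 \<le> f x \<and> f x \<le> B"
proof -
  show c: "continuous_on UNIV f" using assms by (auto simp: Cc_pos_def)
  show "\<exists>B. \<forall>x. 0 \<le> f x \<and> f x \<le> B"
  proof (cases "f \<in> Cc_pos")
    case True
    then have "compact (f ` closure {x. f x \<noteq> 0})"
      by (intro compact_continuous_image continuous_on_subset[OF c]) (auto simp: Cc_pos_def)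
    then obtain B where B: "\<And>y. y \<in> f ` closure {x. f x \<noteq> 0} \<Longrightarrow> norm y \<le> B"
      using compact_imp_bounded bounded_iff by metis
    have "f x \<le> max B 0" for x
      using B[of "f x"] closure_subset[of "{x. f x \<noteq> 0}"] by (cases "f x = 0") fastforce+
    then show ?thesis using True by (auto simp: Cc_pos_def)
  qed (use assms in auto)
qed

text \<open>The space is cut into cells according to the integer parts of \<open>f x / e\<close>,
  for all \<open>f\<close> in \<open>F\<close> together. There are finitely many cells because the
  test functions are bounded, and on one cell each \<open>f\<close> varies by at most
  \<open>e\<close>.\<close>

lemma finite_approximation:
  assumes F: "finite F" "F \<subseteq> (Cc_pos :: ('a::t2_space \<Rightarrow> real) set) \<union> {\<lambda>x. 1}" and e: "e > 0"
  shows "\<exists>h \<in> measurable borel borel. finite (range h) \<and> (\<forall>f\<in>F. \<forall>x. \<bar>f (h x) - f x\<bar> \<le> e)"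
proof -
  define k where "k x = (\<lambda>f\<in>F. \<lfloor>f x / e\<rfloor>)" for x
  \<comment> \<open>One representative per cell: the choice depends on \<open>x\<close> through
    \<open>k x\<close> alone, so \<open>h\<close> is a Borel step map.\<close>
  define h where "h x = (SOME y. k y = k x)" for x
  have kh: "k (h x) = k x" for x unfolding h_def by (rule someI) simp
  obtain B where B: "\<And>f x. f \<in> F \<Longrightarrow> 0 \<le> f x \<and> f x \<le> B f"
    using Cc_pos_bounded(2) F(2) by (metis subsetD)
  have "range k \<subseteq> (\<Pi>\<^sub>E f\<in>F. {0..\<lfloor>B f / e\<rfloor>})"
    using B e by (auto simp: k_def floor_mono divide_right_mono)
  moreover have "finite (\<Pi>\<^sub>E f\<in>F. {0..\<lfloor>B f / e\<rfloor>})" using F(1) by (intro finite_PiE) auto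
  ultimately have "finite (range k)" by (rule finite_subset)
  moreover have "range h = (\<lambda>t. SOME y. k y = t) ` range k" by (auto simp: h_def)
  ultimately have fin: "finite (range h)" by simp
  have cell: "{x. k x = k y} \<in> sets borel" for y
  proof -
    have "{x \<in> space borel. \<lfloor>f x / e\<rfloor> = \<lfloor>f y / e\<rfloor>} \<in> sets borel" if f: "f \<in> F" for f
    proof -
      have [measurable]: "f \<in> borel_measurable borel"
        using Cc_pos_bounded(1) F(2) f by (intro borel_measurable_continuous_onI) blast
      have "{x \<in> space borel. of_int \<lfloor>f y / e\<rfloor> \<le> f x / e \<and> f x / e < of_int \<lfloor>f y / e\<rfloor> + 1} \<in> sets borel"
        by measurable
      then show ?thesis by (simp add: floor_eq_iff)
    qed
    then have "{x \<in> space borel. \<forall>f\<in>F. \<lfloor>f x / e\<rfloor> = \<lfloor>f y / e\<rfloor>} \<in> sets borel"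
      by (intro sets.sets_Collect_finite_All F(1))
    moreover have "k x = k y \<longleftrightarrow> (\<forall>f\<in>F. \<lfloor>f x / e\<rfloor> = \<lfloor>f y / e\<rfloor>)" for x
      by (auto simp: k_def restrict_def fun_eq_iff)
    ultimately show ?thesis by simp
  qed
  have hk: "k x = k y \<Longrightarrow> h x = h y" for x y by (simp add: h_def)
  have meas: "h \<in> measurable borel borel"
  proof (rule measurableI)
    fix A :: "'a set"
    have "h -` A = (\<Union>y\<in>range h \<inter> A. {x. k x = k y})"
    proof (intro equalityI subsetI)
      fix x assume "x \<in> h -` A"
      then show "x \<in> (\<Union>y\<in>range h \<inter> A. {x. k x = k y})" using kh[of x] by (intro UN_I[of "h x"]) auto
    next
      fix x assume "x \<in> (\<Union>y\<in>range h \<inter> A. {x. k x = k y})"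
      then obtain z where z: "h z \<in> A" "k x = k (h z)" by blast
      then have "h x = h z" using hk[of x z] kh[of z] by simp
      then show "x \<in> h -` A" using z by simp
    qed
    moreover have "(\<Union>y\<in>range h \<inter> A. {x. k x = k y}) \<in> sets borel"
      using fin cell by (intro sets.finite_UN) auto
    ultimately show "h -` A \<inter> space borel \<in> sets borel" by simp
  qed simp
  have "\<bar>f (h x) - f x\<bar> \<le> e" if f: "f \<in> F" for f x
  proof -
    have "\<lfloor>f (h x) / e\<rfloor> = \<lfloor>f x / e\<rfloor>" using fun_cong[OF kh[of x], of f] f by (simp add: k_def)
    then have "\<bar>f (h x) / e - f x / e\<bar> \<le> 1" by linarith
    also have "f (h x) / e - f x / e = (f (h x) - f x) / e" by (simp add: diff_divide_distrib)
    finally show ?thesis using e by (simp add: abs_divide)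
  qed
  then show ?thesis using meas fin by blast
qed

definition dirac_sum :: "'a set \<Rightarrow> ('a::topological_space \<Rightarrow> real) \<Rightarrow> 'a cmeas" where
  "dirac_sum Y c = (\<lambda>A. \<Sum>y\<in>Y. of_real (c y) * dirac y A)"

lemma dirac_sum_pos:
  fixes Y :: "'a::t2_space set"
  assumes "\<And>y. y \<in> Y \<Longrightarrow> 0 \<le> c y"
  shows "dirac_sum Y c \<in> MK_pos"
  unfolding dirac_sum_def using assms
proof (induction Y rule: infinite_finite_induct)
  case (insert y Y)
  then show ?case
    using MK_pos_add[OF MK_pos_scale[OF PK_D(1)[OF dirac_PK]], of "c y" _ y] by simp
qed (auto intro: MK_posI)

text \<open>A map with finitely many values has an atomic image measure, whose weights are the
  masses of the fibres. A test integral against the atomic measure thereby becomes an integral of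
  \<open>f (h x)\<close> against \<mu>.\<close>

lemma pushforward_dirac_sum:
  fixes \<mu> :: "'a::t2_space cmeas" and h :: "'a \<Rightarrow> 'a"
  assumes \<mu>: "\<mu> \<in> MK_pos" and h: "h \<in> measurable borel borel" "finite (range h)"
  defines "c \<equiv> \<lambda>y. Re (\<mu> (h -` {y}))"
  shows "to_measure (dirac_sum (range h) c) = distr (to_measure \<mu>) borel h"
proof (rule measure_eqI)
  have pos: "dirac_sum (range h) c \<in> MK_pos"
    by (rule dirac_sum_pos) (simp add: c_def MK_posD(2)[OF \<mu>])
  show "sets (to_measure (dirac_sum (range h) c)) = sets (distr (to_measure \<mu>) borel h)"
    using pos by (simp add: sets_to_measure)
  fix A :: "'a set"
  assume "A \<in> sets (to_measure (dirac_sum (range h) c))"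
  then have A: "A \<in> sets borel" using pos by (simp add: sets_to_measure)
  have hA: "h -` B \<in> sets borel" if "B \<in> sets borel" for B
    using measurable_sets[OF h(1) that] by simp
  have "h -` A = (\<Union>y\<in>range h \<inter> A. h -` {y})" by auto
  then have "\<mu> (h -` A) = (\<Sum>y\<in>range h \<inter> A. \<mu> (h -` {y}))"
    using h(2) hA by (simp only:, intro cm_UN MK_cm MK_posD(1)[OF \<mu>]) (auto simp: disjoint_family_on_def)
  also have "\<dots> = (\<Sum>y\<in>range h. of_real (c y) * dirac y A)"
    using h(2) A MK_posD(4)[OF \<mu>]
    by (intro sum.mono_neutral_cong_left) (auto simp: dirac_def c_def)
  finally have "dirac_sum (range h) c A = \<mu> (h -` A)" by (simp add: dirac_sum_def)
  moreover have "emeasure (distr (to_measure \<mu>) borel h) A = emeasure (to_measure \<mu>) (h -` A \<inter> space (to_measure \<mu>))"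
    using h(1) A by (intro emeasure_distr) (simp_all add: measurable_cong_sets[OF sets_to_measure[OF \<mu>] refl])
  ultimately show "emeasure (to_measure (dirac_sum (range h) c)) A = emeasure (distr (to_measure \<mu>) borel h) A"
    using pos \<mu> A hA[OF A] by (simp add: emeasure_to_measure space_to_measure)
qed

text \<open>Basic neighbourhoods bound finitely many test integrals by one common tolerance;
  intersections take the union of the test functions and the minimum of the tolerances.\<close>

lemma cone_open_basic:
  assumes "openin cone_topology W" "\<mu> \<in> W" "\<mu> \<in> MK_pos"
  shows "\<exists>F e. finite F \<and> F \<subseteq> Cc_pos \<union> {\<lambda>x. 1} \<and> e > 0 \<and>
    (\<forall>\<rho>\<in>MK_pos. (\<forall>f\<in>F. \<bar>(LINT x|to_measure \<rho>. f x) - (LINT x|to_measure \<mu>. f x)\<bar> < e) \<longrightarrow> \<rho> \<in> W)"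
  using assms(1) unfolding cone_topology_def openin_topology_generated_by_iff
  using assms(2)
proof (induction)
  case Empty
  then show ?case by simp
next
  case (Int a b)
  from Int.prems have "\<mu> \<in> a" "\<mu> \<in> b" by auto
  from Int.IH(1)[OF this(1)] Int.IH(2)[OF this(2)] obtain F e G d where Fe: "finite F" "F \<subseteq> Cc_pos \<union> {\<lambda>x. 1}" "e > 0"
    "\<forall>\<rho>\<in>MK_pos. (\<forall>f\<in>F. \<bar>(LINT x|to_measure \<rho>. f x) - (LINT x|to_measure \<mu>. f x)\<bar> < e) \<longrightarrow> \<rho> \<in> a"
    and Gd: "finite G" "G \<subseteq> Cc_pos \<union> {\<lambda>x. 1}" "d > 0"
    "\<forall>\<rho>\<in>MK_pos. (\<forall>f\<in>G. \<bar>(LINT x|to_measure \<rho>. f x) - (LINT x|to_measure \<mu>. f x)\<bar> < d) \<longrightarrow> \<rho> \<in> b"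
    by (elim exE conjE)
  show ?case
    using Fe Gd by (intro exI[of _ "F \<union> G"] exI[of _ "min e d"]) auto
next
  case (UN K)
  then obtain k where k: "k \<in> K" "\<mu> \<in> k" by blast
  from UN.IH[OF this] k(1) show ?case by (meson UnionI)
next
  case (Basis s)
  then obtain f W where fW: "s = {\<mu> \<in> MK_pos. (LINT x|to_measure \<mu>. f x) \<in> W}"
    "f \<in> Cc_pos \<union> {\<lambda>x. 1}" "open W" by blast
  then have "(LINT x|to_measure \<mu>. f x) \<in> W" using Basis by simp
  then obtain e where e: "e > 0" "\<And>y. \<bar>y - (LINT x|to_measure \<mu>. f x)\<bar> < e \<Longrightarrow> y \<in> W"
    using fW(3) unfolding open_dist dist_real_def by blast
  then show ?case using fW(1,2) by (intro exI[of _ "{f}"] exI[of _ e]) auto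
qed

text \<open>The image of \<mu> under the step map is a sum of weighted point masses, in effect a
  Riemann sum; it changes each relevant test integral by at most \<open>d\<close> times the mass of
  \<mu>.\<close>

lemma dirac_sums_dense:
  fixes W :: "'a::t2_space cmeas set"
  assumes W: "openin cone_topology W" "\<mu> \<in> W" and \<mu>: "\<mu> \<in> MK_pos"
  shows "\<exists>Y c. finite Y \<and> (\<forall>y. 0 \<le> c y) \<and> dirac_sum Y c \<in> W"
proof -
  obtain F e where F: "finite F" "F \<subseteq> Cc_pos \<union> {\<lambda>x. 1}" and e: "e > 0"
    and sub: "\<And>\<rho>. \<rho> \<in> MK_pos \<Longrightarrow> (\<And>f. f \<in> F \<Longrightarrow>
      \<bar>(LINT x|to_measure \<rho>. f x) - (LINT x|to_measure \<mu>. f x)\<bar> < e) \<Longrightarrow> \<rho> \<in> W"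
    using cone_open_basic[OF W \<mu>] by metis
  define M where "M = Re (\<mu> UNIV)"
  have M: "M \<ge> 0" unfolding M_def by (rule MK_posD(2)[OF \<mu>])
  \<comment> \<open>Makes the total error \<open>d * M\<close> smaller than \<open>e\<close>, also
    for \<open>M = 0\<close>.\<close>
  define d where "d = e / (M + 1)"
  have d: "d > 0" using e M by (simp add: d_def)
  obtain h where h: "h \<in> measurable borel borel" "finite (range h)"
    "\<And>f x. f \<in> F \<Longrightarrow> \<bar>f (h x) - f x\<bar> \<le> d"
    using finite_approximation[OF F d] by blast
  define c where "c y = Re (\<mu> (h -` {y}))" for y
  have c: "0 \<le> c y" for y unfolding c_def by (rule MK_posD(2)[OF \<mu>])
  interpret finite_measure "to_measure \<mu>" by (rule finite_to_measure[OF \<mu>])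
  have meas: "g \<in> borel_measurable (to_measure \<mu>) \<longleftrightarrow> g \<in> borel_measurable borel" for g :: "'a \<Rightarrow> real"
    by (simp cong: measurable_cong_sets add: sets_to_measure[OF \<mu>])
  have "\<bar>(LINT x|to_measure (dirac_sum (range h) c). f x) - (LINT x|to_measure \<mu>. f x)\<bar> < e"
    if f: "f \<in> F" for f
  proof -
    have fm: "f \<in> borel_measurable borel"
      using Cc_pos_bounded(1) F(2) f by (intro borel_measurable_continuous_onI) blast
    obtain B where B: "\<And>x. 0 \<le> f x \<and> f x \<le> B" using Cc_pos_bounded(2) F(2) f by (metis subsetD)
    have fi: "integrable (to_measure \<mu>) f"
      by (rule integrable_const_bound[of _ B]) (use B fm in \<open>auto simp: meas\<close>)
    have fhi: "integrable (to_measure \<mu>) (\<lambda>x. f (h x))"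
      by (rule integrable_const_bound[of _ B]) (use B measurable_compose[OF h(1) fm] in \<open>auto simp: meas\<close>)
    have "(LINT x|to_measure (dirac_sum (range h) c). f x) = (LINT x|to_measure \<mu>. f (h x))"
      using pushforward_dirac_sum[OF \<mu> h(1,2)] fm h(1)
      by (simp add: c_def[abs_def] integral_distr measurable_cong_sets[OF sets_to_measure[OF \<mu>] refl])
    then have "\<bar>(LINT x|to_measure (dirac_sum (range h) c). f x) - (LINT x|to_measure \<mu>. f x)\<bar>
        = \<bar>LINT x|to_measure \<mu>. f (h x) - f x\<bar>"
      using fi fhi by simp
    also have "\<dots> \<le> (LINT x|to_measure \<mu>. \<bar>f (h x) - f x\<bar>)" by (rule integral_abs_bound)
    also have "\<dots> \<le> (LINT x|to_measure \<mu>. d)"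
      using fi fhi h(3)[OF f] by (intro integral_mono) auto
    also have "\<dots> = d * M" by (simp add: measure_to_measure[OF \<mu>] space_to_measure[OF \<mu>] M_def)
    also have "\<dots> < d * (M + 1)" using d by simp
    also have "\<dots> = e" using M by (simp add: d_def)
    finally show ?thesis .
  qed
  then have "dirac_sum (range h) c \<in> W"
    using c by (intro sub dirac_sum_pos) auto
  then show ?thesis using h(2) c by blast
qed

lemma topspace_cone: "topspace cone_topology = (MK_pos :: 'a::t2_space cmeas set)"
proof -
  have "openin cone_topology (MK_pos :: 'a cmeas set)"
    unfolding cone_topology_def openin_topology_generated_by_iff
    by (rule generate_topology_on.Basis) (auto intro!: exI[of _ "\<lambda>x. 1"] exI[of _ UNIV])
  moreover have "topspace cone_topology \<subseteq> (MK_pos :: 'a cmeas set)"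
    unfolding cone_topology_def topology_generated_by_topspace by blast
  ultimately show ?thesis using openin_subset by blast
qed

text \<open>Mass is the integral of the constant test function. Compactly supported functions would
  not see mass that moves off to infinity.\<close>

lemma openin_cone_mass:
  assumes "open W"
  shows "openin cone_topology {\<rho> \<in> MK_pos :: 'a::t2_space cmeas set. Re (\<rho> UNIV) \<in> W}"
proof -
  have "{\<rho> \<in> MK_pos :: 'a cmeas set. Re (\<rho> UNIV) \<in> W} = {\<rho> \<in> MK_pos. (LINT x|to_measure \<rho>. 1) \<in> W}"
    by (intro Collect_cong conj_cong refl) (simp only: integral_one_to_measure)
  then show ?thesis
    unfolding cone_topology_def openin_topology_generated_by_iff
    using assms by (intro generate_topology_on.Basis) blast
qed

text \<open>Two real functions that are continuous on the cone, the mass of \<open>T \<mu>\<close>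
  and \<open>m\<close> times the mass of \<mu>, agree on a dense set and therefore
  everywhere.\<close>

lemma mass_determined_by_diracs:
  fixes T :: "'a::t2_space cmeas \<Rightarrow> 'a cmeas"
  assumes T: "continuous_map cone_topology cone_topology T"
    and c: "\<And>Y c. finite Y \<Longrightarrow> (\<And>y. 0 \<le> c y) \<Longrightarrow>
      Re (T (dirac_sum Y c) UNIV) = m * Re (dirac_sum Y c UNIV)"
    and \<mu>: "\<mu> \<in> MK_pos"
  shows "Re (T \<mu> UNIV) = m * Re (\<mu> UNIV)"
proof (rule ccontr)
  assume ne: "Re (T \<mu> UNIV) \<noteq> m * Re (\<mu> UNIV)"
  define d where "d = \<bar>Re (T \<mu> UNIV) - m * Re (\<mu> UNIV)\<bar>"
  have d: "d > 0" using ne by (simp add: d_def)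
  \<comment> \<open>An error \<open>e\<close> in the mass of \<mu> is multiplied by
    \<open>m\<close>, and the result stays within \<open>d / 2\<close>; the other half of
    \<open>d\<close> is spent on the mass of \<open>T \<mu>\<close>.\<close>
  define e where "e = d / (2 * (\<bar>m\<bar> + 1))"
  have e: "e > 0" using d by (simp add: e_def)
  define U where "U = {\<rho> \<in> MK_pos :: 'a cmeas set. Re (\<rho> UNIV) \<in> ball (Re (\<mu> UNIV)) e}"
  define V where "V = {\<rho> \<in> topspace cone_topology.
    T \<rho> \<in> {\<rho> \<in> MK_pos. Re (\<rho> UNIV) \<in> ball (Re (T \<mu> UNIV)) (d/2)}}"
  have "openin cone_topology U" unfolding U_def by (rule openin_cone_mass) simp
  moreover have "openin cone_topology V"
    unfolding V_def by (rule openin_continuous_map_preimage[OF T openin_cone_mass]) simp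
  ultimately have "openin cone_topology (U \<inter> V)" by blast
  moreover have "\<mu> \<in> U \<inter> V"
    using \<mu> d e T unfolding U_def V_def
    using continuous_map_funspace[OF T] by (auto simp: topspace_cone)
  ultimately obtain Y c where Y: "finite Y" "\<And>y. 0 \<le> c y" "dirac_sum Y c \<in> U \<inter> V"
    using dirac_sums_dense[OF _ _ \<mu>] by blast
  let ?s = "dirac_sum Y c"
  have "\<bar>Re (T \<mu> UNIV) - Re (T ?s UNIV)\<bar> < d / 2" "\<bar>Re (\<mu> UNIV) - Re (?s UNIV)\<bar> < e"
    using Y(3) by (auto simp: U_def V_def dist_real_def)
  moreover have "Re (T ?s UNIV) = m * Re (?s UNIV)" using Y by (intro c)
  moreover have "\<bar>m * Re (\<mu> UNIV) - m * Re (?s UNIV)\<bar> \<le> \<bar>m\<bar> * e"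
    using calculation(2) by (simp add: right_diff_distrib[symmetric] abs_mult mult_left_mono)
  moreover have "\<bar>m\<bar> * e \<le> d / 2"
    using d by (simp add: e_def field_simps)
  moreover have "d \<le> \<bar>Re (T \<mu> UNIV) - m * Re (?s UNIV)\<bar> + \<bar>m * Re (\<mu> UNIV) - m * Re (?s UNIV)\<bar>"
    unfolding d_def by linarith
  ultimately show False by linarith
qed

section \<open>Convolution\<close>

lemma MK_norm_sum:
  fixes f :: "'i \<Rightarrow> 'a::t2_space cmeas"
  assumes "\<And>i. i \<in> I \<Longrightarrow> f i \<in> carr MK"
  shows "tv (\<lambda>A. \<Sum>i\<in>I. f i A) UNIV \<le> (\<Sum>i\<in>I. tv (f i) UNIV)"
  using assms
proof (induction I rule: infinite_finite_induct)
  case (insert i I)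
  have "(\<lambda>A. \<Sum>i\<in>I. f i A) \<in> carr MK" using insert by simp
  then have "tv (\<lambda>A. f i A + (\<Sum>i\<in>I. f i A)) UNIV
      \<le> tv (f i) UNIV + tv (\<lambda>A. \<Sum>i\<in>I. f i A) UNIV"
    using insert by (intro tv_add MK_cm) auto
  then show ?case using insert by fastforce
qed auto

lemma MK_norm_scale: "\<mu> \<in> carr MK \<Longrightarrow> tv (\<lambda>A. c * \<mu> A) UNIV = cmod c * tv \<mu> UNIV"
  by (intro tv_scale MK_cm) auto

lemma MK_norm_nonneg: "\<mu> \<in> carr MK \<Longrightarrow> 0 \<le> tv \<mu> UNIV"
  by (intro tv_nonneg MK_cm) auto

text \<open>In a real measure of total mass zero the positive and the negative values balance, so a
  one-sided bound controls both, at the cost of the factor 2.\<close>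

lemma tv_le_of_lower_bound:
  assumes d: "d \<in> complex_measures" "d UNIV = 0" "\<And>A. Im (d A) = 0"
    and low: "\<And>E. E \<in> sets borel \<Longrightarrow> - D \<le> Re (d E)"
  shows "tv d UNIV \<le> 2 * D"
proof (rule tv_least)
  fix P :: "'a set set" assume P: "finite P" "P \<subseteq> sets borel" "disjoint P" "\<Union>P = UNIV"
  define Q where "Q = {A\<in>P. Re (d A) < 0}"
  have un: "(\<Sum>A\<in>R. Re (d A)) = Re (d (\<Union>R))" if "R \<subseteq> P" for R
  proof -
    have "finite R" "R \<subseteq> sets borel" "disjoint R"
      using that P by (auto intro: finite_subset pairwise_subset)
    then have "d (\<Union>A\<in>R. A) = (\<Sum>A\<in>R. d A)"
      by (intro cm_UN[OF d(1)]) (auto simp: disjoint_family_on_def pairwise_def disjnt_def)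
    then show ?thesis by simp
  qed
  \<comment> \<open>An absolute value is the number itself plus twice its negative part; the plain
    sum over the partition is the total mass, hence zero.\<close>
  have "(\<Sum>A\<in>P. cmod (d A)) = (\<Sum>A\<in>P. Re (d A) + (if A \<in> Q then - 2 * Re (d A) else 0))"
    using d(3) by (intro sum.cong) (auto simp: Q_def cmod_eq_Re)
  also have "\<dots> = (\<Sum>A\<in>P. Re (d A)) + (\<Sum>A\<in>Q. - 2 * Re (d A))"
    using P(1) by (simp add: sum.distrib sum.If_cases Q_def Int_def)
  also have "\<dots> = - 2 * Re (d (\<Union>Q))"
    using un[of P] un[of Q] P(4) d(2) by (simp add: Q_def sum_negf sum_distrib_left[symmetric])
  also have "\<dots> \<le> 2 * D"
  proof -
    have "\<Union>Q \<in> sets borel" using P by (intro sets.finite_Union) (auto simp: Q_def)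
    from low[OF this] show ?thesis by simp
  qed
  finally show "(\<Sum>A\<in>P. cmod (d A)) \<le> 2 * D" .
qed simp

locale semihypergroup =
  fixes conv :: "'a::t2_space cmeas \<Rightarrow> 'a cmeas \<Rightarrow> 'a cmeas"
  assumes semihypergroup: "semitop_semihypergroup conv"
begin

lemma conv_bilinear: "bilinear_map MK MK MK conv"
  using semihypergroup by (simp add: semitop_semihypergroup_def assoc_algebra_def)

lemma conv_closed [simp]: "\<mu> \<in> carr MK \<Longrightarrow> \<nu> \<in> carr MK \<Longrightarrow> conv \<mu> \<nu> \<in> carr MK"
  using conv_bilinear by (simp add: bilinear_map_def linear_map_def)

lemma conv_add_right: "\<mu> \<in> carr MK \<Longrightarrow> \<nu> \<in> carr MK \<Longrightarrow> \<rho> \<in> carr MK \<Longrightarrow>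
    conv \<mu> (\<lambda>A. \<nu> A + \<rho> A) = (\<lambda>A. conv \<mu> \<nu> A + conv \<mu> \<rho> A)"
  using conv_bilinear by (simp add: bilinear_map_def linear_map_def)

lemma conv_add_left: "\<mu> \<in> carr MK \<Longrightarrow> \<nu> \<in> carr MK \<Longrightarrow> \<rho> \<in> carr MK \<Longrightarrow>
    conv (\<lambda>A. \<mu> A + \<nu> A) \<rho> = (\<lambda>A. conv \<mu> \<rho> A + conv \<nu> \<rho> A)"
  using conv_bilinear by (simp add: bilinear_map_def linear_map_def)

lemma conv_scale_right: "\<mu> \<in> carr MK \<Longrightarrow> \<nu> \<in> carr MK \<Longrightarrow>
    conv \<mu> (\<lambda>A. c * \<nu> A) = (\<lambda>A. c * conv \<mu> \<nu> A)"
  using conv_bilinear by (simp add: bilinear_map_def linear_map_def)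

lemma conv_scale_left: "\<mu> \<in> carr MK \<Longrightarrow> \<nu> \<in> carr MK \<Longrightarrow>
    conv (\<lambda>A. c * \<mu> A) \<nu> = (\<lambda>A. c * conv \<mu> \<nu> A)"
  using conv_bilinear by (simp add: bilinear_map_def linear_map_def)

lemma conv_diff_right: "\<mu> \<in> carr MK \<Longrightarrow> \<nu> \<in> carr MK \<Longrightarrow> \<rho> \<in> carr MK \<Longrightarrow>
    conv \<mu> (\<lambda>A. \<nu> A - \<rho> A) = (\<lambda>A. conv \<mu> \<nu> A - conv \<mu> \<rho> A)"
  using conv_add_right[of \<mu> \<nu> "\<lambda>A. - 1 * \<rho> A"] conv_scale_right[of \<mu> \<rho> "- 1"] by simp

lemma conv_diff_left: "\<mu> \<in> carr MK \<Longrightarrow> \<nu> \<in> carr MK \<Longrightarrow> \<rho> \<in> carr MK \<Longrightarrow>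
    conv (\<lambda>A. \<mu> A - \<nu> A) \<rho> = (\<lambda>A. conv \<mu> \<rho> A - conv \<nu> \<rho> A)"
  using conv_add_left[of \<mu> "\<lambda>A. - 1 * \<nu> A" \<rho>] conv_scale_left[of \<nu> \<rho> "- 1"] by simp

lemma conv_assoc: "\<mu> \<in> carr MK \<Longrightarrow> \<nu> \<in> carr MK \<Longrightarrow> \<rho> \<in> carr MK \<Longrightarrow>
    conv (conv \<mu> \<nu>) \<rho> = conv \<mu> (conv \<nu> \<rho>)"
  using semihypergroup by (simp add: semitop_semihypergroup_def assoc_algebra_def)

lemma conv_pos: "\<mu> \<in> MK_pos \<Longrightarrow> \<nu> \<in> MK_pos \<Longrightarrow> conv \<mu> \<nu> \<in> MK_pos"
  using semihypergroup by (simp add: semitop_semihypergroup_def)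

lemma conv_sum_right:
  assumes "\<mu> \<in> carr MK" "\<And>i. i \<in> I \<Longrightarrow> f i \<in> carr MK"
  shows "conv \<mu> (\<lambda>A. \<Sum>i\<in>I. c i * f i A) = (\<lambda>A. \<Sum>i\<in>I. c i * conv \<mu> (f i) A)"
  using assms(2)
proof (induction I rule: infinite_finite_induct)
  case (insert i I)
  then have "(\<lambda>A. \<Sum>i\<in>I. c i * f i A) \<in> carr MK" "(\<lambda>A. c i * f i A) \<in> carr MK" by simp_all
  then show ?case using insert assms(1) by (simp add: conv_add_right conv_scale_right)
qed (use conv_scale_right[OF assms(1) MK_zero, of 0] in simp_all)

lemma conv_sum_left:
  assumes "\<mu> \<in> carr MK" "\<And>i. i \<in> I \<Longrightarrow> f i \<in> carr MK"
  shows "conv (\<lambda>A. \<Sum>i\<in>I. c i * f i A) \<mu> = (\<lambda>A. \<Sum>i\<in>I. c i * conv (f i) \<mu> A)"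
  using assms(2)
proof (induction I rule: infinite_finite_induct)
  case (insert i I)
  then have "(\<lambda>A. \<Sum>i\<in>I. c i * f i A) \<in> carr MK" "(\<lambda>A. c i * f i A) \<in> carr MK" by simp_all
  then show ?case using insert assms(1) by (simp add: conv_add_left conv_scale_left)
qed (use conv_scale_left[OF MK_zero assms(1), of 0] in simp_all)

section \<open>Total mass and norm of a product\<close>

text \<open>Density is used twice. With a point mass on the left the factor is 1, by the axiom on
  products of two point masses and continuity in the right argument. With an arbitrary \<nu> on the
  right the factor is the mass of \<nu>, by the case just settled and continuity in the left
  argument.\<close>

lemma conv_mass_pos:
  assumes \<mu>: "\<mu> \<in> MK_pos" and \<nu>: "\<nu> \<in> MK_pos"
  shows "Re (conv \<mu> \<nu> UNIV) = Re (\<mu> UNIV) * Re (\<nu> UNIV)"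
proof -
  have d: "dirac x \<in> carr MK" "dirac x \<in> MK_pos" for x :: 'a
    using PK_D[OF dirac_PK[of x]] by auto
  have dirac_mass: "Re (conv (dirac x) \<rho> UNIV) = Re (\<rho> UNIV)" if "\<rho> \<in> MK_pos" for x \<rho>
  proof -
    have "Re (conv (dirac x) \<rho> UNIV) = 1 * Re (\<rho> UNIV)"
    proof (rule mass_determined_by_diracs[OF _ _ that])
      show "continuous_map cone_topology cone_topology (conv (dirac x))"
        using semihypergroup d by (simp add: semitop_semihypergroup_def)
      have "conv (dirac x) (dirac y) UNIV = 1" for y
        using semihypergroup by (simp add: semitop_semihypergroup_def PK_def)
      then show "Re (conv (dirac x) (dirac_sum Y c) UNIV) = 1 * Re (dirac_sum Y c UNIV)" for Y c
        using d by (simp add: dirac_sum_def conv_sum_right) (simp add: dirac_def)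
    qed
    then show ?thesis by simp
  qed
  have "Re (conv \<mu> \<nu> UNIV) = Re (\<nu> UNIV) * Re (\<mu> UNIV)"
  proof (rule mass_determined_by_diracs[OF _ _ \<mu>, where T = "\<lambda>\<mu>. conv \<mu> \<nu>"])
    show "continuous_map cone_topology cone_topology (\<lambda>\<mu>. conv \<mu> \<nu>)"
      using semihypergroup \<nu> by (simp add: semitop_semihypergroup_def)
    show "Re (conv (dirac_sum Y c) \<nu> UNIV) = Re (\<nu> UNIV) * Re (dirac_sum Y c UNIV)" for Y c
      using d MK_posD(1)[OF \<nu>] dirac_mass[OF \<nu>]
      by (simp add: dirac_sum_def conv_sum_left) (simp add: dirac_def sum_distrib_left mult.commute)
  qed
  then show ?thesis by (simp add: mult.commute)
qed

lemma conv_expand: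
  assumes p: "\<And>k::nat. p k \<in> carr MK" and q: "\<And>k::nat. q k \<in> carr MK"
  shows "conv (\<lambda>A. \<Sum>j<4. \<i> ^ j * p j A) (\<lambda>A. \<Sum>k<4. \<i> ^ k * q k A)
    = (\<lambda>A. \<Sum>j<4. \<Sum>k<4. \<i> ^ j * \<i> ^ k * conv (p j) (q k) A)"
proof -
  have "(\<lambda>A. \<Sum>k<4. \<i> ^ k * q k A) \<in> carr MK" using q by simp
  then show ?thesis
    using p q by (simp add: conv_sum_left conv_sum_right sum_distrib_left mult.assoc)
qed

text \<open>Both sides are bilinear, which reduces the claim to the nonnegative parts of the two
  measures.\<close>

lemma conv_mass:
  assumes \<mu>: "\<mu> \<in> carr MK" and \<nu>: "\<nu> \<in> carr MK"
  shows "conv \<mu> \<nu> UNIV = \<mu> UNIV * \<nu> UNIV"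
proof -
  obtain p :: "nat \<Rightarrow> 'a cmeas" where p: "\<And>k. p k \<in> MK_pos" "\<mu> = (\<lambda>A. \<Sum>k<4. \<i> ^ k * p k A)" by (rule jordan_complex[OF \<mu>]) (rule that)
  obtain q :: "nat \<Rightarrow> 'a cmeas" where q: "\<And>k. q k \<in> MK_pos" "\<nu> = (\<lambda>A. \<Sum>k<4. \<i> ^ k * q k A)" by (rule jordan_complex[OF \<nu>]) (rule that)
  have pq: "conv (p j) (q k) UNIV = p j UNIV * q k UNIV" for j k
    using conv_mass_pos[OF p(1) q(1), of j k] MK_posD(3)[OF p(1)] MK_posD(3)[OF q(1)]
      MK_posD(3)[OF conv_pos[OF p(1) q(1)]] by (simp add: complex_eq_iff)
  show ?thesis
    unfolding p(2) q(2) conv_expand[OF MK_posD(1)[OF p(1)] MK_posD(1)[OF q(1)]] pq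
    by (simp add: sum_product mult_ac)
qed

text \<open>The constant is not optimal, but boundedness of the product is all that is needed.\<close>

lemma conv_norm:
  assumes \<mu>: "\<mu> \<in> carr MK" and \<nu>: "\<nu> \<in> carr MK"
  shows "tv (conv \<mu> \<nu>) UNIV \<le> 16 * tv \<mu> UNIV * tv \<nu> UNIV"
proof -
  obtain p :: "nat \<Rightarrow> 'a cmeas" where p: "\<And>k. p k \<in> MK_pos" "\<mu> = (\<lambda>A. \<Sum>k<4. \<i> ^ k * p k A)"
    "\<And>k. Re (p k UNIV) \<le> tv \<mu> UNIV" by (rule jordan_complex[OF \<mu>]) (rule that)
  obtain q :: "nat \<Rightarrow> 'a cmeas" where q: "\<And>k. q k \<in> MK_pos" "\<nu> = (\<lambda>A. \<Sum>k<4. \<i> ^ k * q k A)"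
    "\<And>k. Re (q k UNIV) \<le> tv \<nu> UNIV" by (rule jordan_complex[OF \<nu>]) (rule that)
  note pc = MK_posD(1)[OF p(1)] and qc = MK_posD(1)[OF q(1)]
  have pq: "conv (p j) (q k) \<in> carr MK" for j k using pc qc by simp
  \<comment> \<open>On the positive cone the norm is the mass, and mass is multiplicative. There are
    4 * 4 such terms.\<close>
  have "tv (\<lambda>A. \<i> ^ j * \<i> ^ k * conv (p j) (q k) A) UNIV
      \<le> tv \<mu> UNIV * tv \<nu> UNIV" for j k
  proof -
    have "tv (\<lambda>A. \<i> ^ j * \<i> ^ k * conv (p j) (q k) A) UNIV = Re (p j UNIV) * Re (q k UNIV)"
      by (simp add: MK_norm_scale[OF pq] norm_mult norm_power tv_pos[OF conv_pos[OF p(1) q(1)]]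
          conv_mass_pos[OF p(1) q(1)])
    also have "\<dots> \<le> tv \<mu> UNIV * tv \<nu> UNIV"
      using p q MK_posD(2)[OF p(1)] MK_posD(2)[OF q(1)] MK_norm_nonneg[OF \<mu>] by (intro mult_mono) auto
    finally show ?thesis .
  qed
  then have "(\<Sum>j<4::nat. \<Sum>k<4::nat. tv (\<lambda>A. \<i> ^ j * \<i> ^ k * conv (p j) (q k) A) UNIV)
      \<le> (\<Sum>j<4::nat. \<Sum>k<4::nat. tv \<mu> UNIV * tv \<nu> UNIV)"
    by (intro sum_mono)
  moreover have "tv (\<lambda>A. \<Sum>j<4::nat. \<Sum>k<4::nat. \<i> ^ j * \<i> ^ k * conv (p j) (q k) A) UNIV
      \<le> (\<Sum>j<4::nat. tv (\<lambda>A. \<Sum>k<4::nat. \<i> ^ j * \<i> ^ k * conv (p j) (q k) A) UNIV)"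
    using pq by (intro MK_norm_sum) simp
  moreover have "\<dots> \<le> (\<Sum>j<4::nat. \<Sum>k<4::nat. tv (\<lambda>A. \<i> ^ j * \<i> ^ k * conv (p j) (q k) A) UNIV)"
    using pq by (intro sum_mono MK_norm_sum) simp
  moreover have "conv \<mu> \<nu> = (\<lambda>A. \<Sum>j<4::nat. \<Sum>k<4::nat. \<i> ^ j * \<i> ^ k * conv (p j) (q k) A)"
    unfolding p(2) q(2) by (rule conv_expand[OF pc qc])
  ultimately show ?thesis by simp
qed

lemma conv_PK: "\<mu> \<in> PK \<Longrightarrow> \<nu> \<in> PK \<Longrightarrow> conv \<mu> \<nu> \<in> PK"
  using conv_mass[of \<mu> \<nu>] conv_pos[of \<mu> \<nu>] by (simp add: PK_def MK_posD(1))

text \<open>Convolution with a nonnegative measure preserves real measures, as the Jordan parts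
  show, and so it respects the splitting into real and imaginary parts.\<close>

lemma conv_re_part:
  assumes \<nu>: "\<nu> \<in> MK_pos" and \<mu>: "\<mu> \<in> carr MK"
  shows "conv \<nu> (re_part \<mu>) = re_part (conv \<nu> \<mu>)"
proof -
  have real: "Im (conv \<nu> (re_part \<rho>) A) = 0" if \<rho>: "\<rho> \<in> carr MK" for \<rho> A
  proof -
    obtain p q where "p \<in> MK_pos" "q \<in> MK_pos" "re_part \<rho> = (\<lambda>A. p A - q A)"
      by (rule jordan_real[OF \<rho>])
    then show ?thesis
      using conv_pos[OF \<nu>] \<nu> by (simp add: conv_diff_right MK_posD(1,3))
  qed
  let ?i = "\<lambda>A. - \<i> * \<mu> A"
  have i: "?i \<in> carr MK" using \<mu> by (rule MK_scale)
  have "\<mu> = (\<lambda>A. re_part \<mu> A + \<i> * re_part ?i A)"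
    by (simp add: re_part_def complex_eq_iff fun_eq_iff)
  then have "conv \<nu> \<mu> = (\<lambda>A. conv \<nu> (re_part \<mu>) A + \<i> * conv \<nu> (re_part ?i) A)"
    using conv_add_right[OF MK_posD(1)[OF \<nu>] re_part_MK[OF \<mu>] MK_scale[OF re_part_MK[OF i]], of \<i>]
      conv_scale_right[OF MK_posD(1)[OF \<nu>] re_part_MK[OF i], of \<i>] by simp
  then have "re_part (conv \<nu> \<mu>) A = of_real (Re (conv \<nu> (re_part \<mu>) A))" for A
    using real[OF i] by (simp add: re_part_def)
  then show ?thesis using real[OF \<mu>] by (simp add: fun_eq_iff complex_eq_iff)
qed

text \<open>Write \<open>D\<close> for the variation of \<open>conv \<nu> r - r\<close>. On each
  Borel set the variation of \<open>r\<close> is at most that of \<open>conv \<nu> r\<close> plus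
  \<open>D\<close>, so \<open>conv \<nu> (tv_measure r) - tv_measure r\<close> is nowhere below
  \<open>- D\<close>. Its mass vanishes, and the balance of positive and negative values gives
  \<open>2 * D\<close>.\<close>

lemma tv_measure_almost_invariant:
  assumes \<nu>: "\<nu> \<in> PK" and r: "r \<in> carr MK" "\<And>A. Im (r A) = 0"
  shows "tv (\<lambda>A. conv \<nu> (tv_measure r) A - tv_measure r A) UNIV
    \<le> 2 * tv (\<lambda>A. conv \<nu> r A - r A) UNIV"
proof (rule tv_le_of_lower_bound)
  note \<nu>p = PK_D(1)[OF \<nu>] and \<nu>c = PK_D(2)[OF \<nu>]
  have t: "tv_measure r \<in> MK_pos" using r(1) by simp
  note tc = MK_posD(1)[OF t]
  have nt: "conv \<nu> (tv_measure r) \<in> MK_pos" by (rule conv_pos[OF \<nu>p t])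
  show "(\<lambda>A. conv \<nu> (tv_measure r) A - tv_measure r A) \<in> complex_measures"
    using \<nu>c tc by (intro MK_cm) simp
  show "conv \<nu> (tv_measure r) UNIV - tv_measure r UNIV = 0"
    using conv_mass[OF \<nu>c tc] PK_D(3)[OF \<nu>] by simp
  show "Im (conv \<nu> (tv_measure r) A - tv_measure r A) = 0" for A
    using MK_posD(3)[OF nt] MK_posD(3)[OF t] by simp
  fix E :: "'a set" assume E: "E \<in> sets borel"
  have re: "re_part r = r" using r(2) by (simp add: re_part_def fun_eq_iff complex_eq_iff)
  have real: "Im (conv \<nu> r A) = 0" for A
    using conv_re_part[OF \<nu>p r(1)] unfolding re by (metis Im_complex_of_real re_part_def)
  have nr: "conv \<nu> r \<in> carr MK" using \<nu>c r(1) by simp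
  have abs_le: "\<bar>Re (r A)\<bar> \<le> Re (tv_measure r A)" for A
    using tv_ge[OF MK_cm[OF r(1)], of A] cm_outside[OF MK_cm[OF r(1)], of A] abs_Re_le_cmod[of "r A"]
    by (auto simp: tv_measure_def)
  have le: "0 \<le> Re (tv_measure r A) + Re (r A)" "Re (r A) \<le> Re (tv_measure r A)" for A
    using abs_le[of A] by auto
  have "cmod (conv \<nu> r A) \<le> Re (conv \<nu> (tv_measure r) A)" for A
  proof -
    \<comment> \<open>Positivity of the product is applied to the variation plus \<open>r\<close>
      and minus \<open>r\<close>; together the two results bound the modulus of the real measure
      \<open>conv \<nu> r\<close>.\<close>
    have "(\<lambda>A. tv_measure r A + r A) \<in> MK_pos" "(\<lambda>A. tv_measure r A - r A) \<in> MK_pos"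
      using tc r le MK_posD(3)[OF t] by (auto intro!: MK_posI)
    from conv_pos[OF \<nu>p this(1)] conv_pos[OF \<nu>p this(2)]
    have "(\<lambda>A. conv \<nu> (tv_measure r) A + conv \<nu> r A) \<in> MK_pos"
      "(\<lambda>A. conv \<nu> (tv_measure r) A - conv \<nu> r A) \<in> MK_pos"
      using \<nu>c tc r(1) by (simp_all add: conv_add_right conv_diff_right)
    from MK_posD(2)[OF this(1), of A] MK_posD(2)[OF this(2), of A] show ?thesis
      using real[of A] by (simp add: cmod_eq_Re)
  qed
  then have "tv (conv \<nu> r) E \<le> Re (conv \<nu> (tv_measure r) E)"
    by (intro tv_dominated MK_cm[OF MK_posD(1)[OF nt]] E)
  moreover have "tv r E \<le> tv (conv \<nu> r) E + tv (\<lambda>A. conv \<nu> r A - r A) E"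
    using nr r(1) norm_triangle_ineq4[of "conv \<nu> r A" "conv \<nu> r A - r A" for A]
    by (intro tv_triangle MK_cm E) auto
  moreover have "tv (\<lambda>A. conv \<nu> r A - r A) E \<le> tv (\<lambda>A. conv \<nu> r A - r A) UNIV"
    using nr r(1) E by (intro tv_mono MK_cm) auto
  ultimately show "- tv (\<lambda>A. conv \<nu> r A - r A) UNIV \<le> Re (conv \<nu> (tv_measure r) E - tv_measure r E)"
    using E by (simp add: tv_measure_def)
qed

section \<open>Functionals on M(K) and their translates\<close>

lemma dual_MK_bound: "\<phi> \<in> carr (dual MK) \<Longrightarrow> \<mu> \<in> carr MK \<Longrightarrow>
    cmod (\<phi> \<mu>) \<le> vnorm (dual MK) \<phi> * tv \<mu> UNIV" for \<mu> :: "'a cmeas"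
  using dual_bound[OF complex_normed_MK] by simp

lemma dual_MK_linear:
  fixes \<mu> \<nu> :: "'a cmeas"
  assumes "\<phi> \<in> carr (dual MK)"
  shows "\<mu> \<in> carr MK \<Longrightarrow> \<nu> \<in> carr MK \<Longrightarrow> \<phi> (\<lambda>A. \<mu> A + \<nu> A) = \<phi> \<mu> + \<phi> \<nu>"
    and "\<mu> \<in> carr MK \<Longrightarrow> \<phi> (\<lambda>A. c * \<mu> A) = c * \<phi> \<mu>"
    and "\<mu> \<in> carr MK \<Longrightarrow> \<nu> \<in> carr MK \<Longrightarrow> \<phi> (\<lambda>A. \<mu> A - \<nu> A) = \<phi> \<mu> - \<phi> \<nu>"
  using dualD(1)[OF assms, of \<mu> \<nu>] dualD(2)[OF assms, of \<mu> c] dualD(2)[OF assms, of \<nu> "- 1"]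
    dualD(1)[OF assms, of \<mu> "\<lambda>A. - 1 * \<nu> A"] by simp_all

lemma left_translate_dual [simp]:
  assumes \<mu>: "\<mu> \<in> carr MK" and \<phi>: "\<phi> \<in> carr (dual MK)"
  shows "left_translate conv \<mu> \<phi> \<in> carr (dual MK)"
proof (rule dualI)
  fix \<nu> :: "'a cmeas" assume \<nu>: "\<nu> \<in> carr MK"
  have "cmod (\<phi> (conv \<mu> \<nu>)) \<le> vnorm (dual MK) \<phi> * (16 * tv \<mu> UNIV * tv \<nu> UNIV)"
    using dual_MK_bound[OF \<phi> conv_closed[OF \<mu> \<nu>]] mult_left_mono[OF conv_norm[OF \<mu> \<nu>]
        dual_norm_nonneg[OF complex_normed_MK \<phi>]] by linarith
  then show "cmod (left_translate conv \<mu> \<phi> \<nu>)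
      \<le> (16 * vnorm (dual MK) \<phi> * tv \<mu> UNIV) * vnorm MK \<nu>"
    using \<nu> by (simp add: left_translate_def mult_ac)
qed (use \<mu> \<phi> in \<open>simp_all add: left_translate_def conv_add_right conv_scale_right dual_MK_linear\<close>)

lemma right_translate_dual [simp]:
  assumes \<mu>: "\<mu> \<in> carr MK" and \<phi>: "\<phi> \<in> carr (dual MK)"
  shows "right_translate conv \<mu> \<phi> \<in> carr (dual MK)"
proof (rule dualI)
  fix \<nu> :: "'a cmeas" assume \<nu>: "\<nu> \<in> carr MK"
  have "cmod (\<phi> (conv \<nu> \<mu>)) \<le> vnorm (dual MK) \<phi> * (16 * tv \<nu> UNIV * tv \<mu> UNIV)"
    using dual_MK_bound[OF \<phi> conv_closed[OF \<nu> \<mu>]] mult_left_mono[OF conv_norm[OF \<nu> \<mu>]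
        dual_norm_nonneg[OF complex_normed_MK \<phi>]] by linarith
  then show "cmod (right_translate conv \<mu> \<phi> \<nu>)
      \<le> (16 * vnorm (dual MK) \<phi> * tv \<mu> UNIV) * vnorm MK \<nu>"
    using \<nu> by (simp add: right_translate_def mult_ac)
qed (use \<mu> \<phi> in \<open>simp_all add: right_translate_def conv_add_left conv_scale_left dual_MK_linear\<close>)

lemma one_dual [simp]: "one_functional \<in> carr (dual (MK :: 'a cmeas cnspace))"
  by (rule dualI[of _ _ 1]) (auto simp: one_functional_def MK_norm_ge)

end

section \<open>Almost invariant probability measures\<close>

context semihypergroup
begin

text \<open>Algebraic linearity: the form obtained from stationarity comes without a norm
  estimate.\<close>

definition linear_form :: "(('a cmeas \<Rightarrow> complex) \<Rightarrow> complex) \<Rightarrow> bool" where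
  "linear_form m \<longleftrightarrow>
     (\<forall>\<phi>\<in>carr (dual MK). \<forall>\<psi>\<in>carr (dual MK). m (\<lambda>x. \<phi> x + \<psi> x) = m \<phi> + m \<psi>) \<and>
     (\<forall>c. \<forall>\<phi>\<in>carr (dual MK). m (\<lambda>x. c * \<phi> x) = c * m \<phi>)"

definition invariant_form :: "(('a cmeas \<Rightarrow> complex) \<Rightarrow> complex) \<Rightarrow> bool" where
  "invariant_form m \<longleftrightarrow> linear_form m \<and> m one_functional = 1 \<and>
     (\<forall>\<nu>\<in>PK. \<forall>\<phi>\<in>carr (dual MK). m (left_translate conv \<nu> \<phi>) = m \<phi>)"

definition defect :: "'a cmeas \<Rightarrow> 'a cmeas \<Rightarrow> real" where
  "defect \<nu> \<sigma> = tv (\<lambda>A. conv \<nu> \<sigma> A - \<sigma> A) UNIV"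

lemmas dual_closed = dual_add[OF complex_normed_MK] dual_scale[OF complex_normed_MK]
  dual_diff[OF complex_normed_MK] dual_sum[OF complex_normed_MK] dual_zero[OF complex_normed_MK]

lemma linear_form_diff:
  assumes "linear_form m" "\<phi> \<in> carr (dual MK)" "\<psi> \<in> carr (dual MK)"
  shows "m (\<lambda>x. \<phi> x - \<psi> x) = m \<phi> - m \<psi>"
proof -
  have "m (\<lambda>x. \<phi> x + - 1 * \<psi> x) = m \<phi> + - 1 * m \<psi>"
    using assms dual_closed(2)[OF assms(3), of "- 1"] unfolding linear_form_def by metis
  then show ?thesis by simp
qed

lemma linear_form_sum:
  assumes m: "linear_form m" and "\<And>i. i \<in> I \<Longrightarrow> f i \<in> carr (dual MK)"
  shows "m (\<lambda>x. \<Sum>i\<in>I. f i x) = (\<Sum>i\<in>I. m (f i))"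
proof -
  have zero: "m (\<lambda>x. 0) = 0"
    using m[unfolded linear_form_def, THEN conjunct2, THEN spec, of 0, THEN bspec, OF dual_closed(5)] by simp
  show ?thesis
    using assms(2)
  proof (induction I rule: infinite_finite_induct)
    case (insert i I)
    then have "(\<lambda>x. \<Sum>i\<in>I. f i x) \<in> carr (dual MK)" by (intro dual_closed) auto
    then show ?case using insert m by (simp add: linear_form_def)
  qed (simp_all add: zero)
qed

text \<open>If no measure of mass one had small defect, the functional \<open>e * Re (n UNIV)\<close> of the tuple of
  defects would extend to the whole product space; its components exhibit a multiple of
  \<open>one_functional\<close> as a sum of terms \<open>left_translate conv \<nu> \<phi> - \<phi>\<close>, which \<open>m\<close> annihilates.\<close>

lemma almost_invariant_complex_measure:
  assumes m: "invariant_form m" and F: "finite F" "F \<subseteq> PK" and e: "e > 0"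
  shows "\<exists>n\<in>carr MK. n UNIV = 1 \<and> (\<Sum>\<nu>\<in>F. defect \<nu> n) < e"
proof (rule ccontr)
  assume "\<not> ?thesis"
  then have far: "e \<le> (\<Sum>\<nu>\<in>F. defect \<nu> n)" if "n \<in> carr MK" "n UNIV = 1" for n
    using that by force
  have FMK: "\<nu> \<in> carr MK" if "\<nu> \<in> F" for \<nu> using PK_D(2) F(2) that by blast
  \<comment> \<open>Tuples indexed by \<open>F\<close> are represented as functions on all set
    functions. Membership in \<open>V\<close> and the seminorm \<open>p\<close> look at the
    coordinates in \<open>F\<close> alone.\<close>
  define scale :: "real \<Rightarrow> ('a cmeas \<Rightarrow> 'a cmeas) \<Rightarrow> ('a cmeas \<Rightarrow> 'a cmeas)"
    where "scale r f = (\<lambda>\<nu> A. of_real r * f \<nu> A)" for r f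
  define V where "V = {f :: 'a cmeas \<Rightarrow> 'a cmeas. \<forall>\<nu>\<in>F. f \<nu> \<in> carr MK}"
  define p where "p f = (\<Sum>\<nu>\<in>F. tv (f \<nu>) UNIV)" for f :: "'a cmeas \<Rightarrow> 'a cmeas"
  define T where "T n = (\<lambda>\<nu> A. if \<nu> \<in> F then conv \<nu> n A - n A else 0)" for n
  define \<Gamma> where "\<Gamma> = {(T n, e * Re (n UNIV)) | n. n \<in> carr MK}"
  interpret vector_space scale
    by unfold_locales (auto simp: scale_def fun_eq_iff algebra_simps)
  have subV: "subspace V"
    unfolding subspace_def by (auto simp: V_def scale_def plus_fun_def zero_fun_def)
  interpret real_subspace scale V by unfold_locales (rule subV)
  have TV: "T n \<in> V" if "n \<in> carr MK" for n
    using that FMK by (auto simp: T_def V_def)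
  have T_add: "T (\<lambda>A. n A + k A) = T n + T k" if "n \<in> carr MK" "k \<in> carr MK" for n k
    using that FMK by (auto simp: T_def fun_eq_iff conv_add_right)
  have T_scale: "T (\<lambda>A. c * n A) = (\<lambda>\<nu> A. c * T n \<nu> A)" if "n \<in> carr MK" for n c
    using that FMK by (auto simp: T_def fun_eq_iff conv_scale_right algebra_simps)
  have pT: "p (T n) = (\<Sum>\<nu>\<in>F. defect \<nu> n)" for n
    unfolding p_def defect_def by (rule sum.cong) (auto simp: T_def)
  have sub: "sublinear p"
    unfolding sublinear_def
  proof (intro conjI ballI allI impI)
    show "p (x + y) \<le> p x + p y" if "x \<in> V" "y \<in> V" for x y
      unfolding p_def sum.distrib[symmetric] using that
      by (intro sum_mono) (auto simp: V_def plus_fun_def intro!: tv_add MK_cm)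
    show "p (scale t x) \<le> t * p x" if "t > 0" "x \<in> V" for t x
      unfolding p_def sum_distrib_left using that
      by (intro sum_mono) (auto simp: V_def scale_def MK_norm_scale)
  qed
  have p_nonneg: "0 \<le> p f" if "f \<in> V" for f
    unfolding p_def using that by (intro sum_nonneg) (auto simp: V_def MK_norm_nonneg)
  have "e * Re (n UNIV) \<le> p (T n)" if n: "n \<in> carr MK" for n
  proof (cases "n UNIV = 0")
    case True
    then show ?thesis using p_nonneg[OF TV[OF n]] by simp
  next
    case False
    \<comment> \<open>Dividing by the complex mass also removes its phase: \<open>p (T n)\<close> is
      \<open>cmod ?c\<close> times the value for a measure of mass one, hence at least
      \<open>e * cmod ?c\<close>, which exceeds \<open>e * Re ?c\<close> or equals it.\<close>
    let ?c = "n UNIV" and ?k = "\<lambda>A. 1 / n UNIV * n A"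
    have k: "?k \<in> carr MK" using n by (rule MK_scale)
    have Tk: "T n = (\<lambda>\<nu> A. ?c * T ?k \<nu> A)" using T_scale[OF n, of "1 / ?c"] False by (simp add: fun_eq_iff)
    have "p (T n) = cmod ?c * p (T ?k)"
      unfolding p_def sum_distrib_left
    proof (rule sum.cong[OF refl])
      fix \<nu> assume "\<nu> \<in> F"
      then have "T ?k \<nu> \<in> carr MK" using TV[OF k] by (simp add: V_def)
      from MK_norm_scale[OF this, of ?c]
      show "tv (T n \<nu>) UNIV = cmod ?c * tv (T ?k \<nu>) UNIV"
        by (subst Tk)
    qed
    moreover have "e \<le> p (T ?k)" unfolding pT using far[OF k] False by simp
    ultimately have "e * cmod ?c \<le> p (T n)" using mult_left_mono[of e "p (T ?k)" "cmod ?c"]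
      by (simp add: mult.commute)
    moreover have "e * Re ?c \<le> e * cmod ?c" using e complex_Re_le_cmod[of ?c] by simp
    ultimately show ?thesis by linarith
  qed
  then have "\<exists>f. linear_functional f \<and> (\<forall>x\<in>V. f x \<le> p x) \<and> (\<forall>(v, r)\<in>\<Gamma>. r \<le> f v)"
  proof (intro Hahn_Banach_cone[OF sub])
    show "\<Gamma> \<subseteq> V \<times> UNIV" using TV by (auto simp: \<Gamma>_def)
    have "T (\<lambda>A. 0) = 0" using T_scale[OF MK_zero, of 0] by (simp add: zero_fun_def)
    then show "(0, 0) \<in> \<Gamma>" unfolding \<Gamma>_def using MK_zero by force
    show "(v + w, r + s) \<in> \<Gamma>" if vw: "(v, r) \<in> \<Gamma>" "(w, s) \<in> \<Gamma>" for v r w s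
    proof -
      obtain n k where "n \<in> carr MK" "k \<in> carr MK" "v = T n" "r = e * Re (n UNIV)"
        "w = T k" "s = e * Re (k UNIV)"
        using vw by (auto simp: \<Gamma>_def)
      then show ?thesis
        unfolding \<Gamma>_def using T_add
        by (intro CollectI exI[of _ "\<lambda>A. n A + k A"]) (auto simp: algebra_simps)
    qed
    show "(scale t v, t * r) \<in> \<Gamma>" if "t > 0" and vr: "(v, r) \<in> \<Gamma>" for t v r
    proof -
      obtain n where "n \<in> carr MK" "v = T n" "r = e * Re (n UNIV)" using vr by (auto simp: \<Gamma>_def)
      then show ?thesis
        unfolding \<Gamma>_def using T_scale[of n "of_real t"]
        by (intro CollectI exI[of _ "\<lambda>A. of_real t * n A"]) (auto simp: scale_def)
    qed
  qed (auto simp: \<Gamma>_def)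
  then obtain f where f: "linear_functional f" "\<And>x. x \<in> V \<Longrightarrow> f x \<le> p x"
    and f\<Gamma>: "\<And>n. n \<in> carr MK \<Longrightarrow> e * Re (n UNIV) \<le> f (T n)"
    unfolding \<Gamma>_def by blast
  have f_add: "f (x + y) = f x + f y" if "x \<in> V" "y \<in> V" for x y
    using f(1) that by (simp add: linear_functional_def)
  have f_scale: "f (scale t x) = t * f x" if "x \<in> V" for t x
    using f(1) that by (simp add: linear_functional_def)
  \<comment> \<open>The constraint is an inequality, but it applies to the negative of
    \<open>n\<close> as well and so becomes an equation.\<close>
  have fT: "f (T n) = e * Re (n UNIV)" if n: "n \<in> carr MK" for n
  proof -
    have "T (\<lambda>A. - 1 * n A) = scale (- 1) (T n)" using T_scale[OF n, of "- 1"] by (simp add: scale_def)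
    then have "f (T (\<lambda>A. - 1 * n A)) = - f (T n)" using f_scale[OF TV[OF n], of "- 1"] by simp
    then show ?thesis using f\<Gamma>[OF n] f\<Gamma>[OF MK_scale[OF n], of "- 1"] by simp
  qed
  define single :: "'a cmeas \<Rightarrow> 'a cmeas \<Rightarrow> 'a cmeas \<Rightarrow> 'a cmeas"
    where "single \<nu> x = (\<lambda>\<kappa> A. if \<kappa> = \<nu> then x A else 0)" for \<nu> x
  have singleV: "single \<nu> x \<in> V" if "x \<in> carr MK" for \<nu> x
  proof -
    have "single \<nu> x \<kappa> \<in> carr MK" for \<kappa>
      using that by (cases "\<kappa> = \<nu>") (simp_all add: single_def)
    then show ?thesis by (simp add: V_def)
  qed
  have single_add: "single \<nu> (\<lambda>A. x A + y A) = single \<nu> x + single \<nu> y" for \<nu> x y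
    by (auto simp: single_def fun_eq_iff)
  have single_scale: "single \<nu> (\<lambda>A. of_real r * x A) = scale r (single \<nu> x)" for \<nu> x r
    by (auto simp: single_def scale_def fun_eq_iff)
  have p_single: "p (single \<nu> x) = tv x UNIV" if "\<nu> \<in> F" "x \<in> carr MK" for \<nu> x
  proof -
    have "p (single \<nu> x) = (\<Sum>\<kappa>\<in>F. if \<kappa> = \<nu> then tv x UNIV else 0)"
      unfolding p_def by (rule sum.cong) (auto simp: single_def)
    then show ?thesis using F(1) that by simp
  qed
  have f_single_bound: "\<bar>f (single \<nu> x)\<bar> \<le> tv x UNIV" if "\<nu> \<in> F" "x \<in> carr MK" for \<nu> x
  proof -
    have "f (single \<nu> (\<lambda>A. of_real (- 1) * x A)) = - f (single \<nu> x)"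
      unfolding single_scale f_scale[OF singleV[OF that(2)]] by simp
    moreover have "f (single \<nu> (\<lambda>A. of_real (- 1) * x A)) \<le> tv x UNIV"
      using f(2)[OF singleV[OF MK_scale[OF that(2)]], of \<nu> "of_real (- 1)"]
        p_single[OF that(1) MK_scale[OF that(2)], of "of_real (- 1)"]
        MK_norm_scale[OF that(2), of "of_real (- 1)"] by simp
    ultimately show ?thesis using f(2)[OF singleV[OF that(2)], of \<nu>] p_single[OF that] by simp
  qed
  \<comment> \<open>The complex functional whose real part is the coordinate \<open>u\<close> of
    \<open>f\<close>, namely \<open>u x - \<i> * u (\<i> * x)\<close>.\<close>
  define \<Phi> where "\<Phi> \<nu> x = (if x \<in> carr MK then
      Complex (f (single \<nu> x)) (- f (single \<nu> (\<lambda>A. \<i> * x A))) else 0)" for \<nu> x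
  have \<Phi>_dual: "\<Phi> \<nu> \<in> carr (dual MK)" if \<nu>: "\<nu> \<in> F" for \<nu>
  proof (rule dualI)
    fix x y :: "'a cmeas" assume xy: "x \<in> carr MK" "y \<in> carr MK"
    show "\<Phi> \<nu> (vadd MK x y) = \<Phi> \<nu> x + \<Phi> \<nu> y"
      using xy by (simp add: \<Phi>_def single_add distrib_left f_add singleV complex_eq_iff)
  next
    fix c and x :: "'a cmeas" assume x: "x \<in> carr MK"
    define u where "u = f (single \<nu> x)"
    define v where "v = f (single \<nu> (\<lambda>A. \<i> * x A))"
    have comb: "f (single \<nu> (\<lambda>A. Complex a b * x A)) = a * u + b * v" for a b
    proof -
      have "single \<nu> (\<lambda>A. Complex a b * x A) = scale a (single \<nu> x) + scale b (single \<nu> (\<lambda>A. \<i> * x A))"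
        by (auto simp: single_def scale_def fun_eq_iff complex_eq_iff)
      then show ?thesis using x by (simp add: f_add f_scale singleV u_def v_def)
    qed
    have "(\<lambda>A. \<i> * (c * x A)) = (\<lambda>A. Complex (- Im c) (Re c) * x A)"
      by (auto simp: fun_eq_iff complex_eq_iff algebra_simps)
    then show "\<Phi> \<nu> (vscale MK c x) = c * \<Phi> \<nu> x"
      using x comb[of "Re c" "Im c"] comb[of "- Im c" "Re c"]
      by (simp add: \<Phi>_def u_def[symmetric] v_def[symmetric] complex_eq_iff algebra_simps)
  next
    fix x :: "'a cmeas" assume x: "x \<in> carr MK"
    have "\<bar>f (single \<nu> (\<lambda>A. \<i> * x A))\<bar> \<le> tv x UNIV"
      using f_single_bound[OF \<nu> MK_scale[OF x], of \<i>] MK_norm_scale[OF x, of \<i>] by simp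
    \<comment> \<open>The factor 2 comes from adding the bounds for real and imaginary part.\<close>
    then show "cmod (\<Phi> \<nu> x) \<le> 2 * vnorm MK x"
      using x f_single_bound[OF \<nu> x] cmod_le[of "\<Phi> \<nu> x"] by (simp add: \<Phi>_def)
  qed (simp add: \<Phi>_def)
  have f_sum: "f (\<lambda>\<nu> A. if \<nu> \<in> G then y \<nu> A else 0) = (\<Sum>\<nu>\<in>G. f (single \<nu> (y \<nu>)))"
    if G: "G \<subseteq> F" and y: "\<And>\<nu>. \<nu> \<in> F \<Longrightarrow> y \<nu> \<in> carr MK" for G and y :: "'a cmeas \<Rightarrow> 'a cmeas"
    using finite_subset[OF G F(1)] G
  proof (induction G)
    case empty
    have "f 0 = 0" using f_scale[OF V_zero, of 0] by simp
    then show ?case by (simp add: zero_fun_def)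
  next
    case (insert a G)
    have "(\<lambda>\<nu> A. if \<nu> \<in> insert a G then y \<nu> A else 0)
        = single a (y a) + (\<lambda>\<nu> A. if \<nu> \<in> G then y \<nu> A else 0)"
      by (intro ext) (use insert(2) in \<open>auto simp: single_def\<close>)
    moreover have "(\<lambda>A. if \<nu> \<in> G then y \<nu> A else 0) \<in> carr MK" if "\<nu> \<in> F" for \<nu>
      using y[OF that] by (cases "\<nu> \<in> G") simp_all
    then have "(\<lambda>\<nu> A. if \<nu> \<in> G then y \<nu> A else 0) \<in> V"
      by (simp add: V_def)
    moreover have "single a (y a) \<in> V" using insert(4) y by (intro singleV) auto
    ultimately show ?case using insert by (simp add: f_add)
  qed
  have \<Phi>_sum: "(\<Sum>\<nu>\<in>F. \<Phi> \<nu> (\<lambda>A. conv \<nu> n A - n A)) = of_real e * n UNIV" if n: "n \<in> carr MK" for n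
  proof -
    have y: "(\<lambda>A. conv \<nu> n A - n A) \<in> carr MK" if "\<nu> \<in> F" for \<nu> using FMK[OF that] n by simp
    have i: "(\<lambda>A. \<i> * n A) \<in> carr MK" using n by (rule MK_scale)
    have 1: "(\<Sum>\<nu>\<in>F. f (single \<nu> (\<lambda>A. conv \<nu> n A - n A))) = e * Re (n UNIV)"
      using f_sum[of F "\<lambda>\<nu> A. conv \<nu> n A - n A"] y fT[OF n] by (simp add: T_def)
    have "(\<Sum>\<nu>\<in>F. f (single \<nu> (\<lambda>A. \<i> * (conv \<nu> n A - n A)))) = f (\<lambda>\<nu> A. if \<nu> \<in> F then \<i> * (conv \<nu> n A - n A) else 0)"
      using f_sum[of F "\<lambda>\<nu> A. \<i> * (conv \<nu> n A - n A)"] MK_scale[OF y, of _ \<i>] by simp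
    \<comment> \<open>The imaginary part is read off from the measure \<open>\<i> * n\<close>, whose
      mass has real part \<open>- Im (n UNIV)\<close>.\<close>
    also have "(\<lambda>\<nu> A. if \<nu> \<in> F then \<i> * (conv \<nu> n A - n A) else 0) = T (\<lambda>A. \<i> * n A)"
      unfolding T_scale[OF n] by (auto simp: T_def fun_eq_iff)
    finally have 2: "(\<Sum>\<nu>\<in>F. f (single \<nu> (\<lambda>A. \<i> * (conv \<nu> n A - n A)))) = - e * Im (n UNIV)"
      using fT[OF i] by simp
    show ?thesis
      using 1 2 y by (simp add: \<Phi>_def complex_eq_iff sum_negf)
  qed
  define \<psi> where "\<psi> \<nu> = (\<lambda>x. left_translate conv \<nu> (\<Phi> \<nu>) x - \<Phi> \<nu> x)" for \<nu>
  have \<psi>_dual: "\<psi> \<nu> \<in> carr (dual MK)" if "\<nu> \<in> F" for \<nu>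
    unfolding \<psi>_def using FMK[OF that] \<Phi>_dual[OF that] by (intro dual_closed) auto
  have "m (\<psi> \<nu>) = 0" if "\<nu> \<in> F" for \<nu>
  proof -
    have "m (\<psi> \<nu>) = m (left_translate conv \<nu> (\<Phi> \<nu>)) - m (\<Phi> \<nu>)"
      unfolding \<psi>_def using m FMK[OF that] \<Phi>_dual[OF that]
      by (intro linear_form_diff) (auto simp: invariant_form_def)
    then show ?thesis using m \<Phi>_dual[OF that] F(2) that by (simp add: invariant_form_def subset_iff)
  qed
  then have "m (\<lambda>x. \<Sum>\<nu>\<in>F. \<psi> \<nu> x) = 0"
    using linear_form_sum[of m F \<psi>] m \<psi>_dual by (simp add: invariant_form_def)
  moreover have "(\<lambda>x. \<Sum>\<nu>\<in>F. \<psi> \<nu> x) = (\<lambda>x. of_real e * one_functional x)"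
  proof
    fix x :: "'a cmeas"
    show "(\<Sum>\<nu>\<in>F. \<psi> \<nu> x) = of_real e * one_functional x"
    proof (cases "x \<in> carr MK")
      case True
      have "\<psi> \<nu> x = \<Phi> \<nu> (\<lambda>A. conv \<nu> x A - x A)" if "\<nu> \<in> F" for \<nu>
        using True FMK[OF that] \<Phi>_dual[OF that]
        by (simp add: \<psi>_def left_translate_def dual_MK_linear(3))
      then show ?thesis using \<Phi>_sum[OF True] True by (simp add: one_functional_def)
    next
      case False
      then show ?thesis by (simp add: \<psi>_def left_translate_def one_functional_def \<Phi>_def)
    qed
  qed
  moreover have "m (\<lambda>x. of_real e * one_functional x) = of_real e * m one_functional"
    using m one_dual by (simp add: invariant_form_def linear_form_def)
  ultimately show False using m e by (simp add: invariant_form_def)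
qed

text \<open>The finitary form of (2), in which the pairs of a finite set and a tolerance play the
  role of the index set.\<close>

definition almost_invariance :: bool where
  "almost_invariance \<longleftrightarrow>
     (\<forall>F e. finite F \<longrightarrow> F \<subseteq> PK \<longrightarrow> e > 0 \<longrightarrow> (\<exists>\<sigma>\<in>PK. \<forall>\<nu>\<in>F. defect \<nu> \<sigma> < e))"

text \<open>The normalised variation of the real part of an almost invariant measure is almost
  invariant: this replaces an invariant functional by a positive one.\<close>

lemma almost_invariance_if_form:
  assumes m: "invariant_form m"
  shows "almost_invariance"
  unfolding almost_invariance_def
proof (intro allI impI)
  fix F :: "'a cmeas set" and e :: real assume F: "finite F" "F \<subseteq> PK" and e: "e > 0"
  \<comment> \<open>Passing to the variation doubles the defect; taking the real part and
    normalising do not increase it.\<close>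
  have "e / 2 > 0" using e by simp
  from almost_invariant_complex_measure[OF m F this] obtain n
    where n: "n \<in> carr MK" "n UNIV = 1" "(\<Sum>\<nu>\<in>F. defect \<nu> n) < e / 2" by blast
  have FMK: "\<nu> \<in> carr MK" if "\<nu> \<in> F" for \<nu> using PK_D(2) F(2) that by blast
  have dn: "defect \<nu> n < e / 2" if "\<nu> \<in> F" for \<nu>
  proof -
    have "defect \<nu> n \<le> (\<Sum>\<nu>\<in>F. defect \<nu> n)"
      using FMK n(1) F(1) that by (intro member_le_sum) (auto simp: defect_def intro!: MK_norm_nonneg)
    then show ?thesis using n(3) by simp
  qed
  define r where "r = re_part n"
  have r: "r \<in> carr MK" "Im (r A) = 0" for A using n(1) by (simp_all add: r_def) (simp add: re_part_def)
  define M where "M = tv r UNIV"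
  \<comment> \<open>The real part still has mass 1, so its norm is at least 1 and division by it
    cannot enlarge a defect.\<close>
  have M: "M \<ge> 1" using tv_ge[OF MK_cm[OF r(1)], of UNIV] n(2) by (simp add: M_def r_def re_part_def)
  define \<sigma> where "\<sigma> = (\<lambda>A. of_real (1 / M) * tv_measure r A)"
  have t: "tv_measure r \<in> MK_pos" using r(1) by simp
  have "\<sigma> \<in> MK_pos" unfolding \<sigma>_def using M by (intro MK_pos_scale[OF t]) simp
  moreover have "\<sigma> UNIV = 1" using M by (simp add: \<sigma>_def tv_measure_def M_def[symmetric])
  ultimately have \<sigma>: "\<sigma> \<in> PK" by (simp add: PK_def)
  have "defect \<nu> \<sigma> < e" if \<nu>: "\<nu> \<in> F" for \<nu>
  proof -
    note \<nu>c = FMK[OF \<nu>] and \<nu>P = subsetD[OF F(2) \<nu>]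
    have tc: "tv_measure r \<in> carr MK" by (rule MK_posD(1)[OF t])
    have "(\<lambda>A. conv \<nu> \<sigma> A - \<sigma> A) = (\<lambda>A. of_real (1 / M) * (conv \<nu> (tv_measure r) A - tv_measure r A))"
      unfolding \<sigma>_def conv_scale_right[OF \<nu>c tc] by (simp add: algebra_simps)
    then have "defect \<nu> \<sigma> = 1 / M * defect \<nu> (tv_measure r)"
      unfolding defect_def using MK_norm_scale[of "\<lambda>A. conv \<nu> (tv_measure r) A - tv_measure r A" "of_real (1 / M)"]
        \<nu>c tc M by (simp add: norm_divide)
    also have "\<dots> \<le> defect \<nu> (tv_measure r)"
    proof -
      have "0 \<le> defect \<nu> (tv_measure r)" unfolding defect_def using \<nu>c tc by (intro MK_norm_nonneg) simp
      then show ?thesis using M by (simp add: divide_le_eq mult_left_mono[of 1 M, simplified] mult_le_cancel_left1)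
    qed
    also have "\<dots> \<le> 2 * defect \<nu> r"
      unfolding defect_def by (rule tv_measure_almost_invariant[OF \<nu>P r])
    also have "defect \<nu> r \<le> defect \<nu> n"
    proof -
      have "(\<lambda>A. conv \<nu> r A - r A) = re_part (\<lambda>A. conv \<nu> n A - n A)"
        unfolding r_def conv_re_part[OF PK_D(1)[OF \<nu>P] n(1)] by (simp add: re_part_def)
      then show ?thesis
        unfolding defect_def using re_part_norm_le[of "\<lambda>A. conv \<nu> n A - n A"] \<nu>c n(1) by simp
    qed
    finally show ?thesis using dn[OF \<nu>] by simp
  qed
  then show "\<exists>\<sigma>\<in>PK. \<forall>\<nu>\<in>F. defect \<nu> \<sigma> < e" using \<sigma> by blast
qed

end

section \<open>Limits of almost invariant probability measures\<close>

text \<open>The point \<open>x\<^sub>0\<close> witnesses that \<open>l\<close> belongs to the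
  topological space at all, since the sub-basis is indexed by points of the carrier.\<close>

lemma limitin_weak_star:
  assumes V: "x\<^sub>0 \<in> carr V" and l: "l \<in> carr (dual V)"
    and lim: "\<And>x. x \<in> carr V \<Longrightarrow> ((\<lambda>i. g i x) \<longlongrightarrow> l x) F"
    and g: "eventually (\<lambda>i. g i \<in> carr (dual V)) F"
  shows "limitin (weak_star_topology V) g l F"
  unfolding limitin_def
proof (intro conjI allI impI)
  have "l \<in> {\<phi> \<in> carr (dual V). \<phi> x\<^sub>0 \<in> UNIV}" using l by simp
  then show "l \<in> topspace (weak_star_topology V)"
    unfolding weak_star_topology_def topology_generated_by_topspace using V by blast
  fix U assume "openin (weak_star_topology V) U \<and> l \<in> U"
  then have "generate_topology_on {{\<phi> \<in> carr (dual V). \<phi> x \<in> U} | x U. x \<in> carr V \<and> open U} U" "l \<in> U"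
    by (simp_all add: weak_star_topology_def openin_topology_generated_by_iff)
  then show "eventually (\<lambda>i. g i \<in> U) F"
  proof (induction)
    case Empty
    then show ?case by simp
  next
    case (Int a b)
    then show ?case by (auto intro: eventually_conj)
  next
    case (UN K)
    then obtain k where k: "k \<in> K" "l \<in> k" by blast
    show ?case by (rule eventually_mono[OF UN.IH[OF k]]) (use k in blast)
  next
    case (Basis s)
    then obtain x W where s: "s = {\<phi> \<in> carr (dual V). \<phi> x \<in> W}" "x \<in> carr V" "open W" by blast
    then have "eventually (\<lambda>i. g i x \<in> W) F"
      using Basis.prems by (intro topological_tendstoD[OF lim[OF s(2)]]) auto
    then show ?case using g by eventually_elim (simp add: s(1))
  qed
qed

lemma weak_star_limitD:
  assumes lim: "limitin (weak_star_topology V) g l F" and x: "x \<in> carr V"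
  shows "((\<lambda>i. g i x) \<longlongrightarrow> l x) F"
proof (rule topological_tendstoI)
  fix W :: "complex set" assume W: "open W" "l x \<in> W"
  have "l \<in> topspace (weak_star_topology V)" using lim by (simp add: limitin_def)
  then have "l \<in> carr (dual V)"
    unfolding weak_star_topology_def topology_generated_by_topspace by blast
  moreover have "openin (weak_star_topology V) {\<phi> \<in> carr (dual V). \<phi> x \<in> W}"
    unfolding weak_star_topology_def openin_topology_generated_by_iff
    using x W(1) by (intro generate_topology_on.Basis) blast
  ultimately have "eventually (\<lambda>i. g i \<in> {\<phi> \<in> carr (dual V). \<phi> x \<in> W}) F"
    using lim W(2) unfolding limitin_def by blast
  then show "eventually (\<lambda>i. g i x \<in> W) F" by (rule eventually_mono) simp
qed

context semihypergroup
begin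

text \<open>Condition (2) for the filter of tails of the net, in a form that survives passing to a
  finer proper filter.\<close>

definition almost_invariant_filter :: "'a cmeas filter \<Rightarrow> bool" where
  "almost_invariant_filter F \<longleftrightarrow> F \<noteq> bot \<and> eventually (\<lambda>\<sigma>. \<sigma> \<in> PK) F \<and>
     (\<forall>\<nu>\<in>PK. (defect \<nu> \<longlongrightarrow> 0) F)"

lemma defect_nonneg: "\<nu> \<in> carr MK \<Longrightarrow> \<sigma> \<in> carr MK \<Longrightarrow> 0 \<le> defect \<nu> \<sigma>"
  unfolding defect_def by (intro MK_norm_nonneg) simp

text \<open>The sets of probability measures with small defects at finitely many measures form a
  filter base; almost invariance says that none of them is empty.\<close>

lemma almost_invariant_filter_exists:
  assumes "almost_invariance"
  shows "\<exists>F. almost_invariant_filter F"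
proof -
  define B where "B = {(G :: 'a cmeas set, e :: real). finite G \<and> G \<subseteq> PK \<and> e > 0}"
  define S where "S = (\<lambda>(G, e). {\<sigma>\<in>PK. \<forall>\<nu>\<in>G. defect \<nu> \<sigma> < e})"
  define F where "F = (INF b\<in>B. principal (S b))"
  have ev: "eventually P F \<longleftrightarrow> (\<exists>b\<in>B. \<forall>\<sigma>\<in>S b. P \<sigma>)" for P
    unfolding F_def eventually_principal[symmetric]
  proof (rule eventually_INF_base)
    have "({}, 1) \<in> B" by (simp add: B_def)
    then show "B \<noteq> {}" by blast
    fix a b assume "a \<in> B" "b \<in> B"
    then have "(fst a \<union> fst b, min (snd a) (snd b)) \<in> B" by (auto simp: B_def)
    moreover have "S (fst a \<union> fst b, min (snd a) (snd b)) \<subseteq> S a \<inter> S b"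
      by (auto simp: S_def split_def)
    ultimately show "\<exists>x\<in>B. principal (S x) \<le> inf (principal (S a)) (principal (S b))"
      by (metis inf_principal principal_le_iff)
  qed
  have "S b \<noteq> {}" if "b \<in> B" for b
    using assms that unfolding almost_invariance_def B_def S_def by fastforce
  then have "F \<noteq> bot"
    unfolding trivial_limit_def ev by blast
  moreover have "eventually (\<lambda>\<sigma>. \<sigma> \<in> PK) F"
    unfolding ev by (rule bexI[of _ "({}, 1)"]) (auto simp: S_def B_def)
  moreover have "(defect \<nu> \<longlongrightarrow> 0) F" if \<nu>: "\<nu> \<in> PK" for \<nu>
  proof (rule tendstoI)
    fix e :: real assume "e > 0"
    then have "({\<nu>}, e) \<in> B" using \<nu> by (simp add: B_def)
    moreover have "dist (defect \<nu> \<sigma>) 0 < e" if "\<sigma> \<in> S ({\<nu>}, e)" for \<sigma>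
      using that defect_nonneg[OF PK_D(2)[OF \<nu>] PK_D(2)] by (auto simp: S_def)
    ultimately show "eventually (\<lambda>\<sigma>. dist (defect \<nu> \<sigma>) 0 < e) F"
      unfolding ev by blast
  qed
  ultimately show ?thesis by (auto simp: almost_invariant_filter_def)
qed

text \<open>By Tychonoff's theorem the evaluation functionals at the points of the filter have a
  cluster point; refining the filter makes them converge.\<close>

lemma almost_invariant_filter_refine:
  assumes F: "almost_invariant_filter F"
  shows "\<exists>G m. almost_invariant_filter G \<and> (\<forall>\<phi>\<in>carr (dual MK). ((\<lambda>\<sigma>. \<phi> \<sigma>) \<longlongrightarrow> m \<phi>) G) \<and>
    (\<forall>\<phi>. \<phi> \<notin> carr (dual MK) \<longrightarrow> m \<phi> = 0)"
proof -
  \<comment> \<open>Evaluations are set to 0 off the dual space, so that they are points of a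
    product over the whole function type.\<close>
  define J where "J \<sigma> = (\<lambda>\<phi> :: 'a cmeas \<Rightarrow> complex. if \<phi> \<in> carr (dual MK) then \<phi> \<sigma> else 0)" for \<sigma>
  \<comment> \<open>Probability measures have norm 1, which confines the value at \<phi> to a disc
    whose radius is the norm of \<phi>.\<close>
  let ?K = "(\<Pi>\<^sub>E \<phi> :: 'a cmeas \<Rightarrow> complex \<in> UNIV.
      if \<phi> \<in> carr (dual MK) then cball 0 (vnorm (dual MK) \<phi>) else {0 :: complex})"
  have "compactin (product_topology (\<lambda>_. euclidean) UNIV) ?K"
    unfolding compactin_PiE by auto
  then have comp: "compact ?K" by (simp add: euclidean_product_topology)
  have "eventually (\<lambda>\<sigma>. J \<sigma> \<in> ?K) F"
  proof (rule eventually_mono)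
    show "eventually (\<lambda>\<sigma>. \<sigma> \<in> PK) F" using F by (simp add: almost_invariant_filter_def)
    show "J \<sigma> \<in> ?K" if "\<sigma> \<in> PK" for \<sigma>
      using that dual_MK_bound[OF _ PK_D(2)[OF that]] by (auto simp: J_def)
  qed
  then have "eventually (\<lambda>y. y \<in> ?K) (filtermap J F)" by (simp add: eventually_filtermap)
  moreover have "filtermap J F \<noteq> bot"
    using F by (simp add: almost_invariant_filter_def filtermap_bot_iff)
  ultimately obtain m where m: "m \<in> ?K" "inf (nhds m) (filtermap J F) \<noteq> bot"
    using comp unfolding compact_filter by blast
  \<comment> \<open>The coarsest refinement of \<open>F\<close> along which \<open>J\<close> tends
    to \<open>m\<close>; it is proper exactly because \<open>m\<close> is a cluster point.\<close>
  define G where "G = inf F (filtercomap J (nhds m))"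
  have "G \<noteq> bot"
  proof
    assume "G = bot"
    then have "eventually (\<lambda>_. False) (inf F (filtercomap J (nhds m)))" by (simp add: G_def)
    then obtain P Q where PQ: "eventually P F" "eventually Q (nhds m)" "\<And>\<sigma>. P \<sigma> \<Longrightarrow> Q (J \<sigma>) \<Longrightarrow> False"
      unfolding eventually_inf eventually_filtercomap by blast
    have "eventually (\<lambda>y. \<not> Q y) (filtermap J F)"
      unfolding eventually_filtermap using PQ(1) by (rule eventually_mono) (use PQ(3) in blast)
    with PQ(2) have "eventually (\<lambda>_. False) (inf (nhds m) (filtermap J F))"
      unfolding eventually_inf by blast
    then show False using m(2) by (simp add: trivial_limit_def)
  qed
  moreover have GF: "G \<le> F" by (simp add: G_def)
  ultimately have "almost_invariant_filter G"
    using F filter_leD[OF GF] tendsto_mono[OF GF] by (auto simp: almost_invariant_filter_def)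
  moreover have "((\<lambda>\<sigma>. \<phi> \<sigma>) \<longlongrightarrow> m \<phi>) G" if \<phi>: "\<phi> \<in> carr (dual MK)" for \<phi>
  proof -
    have J: "filterlim J (nhds m) G" by (simp add: filterlim_iff_le_filtercomap G_def)
    have "((\<lambda>\<sigma>. J \<sigma> \<phi>) \<longlongrightarrow> m \<phi>) G"
    proof (rule topological_tendstoI)
      fix W :: "complex set" assume W: "open W" "m \<phi> \<in> W"
      have "open ((\<lambda>y :: ('a cmeas \<Rightarrow> complex) \<Rightarrow> complex. y \<phi>) -` W)"
        using W(1) by (intro open_vimage continuous_on_product_coordinates)
      from topological_tendstoD[OF J this] W(2) show "eventually (\<lambda>\<sigma>. J \<sigma> \<phi> \<in> W) G" by simp
    qed
    then show ?thesis using \<phi> by (simp add: J_def)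
  qed
  moreover have "m \<phi> = 0" if "\<phi> \<notin> carr (dual MK)" for \<phi>
    using PiE_mem[OF m(1), of \<phi>] that by simp
  ultimately show ?thesis by blast
qed

text \<open>Linearity, positivity and the bound 1 are closed conditions that hold along the filter.
  The norm is exactly 1 because the value at \<open>one_functional\<close>, itself of norm at most
  1, equals 1.\<close>

lemma limit_is_TLIM:
  assumes F: "almost_invariant_filter F"
    and lim: "\<And>\<phi>. \<phi> \<in> carr (dual MK) \<Longrightarrow> ((\<lambda>\<sigma>. \<phi> \<sigma>) \<longlongrightarrow> m \<phi>) F"
    and off: "\<And>\<phi>. \<phi> \<notin> carr (dual MK) \<Longrightarrow> m \<phi> = 0"
  shows "TLIM conv m" "invariant_form m"
proof -
  have nb: "F \<noteq> bot" and P: "eventually (\<lambda>\<sigma>. \<sigma> \<in> PK) F" and d: "\<And>\<nu>. \<nu> \<in> PK \<Longrightarrow> (defect \<nu> \<longlongrightarrow> 0) F"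
    using F by (auto simp: almost_invariant_filter_def)
  have nD: "complex_normed_space (dual (MK :: 'a cmeas cnspace))"
    by (rule complex_normed_dual[OF complex_normed_MK])
  have lin: "linear_form m"
    unfolding linear_form_def
  proof (intro conjI ballI allI)
    show "m (\<lambda>x. \<phi> x + \<psi> x) = m \<phi> + m \<psi>" if "\<phi> \<in> carr (dual MK)" "\<psi> \<in> carr (dual MK)" for \<phi> \<psi>
      using tendsto_unique[OF nb lim[OF dual_closed(1)[OF that]] tendsto_add[OF lim[OF that(1)] lim[OF that(2)]]] .
    show "m (\<lambda>x. c * \<phi> x) = c * m \<phi>" if "\<phi> \<in> carr (dual MK)" for c \<phi>
      using tendsto_unique[OF nb lim[OF dual_closed(2)[OF that]] tendsto_mult[OF tendsto_const lim[OF that]]] .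
  qed
  have "eventually (\<lambda>\<sigma>. one_functional \<sigma> = 1) F"
    using P by (rule eventually_mono) (simp add: one_functional_def PK_D)
  then have one: "m one_functional = 1"
    by (intro tendsto_unique[OF nb lim[OF one_dual] tendsto_eventually])
  have bound: "cmod (m \<phi>) \<le> 1 * vnorm (dual MK) \<phi>" if \<phi>: "\<phi> \<in> carr (dual MK)" for \<phi>
  proof (rule tendsto_upperbound[OF tendsto_norm[OF lim[OF \<phi>]] _ nb])
    show "eventually (\<lambda>\<sigma>. cmod (\<phi> \<sigma>) \<le> 1 * vnorm (dual MK) \<phi>) F"
      using P by (rule eventually_mono) (use dual_MK_bound[OF \<phi> PK_D(2)] in simp)
  qed
  have inv: "m (left_translate conv \<nu> \<phi>) = m \<phi>" if \<nu>: "\<nu> \<in> PK" and \<phi>: "\<phi> \<in> carr (dual MK)" for \<nu> \<phi>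
  proof -
    have L: "left_translate conv \<nu> \<phi> \<in> carr (dual MK)" using PK_D(2)[OF \<nu>] \<phi> by simp
    \<comment> \<open>Evaluations of \<phi> at \<open>conv \<nu> \<sigma>\<close> and at \<sigma>
      differ by at most the norm of \<phi> times the defect.\<close>
    have "((\<lambda>\<sigma>. vnorm (dual MK) \<phi> * defect \<nu> \<sigma>) \<longlongrightarrow> 0) F"
      using tendsto_mult[OF tendsto_const d[OF \<nu>]] by simp
    then have "((\<lambda>\<sigma>. left_translate conv \<nu> \<phi> \<sigma> - \<phi> \<sigma>) \<longlongrightarrow> 0) F"
    proof (rule Lim_null_comparison[rotated])
      show "eventually (\<lambda>\<sigma>. norm (left_translate conv \<nu> \<phi> \<sigma> - \<phi> \<sigma>) \<le> vnorm (dual MK) \<phi> * defect \<nu> \<sigma>) F"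
        using P
      proof (rule eventually_mono)
        fix \<sigma> :: "'a cmeas" assume "\<sigma> \<in> PK"
        then have \<sigma>: "\<sigma> \<in> carr MK" by (rule PK_D)
        then show "norm (left_translate conv \<nu> \<phi> \<sigma> - \<phi> \<sigma>) \<le> vnorm (dual MK) \<phi> * defect \<nu> \<sigma>"
          using dual_MK_bound[OF \<phi>, of "\<lambda>A. conv \<nu> \<sigma> A - \<sigma> A"] PK_D(2)[OF \<nu>]
          by (simp add: left_translate_def defect_def dual_MK_linear(3)[OF \<phi>])
      qed
    qed
    then have "m (left_translate conv \<nu> \<phi>) - m \<phi> = 0"
      using tendsto_unique[OF nb tendsto_diff[OF lim[OF L] lim[OF \<phi>]]] by blast
    then show ?thesis by simp
  qed
  show "invariant_form m" using lin one inv by (simp add: invariant_form_def)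
  have mDD: "m \<in> carr (dual (dual MK))"
    by (rule dualI[of _ _ 1]) (use lin bound off in \<open>auto simp: linear_form_def\<close>)
  have "vnorm (dual (dual MK)) m \<le> 1"
    by (rule dual_norm_le[OF nD]) (use bound in auto)
  moreover have "vnorm (dual MK) (one_functional :: 'a cmeas \<Rightarrow> complex) \<le> 1"
    by (rule dual_norm_le[OF complex_normed_MK]) (auto simp: one_functional_def MK_norm_ge)
  then have "1 \<le> vnorm (dual (dual MK)) m"
    using dual_norm_upper[OF nD mDD one_dual] one by simp
  moreover have "m \<phi> \<in> \<real>\<^sub>\<ge>\<^sub>0" if \<phi>: "\<phi> \<in> carr (dual MK)" and pos: "\<forall>\<nu>\<in>MK_pos. \<phi> \<nu> \<in> \<real>\<^sub>\<ge>\<^sub>0" for \<phi>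
  proof (rule Lim_in_closed_set[OF closed_nonneg_Reals_complex _ nb lim[OF \<phi>]])
    show "eventually (\<lambda>\<sigma>. \<phi> \<sigma> \<in> \<real>\<^sub>\<ge>\<^sub>0) F"
      using P by (rule eventually_mono) (use pos PK_D(1) in blast)
  qed
  ultimately show "TLIM conv m"
    using mDD inv by (simp add: TLIM_def is_mean_def)
qed

text \<open>A large multiple of \<open>one_functional\<close> dominates any functional that is real
  on the cone. If the mean vanished at \<open>one_functional\<close>, positivity would make it
  vanish at those functionals, hence at all their complex combinations, against norm 1. A nonzero
  value is enough to normalise the mean by division.\<close>

lemma mean_one_nonzero:
  fixes m :: "('a cmeas \<Rightarrow> complex) \<Rightarrow> complex"
  assumes m: "is_mean m"
  shows "m one_functional \<noteq> 0"
proof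
  assume 0: "m one_functional = 0"
  have mD: "m \<in> carr (dual (dual MK))" and m1: "vnorm (dual (dual MK)) m = 1"
    and pos: "\<And>\<phi>. \<phi> \<in> carr (dual MK) \<Longrightarrow> (\<And>\<nu>. \<nu> \<in> MK_pos \<Longrightarrow> \<phi> \<nu> \<in> \<real>\<^sub>\<ge>\<^sub>0) \<Longrightarrow> m \<phi> \<in> \<real>\<^sub>\<ge>\<^sub>0"
    using m by (auto simp: is_mean_def)
  have add: "m (\<lambda>x. \<phi> x + \<psi> x) = m \<phi> + m \<psi>" if "\<phi> \<in> carr (dual MK)" "\<psi> \<in> carr (dual MK)" for \<phi> \<psi>
    using dualD(1)[OF mD that] by simp
  have scale: "m (\<lambda>x. c * \<phi> x) = c * m \<phi>" if "\<phi> \<in> carr (dual MK)" for \<phi> c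
    using dualD(2)[OF mD that] by simp
  have sa: "m \<theta> = 0" if \<theta>: "\<theta> \<in> carr (dual MK)" and real: "\<And>\<nu>. \<nu> \<in> MK_pos \<Longrightarrow> Im (\<theta> \<nu>) = 0" for \<theta>
  proof -
    \<comment> \<open>On the cone \<theta> is bounded by \<open>C\<close> times the mass, so
      \<open>C\<close> times \<open>one_functional\<close> plus or minus \<theta> is
      positive.\<close>
    define C where "C = vnorm (dual MK) \<theta>"
    have C1: "(\<lambda>x :: 'a cmeas. of_real C * one_functional x) \<in> carr (dual MK)" by (rule dual_closed(2)[OF one_dual])
    have *: "of_real s * m \<theta> \<in> \<real>\<^sub>\<ge>\<^sub>0" if s: "s = 1 \<or> s = - 1" for s :: real
    proof -
      have s\<theta>: "(\<lambda>x. of_real s * \<theta> x) \<in> carr (dual MK)" by (rule dual_closed(2)[OF \<theta>])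
      have "m (\<lambda>x. of_real C * one_functional x + of_real s * \<theta> x) \<in> \<real>\<^sub>\<ge>\<^sub>0"
      proof (rule pos[OF dual_closed(1)[OF C1 s\<theta>]])
        fix \<nu> :: "'a cmeas" assume \<nu>: "\<nu> \<in> MK_pos"
        have "\<bar>Re (\<theta> \<nu>)\<bar> \<le> C * Re (\<nu> UNIV)"
          using dual_MK_bound[OF \<theta> MK_posD(1)[OF \<nu>]] abs_Re_le_cmod[of "\<theta> \<nu>"] tv_pos[OF \<nu>, of UNIV]
          by (simp add: C_def)
        then show "of_real C * one_functional \<nu> + of_real s * \<theta> \<nu> \<in> \<real>\<^sub>\<ge>\<^sub>0"
          using s real[OF \<nu>] MK_posD(1,3)[OF \<nu>]
          by (auto simp: complex_nonneg_Reals_iff one_functional_def)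
      qed
      then show ?thesis using add[OF C1 s\<theta>] scale[OF one_dual] scale[OF \<theta>] 0 by simp
    qed
    show ?thesis using *[of 1] *[of "- 1"] by (auto simp: complex_nonneg_Reals_iff complex_eq_iff)
  qed
  have cnj_MK: "(\<lambda>A. cnj (\<mu> A)) \<in> carr MK" "tv (\<lambda>A. cnj (\<mu> A)) UNIV \<le> tv \<mu> UNIV"
    if \<mu>: "\<mu> \<in> carr MK" for \<mu> :: "'a cmeas"
  proof -
    have le: "tv (\<lambda>A. cnj (\<mu> A)) E \<le> 1 * tv \<mu> E" if "E \<in> sets borel" for E
      using that by (intro tv_le_scaled MK_cm[OF \<mu>]) auto
    from le[of UNIV] show "tv (\<lambda>A. cnj (\<mu> A)) UNIV \<le> tv \<mu> UNIV" by simp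
    have "(\<lambda>A. cnj (\<mu> A)) \<in> complex_measures"
      using MK_cm[OF \<mu>] by (intro complex_measuresI) (auto simp: cm_outside sums_cnj intro!: cm_sums)
    then show "(\<lambda>A. cnj (\<mu> A)) \<in> carr MK" by (rule MK_dominated[OF \<mu> _ _ le]) simp_all
  qed
  have "m \<phi> = 0" if \<phi>: "\<phi> \<in> carr (dual MK)" for \<phi>
  proof -
    \<comment> \<open>The involution of the dual W*-algebra, described through conjugation of
      measures.\<close>
    define star where "star \<mu> = (if \<mu> \<in> carr MK then cnj (\<phi> (\<lambda>A. cnj (\<mu> A))) else 0)" for \<mu>
    have star: "star \<in> carr (dual MK)"
    proof (rule dualI)
      show "cmod (star \<mu>) \<le> vnorm (dual MK) \<phi> * vnorm MK \<mu>" if \<mu>: "\<mu> \<in> carr MK" for \<mu>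
        using dual_MK_bound[OF \<phi> cnj_MK(1)[OF \<mu>]]
          mult_left_mono[OF cnj_MK(2)[OF \<mu>] dual_norm_nonneg[OF complex_normed_MK \<phi>]] \<mu>
        by (simp add: star_def)
    qed (auto simp: star_def cnj_MK dual_MK_linear[OF \<phi>])
    have star_pos: "star \<nu> = cnj (\<phi> \<nu>)" if \<nu>: "\<nu> \<in> MK_pos" for \<nu>
    proof -
      have "(\<lambda>A. cnj (\<nu> A)) = \<nu>" using MK_posD(3)[OF \<nu>] by (simp add: fun_eq_iff complex_eq_iff)
      then show ?thesis using MK_posD(1)[OF \<nu>] by (simp add: star_def)
    qed
    have r: "m (\<lambda>x. \<phi> x + star x) = 0"
      using \<phi> star by (intro sa dual_closed) (simp_all add: star_pos)
    have i: "m (\<lambda>x. \<i> * (\<phi> x - star x)) = 0"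
      using \<phi> star by (intro sa dual_closed) (simp_all add: star_pos)
    \<comment> \<open>Twice \<phi> as a combination of two functionals that are real on the
      cone.\<close>
    have "m (\<lambda>x. (\<phi> x + star x) + - \<i> * (\<i> * (\<phi> x - star x))) = 0"
      using \<phi> star add[OF dual_closed(1)[OF \<phi> star] dual_closed(2)[OF dual_closed(2)[OF dual_closed(3)[OF \<phi> star]]], of "- \<i>" \<i>]
        scale[OF dual_closed(2)[OF dual_closed(3)[OF \<phi> star]], of "- \<i>" \<i>] r i by simp
    moreover have "(\<lambda>x. (\<phi> x + star x) + - \<i> * (\<i> * (\<phi> x - star x))) = (\<lambda>x. 2 * \<phi> x)"
      by (auto simp: algebra_simps)
    ultimately show ?thesis using scale[OF \<phi>, of 2] by simp
  qed
  then have "vnorm (dual (dual MK)) m \<le> 0"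
    by (intro dual_norm_le[OF complex_normed_dual[OF complex_normed_MK]]) auto
  then show False using m1 by simp
qed

lemma TLIM_imp_invariant_form:
  assumes m: "TLIM conv m"
  shows "\<exists>m. invariant_form m"
proof -
  have ne: "m one_functional \<noteq> 0" using m mean_one_nonzero by (simp add: TLIM_def)
  have mD: "m \<in> carr (dual (dual MK))" using m by (simp add: TLIM_def is_mean_def)
  have "linear_form m"
    unfolding linear_form_def using dualD(1)[OF mD] dualD(2)[OF mD] by simp
  then have "invariant_form (\<lambda>\<phi>. m \<phi> / m one_functional)"
    using m ne by (simp add: invariant_form_def linear_form_def TLIM_def add_divide_distrib)
  then show ?thesis by blast
qed

end

section \<open>Norm infima and stationarity\<close>

lemma tails_not_bot:
  assumes "directed_set I le"
  shows "tails I le \<noteq> bot"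
proof -
  have "\<forall>i\<in>I. le i i" using assms by (simp add: directed_set_def)
  then have "\<not> eventually (\<lambda>_. False) (tails I le)"
    unfolding eventually_tails[OF assms] by blast
  then show ?thesis by (simp add: trivial_limit_def)
qed

lemma eventually_tails_in:
  assumes "directed_set I le" "\<forall>i\<in>I. n i \<in> S"
  shows "eventually (\<lambda>i. n i \<in> S) (tails I le)"
proof -
  have "I \<noteq> {}" using assms(1) by (simp add: directed_set_def)
  then show ?thesis unfolding eventually_tails[OF assms(1)] using assms(2) by blast
qed

lemma MK_pos_normalise:
  fixes p :: "'a::t2_space cmeas"
  assumes p: "p \<in> MK_pos"
  obtains \<nu> where "\<nu> \<in> PK" "\<And>A. p A = p UNIV * \<nu> A"
proof (cases "p UNIV = 0")
  case True
  then have "tv p UNIV = 0" using tv_pos[OF p, of UNIV] by simp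
  then have "p A = 0" for A using MK_norm_ge[OF MK_posD(1)[OF p], of A] by simp
  \<comment> \<open>A measure of mass zero in the cone vanishes, so any probability measure will
    do.\<close>
  then show ?thesis using that[OF dirac_PK] by simp
next
  case False
  define r where "r = Re (p UNIV)"
  have r: "p UNIV = of_real r" using MK_posD(4)[OF p, of UNIV] by (simp add: r_def)
  have "r \<noteq> 0" using False unfolding r by simp
  moreover have "r \<ge> 0" unfolding r_def by (rule MK_posD(2)[OF p])
  ultimately have "r > 0" by simp
  then have "(\<lambda>A. of_real (1 / r) * p A) \<in> PK"
    using MK_pos_scale[OF p, of "1 / r"] r by (simp add: PK_def)
  moreover have "p A = p UNIV * (of_real (1 / r) * p A)" for A
    unfolding r using \<open>r > 0\<close> by simp
  ultimately show ?thesis by (rule that)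
qed

context semihypergroup
begin

lemma defect_eq: "vnorm MK (vdiff MK (conv \<nu> \<sigma>) \<sigma>) = defect \<nu> \<sigma>"
  by (simp add: defect_def)

text \<open>The translate is linear in the measure, and a complex measure is a combination of four
  probability measures whose coefficients add up to its mass.\<close>

lemma invariant_form_translate:
  assumes m: "invariant_form m" and \<mu>: "\<mu> \<in> carr MK" and \<phi>: "\<phi> \<in> carr (dual MK)"
  shows "m (left_translate conv \<mu> \<phi>) = \<mu> UNIV * m \<phi>"
proof -
  have scale: "m (\<lambda>x. c * \<psi> x) = c * m \<psi>" if "\<psi> \<in> carr (dual MK)" for c \<psi>
    using m that by (simp add: invariant_form_def linear_form_def)
  have pos: "m (left_translate conv p \<phi>) = p UNIV * m \<phi>" if p: "p \<in> MK_pos" for p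
  proof -
    obtain \<nu> where \<nu>: "\<nu> \<in> PK" "\<And>A. p A = p UNIV * \<nu> A" by (rule MK_pos_normalise[OF p]) (rule that)
    note \<nu>c = PK_D(2)[OF \<nu>(1)]
    have p_eq: "p = (\<lambda>A. p UNIV * \<nu> A)" by (rule ext) (rule \<nu>(2))
    have "left_translate conv p \<phi> = (\<lambda>x. p UNIV * left_translate conv \<nu> \<phi> x)"
      by (subst p_eq) (auto simp: left_translate_def conv_scale_left \<nu>c dual_MK_linear(2)[OF \<phi>])
    then show ?thesis using scale[OF left_translate_dual[OF \<nu>c \<phi>]] m \<nu>(1) \<phi> by (simp add: invariant_form_def)
  qed
  obtain p :: "nat \<Rightarrow> 'a cmeas" where p: "\<And>k. p k \<in> MK_pos" "\<mu> = (\<lambda>A. \<Sum>k<4. \<i> ^ k * p k A)"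
    by (rule jordan_complex[OF \<mu>]) (rule that)
  have sum: "\<phi> (\<lambda>A. \<Sum>k<n. \<i> ^ k * f k A) = (\<Sum>k<n. \<i> ^ k * \<phi> (f k))"
    if "\<And>k. f k \<in> carr MK" for n :: nat and f :: "nat \<Rightarrow> 'a cmeas"
  proof (induction n)
    case 0
    then show ?case using dual_at_zero[OF complex_normed_MK \<phi>] by simp
  next
    case (Suc n)
    then show ?case using that by (simp add: dual_MK_linear[OF \<phi>])
  qed
  have "left_translate conv \<mu> \<phi> = (\<lambda>x. \<Sum>k<4. \<i> ^ k * left_translate conv (p k) \<phi> x)"
    unfolding p(2) using MK_posD(1)[OF p(1)] by (auto simp: left_translate_def conv_sum_left sum)
  then have "m (left_translate conv \<mu> \<phi>) = (\<Sum>k<4. m (\<lambda>x. \<i> ^ k * left_translate conv (p k) \<phi> x))"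
    using m linear_form_sum[of m "{..<4::nat}" "\<lambda>k x. \<i> ^ k * left_translate conv (p k) \<phi> x"]
      dual_closed(2)[OF left_translate_dual[OF MK_posD(1)[OF p(1)] \<phi>]]
    by (simp add: invariant_form_def)
  also have "\<dots> = (\<Sum>k<4. \<i> ^ k * (p k UNIV * m \<phi>))"
    using scale[OF left_translate_dual[OF MK_posD(1)[OF p(1)] \<phi>]] pos[OF p(1)] by simp
  also have "\<dots> = \<mu> UNIV * m \<phi>" by (simp add: p(2) sum_distrib_right mult.assoc)
  finally show ?thesis .
qed

text \<open>Extends the vanishing of defects from probability measures to all of M(K), with the mass
  as multiplier; the error is at most a fixed combination of four defects.\<close>

lemma almost_invariant_filter_measure:
  assumes F: "almost_invariant_filter F" and \<mu>: "\<mu> \<in> carr MK"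
  shows "((\<lambda>\<sigma>. tv (\<lambda>A. conv \<mu> \<sigma> A - \<mu> UNIV * \<sigma> A) UNIV) \<longlongrightarrow> 0) F"
proof -
  have P: "eventually (\<lambda>\<sigma>. \<sigma> \<in> PK) F" and d: "\<And>\<nu>. \<nu> \<in> PK \<Longrightarrow> (defect \<nu> \<longlongrightarrow> 0) F"
    using F by (auto simp: almost_invariant_filter_def)
  obtain p :: "nat \<Rightarrow> 'a cmeas" where p: "\<And>k. p k \<in> MK_pos" "\<mu> = (\<lambda>A. \<Sum>k<4. \<i> ^ k * p k A)"
    by (rule jordan_complex[OF \<mu>]) (rule that)
  have "\<exists>\<nu>. \<nu> \<in> PK \<and> (\<forall>A. p k A = p k UNIV * \<nu> A)" for k
    using MK_pos_normalise[OF p(1)] by blast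
  then obtain \<nu> where \<nu>: "\<And>k. \<nu> k \<in> PK" "\<And>k A. p k A = p k UNIV * \<nu> k A" by metis
  \<comment> \<open>The phases and the masses of the parts are merged into the coefficients, whose
    sum is \<open>\<mu> UNIV\<close>.\<close>
  define c where "c k = \<i> ^ k * p k UNIV" for k
  have \<mu>eq: "\<mu> = (\<lambda>A. \<Sum>k<4. c k * \<nu> k A)"
  proof -
    have "\<i> ^ k * p k A = c k * \<nu> k A" for k A
      unfolding c_def mult.assoc using \<nu>(2)[of k A] by (rule arg_cong)
    then show ?thesis unfolding p(2) by simp
  qed
  have "((\<lambda>\<sigma>. \<Sum>k<4. cmod (c k) * defect (\<nu> k) \<sigma>) \<longlongrightarrow> (\<Sum>k<4. cmod (c k) * 0)) F"
    by (intro tendsto_sum tendsto_mult tendsto_const d \<nu>(1))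
  then have lim: "((\<lambda>\<sigma>. \<Sum>k<4. cmod (c k) * defect (\<nu> k) \<sigma>) \<longlongrightarrow> 0) F" by simp
  show ?thesis
  proof (rule Lim_null_comparison[OF _ lim])
    show "eventually (\<lambda>\<sigma>. norm (tv (\<lambda>A. conv \<mu> \<sigma> A - \<mu> UNIV * \<sigma> A) UNIV)
        \<le> (\<Sum>k<4. cmod (c k) * defect (\<nu> k) \<sigma>)) F"
      using P
    proof (rule eventually_mono)
      fix \<sigma> :: "'a cmeas" assume "\<sigma> \<in> PK"
      then have \<sigma>: "\<sigma> \<in> carr MK" by (rule PK_D)
      note \<nu>c = PK_D(2)[OF \<nu>(1)]
      have diff: "(\<lambda>A. conv (\<nu> k) \<sigma> A - \<sigma> A) \<in> carr MK" for k using \<nu>c \<sigma> by simp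
      have "conv \<mu> \<sigma> = (\<lambda>A. \<Sum>k<4. c k * conv (\<nu> k) \<sigma> A)"
        unfolding \<mu>eq by (rule conv_sum_left[OF \<sigma> \<nu>c])
      moreover have "\<mu> UNIV = (\<Sum>k<4. c k)" using PK_D(3)[OF \<nu>(1)] by (simp add: \<mu>eq)
      ultimately have "(\<lambda>A. conv \<mu> \<sigma> A - \<mu> UNIV * \<sigma> A) = (\<lambda>A. \<Sum>k<4. c k * (conv (\<nu> k) \<sigma> A - \<sigma> A))"
        by (simp add: sum_distrib_right right_diff_distrib sum_subtractf)
      moreover have "tv (\<lambda>A. \<Sum>k<4. c k * (conv (\<nu> k) \<sigma> A - \<sigma> A)) UNIV
          \<le> (\<Sum>k<4. tv (\<lambda>A. c k * (conv (\<nu> k) \<sigma> A - \<sigma> A)) UNIV)"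
        by (intro MK_norm_sum MK_scale[OF diff])
      moreover have "(\<lambda>A. conv \<mu> \<sigma> A - \<mu> UNIV * \<sigma> A) \<in> carr MK"
        using \<mu> \<sigma> by simp
      ultimately show "norm (tv (\<lambda>A. conv \<mu> \<sigma> A - \<mu> UNIV * \<sigma> A) UNIV)
          \<le> (\<Sum>k<4. cmod (c k) * defect (\<nu> k) \<sigma>)"
        using MK_norm_nonneg[of "\<lambda>A. conv \<mu> \<sigma> A - \<mu> UNIV * \<sigma> A"]
        by (simp add: MK_norm_scale[OF diff] defect_def)
    qed
  qed
qed

lemma norm_infimum_bdd: "\<mu> \<in> carr MK \<Longrightarrow> bdd_below ((\<lambda>\<nu>. tv (conv \<mu> \<nu>) UNIV) ` PK)"
  by (rule bdd_belowI2[of _ 0]) (simp add: MK_norm_nonneg PK_D(2))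

text \<open>The modulus of the mass never exceeds the norm, and convolving with a probability
  measure keeps the mass. Conversely \<open>conv \<mu> \<sigma>\<close> is close to
  \<open>\<mu> UNIV\<close> times \<sigma>, whose norm is the modulus of the mass.\<close>

lemma mass_eq_norm_infimum:
  assumes F: "almost_invariant_filter F" and \<mu>: "\<mu> \<in> carr MK"
  shows "cmod (\<mu> UNIV) = (INF \<nu>\<in>PK. tv (conv \<mu> \<nu>) UNIV)"
proof (rule antisym)
  have ne: "PK \<noteq> ({} :: 'a cmeas set)" using dirac_PK by blast
  have "cmod (\<mu> UNIV) \<le> tv (conv \<mu> \<nu>) UNIV" if "\<nu> \<in> PK" for \<nu>
    using MK_norm_ge[OF conv_closed[OF \<mu> PK_D(2)[OF that]], of UNIV] conv_mass[OF \<mu> PK_D(2)[OF that]] PK_D(3)[OF that]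
    by simp
  then show "cmod (\<mu> UNIV) \<le> (INF \<nu>\<in>PK. tv (conv \<mu> \<nu>) UNIV)"
    by (intro cINF_greatest ne)
  show "(INF \<nu>\<in>PK. tv (conv \<mu> \<nu>) UNIV) \<le> cmod (\<mu> UNIV)"
  proof (rule field_le_epsilon)
    fix e :: real assume "e > 0"
    have "eventually (\<lambda>\<sigma>. tv (\<lambda>A. conv \<mu> \<sigma> A - \<mu> UNIV * \<sigma> A) UNIV < e \<and> \<sigma> \<in> PK) F"
      using order_tendstoD(2)[OF almost_invariant_filter_measure[OF F \<mu>] \<open>e > 0\<close>] F
      by (auto simp: almost_invariant_filter_def intro: eventually_conj)
    then obtain \<sigma> where \<sigma>: "\<sigma> \<in> PK" "tv (\<lambda>A. conv \<mu> \<sigma> A - \<mu> UNIV * \<sigma> A) UNIV < e"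
      using F eventually_happens' unfolding almost_invariant_filter_def by blast
    note \<sigma>c = PK_D(2)[OF \<sigma>(1)]
    have "tv (conv \<mu> \<sigma>) UNIV
        \<le> tv (\<lambda>A. conv \<mu> \<sigma> A - \<mu> UNIV * \<sigma> A) UNIV + tv (\<lambda>A. \<mu> UNIV * \<sigma> A) UNIV"
      using tv_add[of "\<lambda>A. conv \<mu> \<sigma> A - \<mu> UNIV * \<sigma> A" "\<lambda>A. \<mu> UNIV * \<sigma> A" UNIV] \<mu> \<sigma>c by (simp add: MK_cm)
    also have "\<dots> \<le> e + cmod (\<mu> UNIV)" using \<sigma> by (simp add: MK_norm_scale[OF \<sigma>c])
    finally have "tv (conv \<mu> \<sigma>) UNIV \<le> cmod (\<mu> UNIV) + e" by simp
    then show "(INF \<nu>\<in>PK. tv (conv \<mu> \<nu>) UNIV) \<le> cmod (\<mu> UNIV) + e"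
      using cINF_lower[OF norm_infimum_bdd[OF \<mu>] \<sigma>(1)] by linarith
  qed
qed

text \<open>Measures of mass zero are made small one after the other, by convolving with further
  probability measures on the right.\<close>

lemma almost_invariance_if_norm_infimum:
  assumes inf: "\<And>\<mu>. \<mu> \<in> carr MK \<Longrightarrow> cmod (\<mu> UNIV) = (INF \<nu>\<in>PK. tv (conv \<mu> \<nu>) UNIV)"
  shows "almost_invariance"
proof -
  have ne: "PK \<noteq> ({} :: 'a cmeas set)" using dirac_PK by blast
  have small: "\<exists>\<sigma>\<in>PK. tv (conv \<mu> \<sigma>) UNIV < e"
    if "\<mu> \<in> carr MK" "\<mu> UNIV = 0" "e > 0" for \<mu> e
    using inf[OF that(1)] that cINF_less_iff[OF ne norm_infimum_bdd[OF that(1)], of e] by simp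
  have common: "\<exists>\<sigma>\<in>PK. \<forall>\<mu>\<in>F. tv (conv \<mu> \<sigma>) UNIV < e"
    if "finite F" "F \<subseteq> {\<mu> \<in> carr MK. \<mu> UNIV = 0}" "e > 0" for F e
    using that
  proof (induction F arbitrary: e)
    case empty
    then show ?case using ne by blast
  next
    case (insert \<mu> F)
    \<comment> \<open>The next convolution, by \<tau>, can enlarge what is already small by the
      factor 16 of \<open>conv_norm\<close>.\<close>
    then have "e / 16 > 0" "F \<subseteq> {\<mu> \<in> carr MK. \<mu> UNIV = 0}" by auto
    then obtain \<sigma> where \<sigma>: "\<sigma> \<in> PK" "\<And>\<kappa>. \<kappa> \<in> F \<Longrightarrow> tv (conv \<kappa> \<sigma>) UNIV < e / 16"
      using insert.IH by blast
    note \<sigma>c = PK_D(2)[OF \<sigma>(1)]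
    have \<mu>: "\<mu> \<in> carr MK" "\<mu> UNIV = 0" using insert.prems by auto
    obtain \<tau> where \<tau>: "\<tau> \<in> PK" "tv (conv (conv \<mu> \<sigma>) \<tau>) UNIV < e"
      using small[of "conv \<mu> \<sigma>" e] \<mu> \<sigma>c conv_mass[OF \<mu>(1) \<sigma>c] insert.prems by auto
    note \<tau>c = PK_D(2)[OF \<tau>(1)]
    have "tv (conv \<kappa> (conv \<sigma> \<tau>)) UNIV < e" if \<kappa>: "\<kappa> \<in> insert \<mu> F" for \<kappa>
    proof (cases "\<kappa> = \<mu>")
      case True
      then show ?thesis using \<tau>(2) conv_assoc[OF \<mu>(1) \<sigma>c \<tau>c] by simp
    next
      case False
      then have \<kappa>: "\<kappa> \<in> F" "\<kappa> \<in> carr MK" using \<kappa> insert.prems by auto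
      have "tv (conv (conv \<kappa> \<sigma>) \<tau>) UNIV \<le> 16 * tv (conv \<kappa> \<sigma>) UNIV * tv \<tau> UNIV"
        using \<kappa> \<sigma>c \<tau>c by (intro conv_norm) auto
      also have "\<dots> < e" using \<sigma>(2)[OF \<kappa>(1)] \<tau>(1) by simp
      finally show ?thesis using conv_assoc[OF \<kappa>(2) \<sigma>c \<tau>c] by simp
    qed
    then show ?case using conv_PK[OF \<sigma>(1) \<tau>(1)] by blast
  qed
  show ?thesis
    unfolding almost_invariance_def
  proof (intro allI impI)
    fix F :: "'a cmeas set" and e :: real assume F: "finite F" "F \<subseteq> PK" and e: "e > 0"
    define \<pi> where "\<pi> = dirac (undefined :: 'a)"
    have \<pi>: "\<pi> \<in> PK" by (simp add: \<pi>_def)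
    note \<pi>c = PK_D(2)[OF \<pi>]
    \<comment> \<open>M(K) is not assumed to have an identity from which \<nu> could be subtracted,
      so everything is multiplied by a fixed \<pi> on the right. A \<sigma> that makes these
      measures of mass zero small yields the almost invariant measure
      \<open>conv \<pi> \<sigma>\<close>.\<close>
    define g where "g \<nu> = (\<lambda>A. conv \<nu> \<pi> A - \<pi> A)" for \<nu>
    have g: "g \<nu> \<in> carr MK" "g \<nu> UNIV = 0" if "\<nu> \<in> PK" for \<nu>
      using PK_D(2)[OF that] \<pi>c conv_mass[OF PK_D(2)[OF that] \<pi>c] PK_D(3)[OF that]
      by (simp_all add: g_def)
    obtain \<sigma> where \<sigma>: "\<sigma> \<in> PK" "\<And>\<nu>. \<nu> \<in> F \<Longrightarrow> tv (conv (g \<nu>) \<sigma>) UNIV < e"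
    proof -
      have "g ` F \<subseteq> {\<mu> \<in> carr MK. \<mu> UNIV = 0}" using g F(2) by blast
      with common[of "g ` F" e] F(1) e show ?thesis using that by auto
    qed
    have "defect \<nu> (conv \<pi> \<sigma>) < e" if \<nu>: "\<nu> \<in> F" for \<nu>
    proof -
      have \<nu>c: "\<nu> \<in> carr MK" using F(2) \<nu> PK_D(2) by blast
      have "conv (g \<nu>) \<sigma> = (\<lambda>A. conv \<nu> (conv \<pi> \<sigma>) A - conv \<pi> \<sigma> A)"
        unfolding g_def using \<nu>c \<pi>c PK_D(2)[OF \<sigma>(1)] by (simp add: conv_diff_left conv_assoc)
      then show ?thesis using \<sigma>(2)[OF \<nu>] by (simp add: defect_def)
    qed
    then show "\<exists>\<sigma>\<in>PK. \<forall>\<nu>\<in>F. defect \<nu> \<sigma> < e" using conv_PK[OF \<pi> \<sigma>(1)] by blast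
  qed
qed

text \<open>Along the refined filter \<open>\<phi> (conv x \<sigma>)\<close> is asymptotic to
  \<open>x UNIV * \<phi> \<sigma>\<close> and thus tends to \<open>x UNIV * m \<phi>\<close>, which
  identifies the constant as \<open>m \<phi>\<close>. The filter is then written as the tails of a
  net.\<close>

lemma topological_right_stationary_if_filter:
  assumes "almost_invariant_filter F"
  shows "topological_right_stationary conv"
proof -
  obtain G m where G: "almost_invariant_filter G"
    and lim: "\<And>\<phi>. \<phi> \<in> carr (dual MK) \<Longrightarrow> ((\<lambda>\<sigma>. \<phi> \<sigma>) \<longlongrightarrow> m \<phi>) G"
    using almost_invariant_filter_refine[OF assms] by blast
  have "G \<noteq> bot" and P: "eventually (\<lambda>\<sigma>. \<sigma> \<in> PK) G" using G by (auto simp: almost_invariant_filter_def)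
  from filter_as_net[OF this] obtain I :: "('a cmeas \<times> 'a cmeas set) set" and le n
    where net: "directed_set I le" "\<forall>i\<in>I. n i \<in> PK" "filtermap n (tails I le) = G" by blast
  have "limitin (weak_star_topology MK) (\<lambda>i. right_translate conv (n i) \<phi>)
      (vscale (dual MK) (m \<phi>) one_functional) (tails I le)" if \<phi>: "\<phi> \<in> carr (dual MK)" for \<phi>
  proof (rule limitin_weak_star[OF MK_zero])
    show "vscale (dual MK) (m \<phi>) one_functional \<in> carr (dual (MK :: 'a cmeas cnspace))"
      using dual_closed(2)[OF one_dual] by simp
    have "eventually (\<lambda>\<sigma>. right_translate conv \<sigma> \<phi> \<in> carr (dual MK)) G"
      using P by (rule eventually_mono) (simp add: \<phi> PK_D(2))
    then show "eventually (\<lambda>i. right_translate conv (n i) \<phi> \<in> carr (dual MK)) (tails I le)"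
      unfolding net(3)[symmetric] eventually_filtermap .
    fix x :: "'a cmeas" assume x: "x \<in> carr MK"
    have "((\<lambda>\<sigma>. vnorm (dual MK) \<phi> * tv (\<lambda>A. conv x \<sigma> A - x UNIV * \<sigma> A) UNIV) \<longlongrightarrow> 0) G"
      using tendsto_mult[OF tendsto_const almost_invariant_filter_measure[OF G x]] by simp
    then have "((\<lambda>\<sigma>. \<phi> (conv x \<sigma>) - x UNIV * \<phi> \<sigma>) \<longlongrightarrow> 0) G"
    proof (rule Lim_null_comparison[rotated])
      show "eventually (\<lambda>\<sigma>. norm (\<phi> (conv x \<sigma>) - x UNIV * \<phi> \<sigma>)
          \<le> vnorm (dual MK) \<phi> * tv (\<lambda>A. conv x \<sigma> A - x UNIV * \<sigma> A) UNIV) G"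
        using P
      proof (rule eventually_mono)
        fix \<sigma> :: "'a cmeas" assume "\<sigma> \<in> PK"
        then have \<sigma>: "\<sigma> \<in> carr MK" by (rule PK_D)
        then show "norm (\<phi> (conv x \<sigma>) - x UNIV * \<phi> \<sigma>)
            \<le> vnorm (dual MK) \<phi> * tv (\<lambda>A. conv x \<sigma> A - x UNIV * \<sigma> A) UNIV"
          using dual_MK_bound[OF \<phi>, of "\<lambda>A. conv x \<sigma> A - x UNIV * \<sigma> A"] x
          by (simp add: dual_MK_linear[OF \<phi>])
      qed
    qed
    from tendsto_add[OF this tendsto_mult[OF tendsto_const[of "x UNIV"] lim[OF \<phi>]]]
    have "((\<lambda>\<sigma>. \<phi> (conv x \<sigma>)) \<longlongrightarrow> x UNIV * m \<phi>) G" by simp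
    then have "((\<lambda>i. \<phi> (conv x (n i))) \<longlongrightarrow> x UNIV * m \<phi>) (tails I le)"
      unfolding net(3)[symmetric] filterlim_filtermap .
    then show "((\<lambda>i. right_translate conv (n i) \<phi> x) \<longlongrightarrow> vscale (dual MK) (m \<phi>) one_functional x) (tails I le)"
      using x by (simp add: right_translate_def one_functional_def mult.commute)
  qed
  then show ?thesis unfolding topological_right_stationary_def using net(1,2) by blast
qed

text \<open>The limit of \<open>\<phi> (conv x (n i))\<close> is the same for every probability
  measure \<open>x\<close>. Replacing \<open>x\<close> by its product with \<nu> therefore does not
  alter it, and this is the invariance.\<close>

lemma topological_right_stationary_imp_form:
  assumes "topological_right_stationary conv"
  shows "\<exists>m. invariant_form m"
proof -
  obtain I :: "('a cmeas \<times> 'a cmeas set) set" and le n where net: "directed_set I le" "\<forall>i\<in>I. n i \<in> PK"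
    and ex: "\<forall>\<phi>\<in>carr (dual MK). \<exists>c. limitin (weak_star_topology MK) (\<lambda>i. right_translate conv (n i) \<phi>)
             (vscale (dual MK) c one_functional) (tails I le)"
    using assms unfolding topological_right_stationary_def by blast
  let ?F = "tails I le"
  \<comment> \<open>One constant is chosen per functional; linearity is recovered from the
    uniqueness of limits at a fixed \<pi>.\<close>
  from bchoice[OF ex] obtain m where
    m: "\<And>\<phi>. \<phi> \<in> carr (dual MK) \<Longrightarrow> limitin (weak_star_topology MK) (\<lambda>i. right_translate conv (n i) \<phi>)
             (vscale (dual MK) (m \<phi>) one_functional) ?F" by blast
  have lim: "((\<lambda>i. \<phi> (conv x (n i))) \<longlongrightarrow> m \<phi>) ?F" if "\<phi> \<in> carr (dual MK)" "x \<in> PK" for \<phi> x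
    using weak_star_limitD[OF m[OF that(1)] PK_D(2)[OF that(2)]] PK_D[OF that(2)]
    by (simp add: right_translate_def one_functional_def)
  have nb: "?F \<noteq> bot" by (rule tails_not_bot[OF net(1)])
  have P: "eventually (\<lambda>i. n i \<in> PK) ?F" by (rule eventually_tails_in[OF net])
  define \<pi> where "\<pi> = dirac (undefined :: 'a)"
  have \<pi>: "\<pi> \<in> PK" by (simp add: \<pi>_def)
  have "m (\<lambda>x. \<phi> x + \<psi> x) = m \<phi> + m \<psi>" if "\<phi> \<in> carr (dual MK)" "\<psi> \<in> carr (dual MK)" for \<phi> \<psi>
    using tendsto_unique[OF nb lim[OF dual_closed(1)[OF that] \<pi>] tendsto_add[OF lim[OF that(1) \<pi>] lim[OF that(2) \<pi>]]] .
  moreover have "m (\<lambda>x. c * \<phi> x) = c * m \<phi>" if "\<phi> \<in> carr (dual MK)" for c \<phi>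
    using tendsto_unique[OF nb lim[OF dual_closed(2)[OF that] \<pi>] tendsto_mult[OF tendsto_const lim[OF that \<pi>]]] .
  moreover have "eventually (\<lambda>i. one_functional (conv \<pi> (n i)) = 1) ?F"
    using P by (rule eventually_mono) (use conv_PK[OF \<pi>] in \<open>simp add: one_functional_def PK_D\<close>)
  then have "m one_functional = 1"
    by (intro tendsto_unique[OF nb lim[OF one_dual \<pi>] tendsto_eventually])
  moreover have "m (left_translate conv \<nu> \<phi>) = m \<phi>" if \<nu>: "\<nu> \<in> PK" and \<phi>: "\<phi> \<in> carr (dual MK)" for \<nu> \<phi>
  proof -
    \<comment> \<open>Associativity moves \<nu> into the probability measure at which the limit is
      taken.\<close>
    have "eventually (\<lambda>i. left_translate conv \<nu> \<phi> (conv \<pi> (n i)) = \<phi> (conv (conv \<nu> \<pi>) (n i))) ?F"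
      using P by (rule eventually_mono)
        (simp add: left_translate_def conv_assoc PK_D(2) \<nu> \<pi>)
    moreover have "((\<lambda>i. left_translate conv \<nu> \<phi> (conv \<pi> (n i))) \<longlongrightarrow> m (left_translate conv \<nu> \<phi>)) ?F"
      using \<phi> PK_D(2)[OF \<nu>] \<pi> by (intro lim) simp_all
    ultimately have "((\<lambda>i. \<phi> (conv (conv \<nu> \<pi>) (n i))) \<longlongrightarrow> m (left_translate conv \<nu> \<phi>)) ?F"
      by (simp add: tendsto_cong)
    then show ?thesis using tendsto_unique[OF nb _ lim[OF \<phi> conv_PK[OF \<nu> \<pi>]]] by blast
  qed
  ultimately have "invariant_form m" by (simp add: invariant_form_def linear_form_def)
  then show ?thesis by blast
qed

end

section \<open>Left amenability\<close>

context semihypergroup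
begin

text \<open>A derivation \<open>D\<close> into \<open>X*\<close> is implemented by the functional \<open>x \<mapsto> - m (a \<mapsto> D a x)\<close>.\<close>

lemma left_amenable_if_bounded_form:
  assumes m: "invariant_form m" "m \<in> carr (dual (dual MK))"
  shows "left_amenable TYPE('x) MK conv one_functional"
  unfolding left_amenable_def
proof (intro allI impI)
  fix X :: "'x cnspace" and lact ract D
  assume bim: "banach_bimodule MK conv X lact ract"
    and lact: "\<forall>a\<in>carr MK. \<forall>x\<in>carr X. lact a x = vscale X (one_functional a) x"
    and der: "derivation MK conv (dual X) (dual_lact X ract) (dual_ract X lact) D"
    and bdd: "bounded_map MK (dual X) D"
  have X: "complex_normed_space X"
    using bim by (simp add: banach_bimodule_def complex_banach_space_def)
  have nD: "complex_normed_space (dual (MK :: 'a cmeas cnspace))"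
    by (rule complex_normed_dual[OF complex_normed_MK])
  have ract_lin: "linear_map X X (\<lambda>x. ract x a)" if "a \<in> carr MK" for a
    using bim that by (simp add: banach_bimodule_def bounded_bilinear_map_def bilinear_map_def)
  have ract: "ract x a \<in> carr X" if "x \<in> carr X" "a \<in> carr MK" for x a
    using ract_lin[OF that(2)] that(1) by (simp add: linear_map_def)
  have D: "D a \<in> carr (dual X)" if "a \<in> carr MK" for a
    using der that by (simp add: derivation_def linear_map_def)
  have D_add: "D (\<lambda>A. a A + b A) x = D a x + D b x" if "a \<in> carr MK" "b \<in> carr MK" for a b x
    using der that by (simp add: derivation_def linear_map_def)
  have D_scale: "D (\<lambda>A. c * a A) x = c * D a x" if "a \<in> carr MK" for a c x
    using der that by (simp add: derivation_def linear_map_def)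
  obtain B where B: "\<And>a. a \<in> carr MK \<Longrightarrow> vnorm (dual X) (D a) \<le> B * tv a UNIV"
    using bdd by (auto simp: bounded_map_def)
  have DB: "cmod (D a x) \<le> \<bar>B\<bar> * vnorm X x * tv a UNIV"
    if a: "a \<in> carr MK" and x: "x \<in> carr X" for a x
  proof -
    have "vnorm (dual X) (D a) \<le> \<bar>B\<bar> * tv a UNIV"
      using B[OF a] mult_right_mono[OF abs_ge_self[of B] MK_norm_nonneg[OF a]] by linarith
    from mult_right_mono[OF this cnsD(4)[OF X x]] show ?thesis
      using dual_bound[OF X D[OF a] x] by (simp add: mult_ac)
  qed
  define \<Phi> where "\<Phi> x a = (if a \<in> carr MK then D a x else 0)" for x and a :: "'a cmeas"
  have \<Phi>: "\<Phi> x \<in> carr (dual MK)" if "x \<in> carr X" for x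
    by (rule dualI[of _ _ "\<bar>B\<bar> * vnorm X x"])
      (use DB that in \<open>auto simp: \<Phi>_def D_add D_scale\<close>)
  have \<Phi>_norm: "vnorm (dual MK) (\<Phi> x) \<le> \<bar>B\<bar> * vnorm X x" if x: "x \<in> carr X" for x
    by (rule dual_norm_le[OF complex_normed_MK]) (use DB x cnsD(4)[OF X x] in \<open>auto simp: \<Phi>_def\<close>)
  have m_add: "m (\<lambda>a. \<phi> a + \<psi> a) = m \<phi> + m \<psi>" if "\<phi> \<in> carr (dual MK)" "\<psi> \<in> carr (dual MK)" for \<phi> \<psi>
    using m that by (simp add: invariant_form_def linear_form_def)
  have m_scale: "m (\<lambda>a. c * \<phi> a) = c * m \<phi>" if "\<phi> \<in> carr (dual MK)" for c \<phi>
    using m that by (simp add: invariant_form_def linear_form_def)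
  define y where "y x = (if x \<in> carr X then - m (\<Phi> x) else 0)" for x
  have y_dual: "y \<in> carr (dual X)"
  proof (rule dualI)
    fix x z assume xz: "x \<in> carr X" "z \<in> carr X"
    have "\<Phi> (vadd X x z) = (\<lambda>a. \<Phi> x a + \<Phi> z a)"
      using dualD(1)[OF D xz] by (auto simp: \<Phi>_def)
    then show "y (vadd X x z) = y x + y z"
      using xz cnsD(2)[OF X xz] m_add[OF \<Phi>[OF xz(1)] \<Phi>[OF xz(2)]] by (simp add: y_def)
  next
    fix c x assume x: "x \<in> carr X"
    have "\<Phi> (vscale X c x) = (\<lambda>a. c * \<Phi> x a)"
      using dualD(2)[OF D x] by (auto simp: \<Phi>_def)
    then show "y (vscale X c x) = c * y x"
      using x cnsD(3)[OF X x] m_scale[OF \<Phi>[OF x]] by (simp add: y_def)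
  next
    fix x assume x: "x \<in> carr X"
    have "cmod (m (\<Phi> x)) \<le> vnorm (dual (dual MK)) m * (\<bar>B\<bar> * vnorm X x)"
      using dual_bound[OF nD m(2) \<Phi>[OF x]]
        mult_left_mono[OF \<Phi>_norm[OF x] dual_norm_nonneg[OF nD m(2)]] by linarith
    then show "cmod (y x) \<le> (vnorm (dual (dual MK)) m * \<bar>B\<bar>) * vnorm X x"
      using x by (simp add: y_def mult_ac)
  qed (simp add: y_def)
  have "D a x = dual_lact X ract a y x - dual_ract X lact y a x" if a: "a \<in> carr MK" for a x
  proof (cases "x \<in> carr X")
    case False
    then show ?thesis using dualD(3)[OF D[OF a]] by (simp add: dual_lact_def dual_ract_def)
  next
    case x: True
    have lact_x: "lact b x = vscale X (b UNIV) x" if "b \<in> carr MK" for b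
      using lact that x by (simp add: one_functional_def)
    \<comment> \<open>The derivation rule at \<open>x\<close>; the trivial left action turns its
      first term into a multiple of \<open>one_functional b\<close>.\<close>
    have "\<Phi> x (conv a b) = b UNIV * D a x + \<Phi> (ract x a) b" if b: "b \<in> carr MK" for b
    proof -
      have "D (conv a b) = (\<lambda>x. dual_ract X lact (D a) b x + dual_lact X ract a (D b) x)"
        using der a b by (simp add: derivation_def)
      then show ?thesis
        using a b x lact_x[OF b] dualD(2)[OF D[OF a] x]
        by (simp add: \<Phi>_def dual_lact_def dual_ract_def)
    qed
    then have "left_translate conv a (\<Phi> x) = (\<lambda>b. D a x * one_functional b + \<Phi> (ract x a) b)"
      by (auto simp: left_translate_def one_functional_def \<Phi>_def)
    \<comment> \<open>The form is applied in the variable \<open>b\<close>, where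
      \<open>m one_functional = 1\<close> isolates \<open>D a x\<close>. Solving for it explains the
      minus sign in \<open>y\<close>.\<close>
    then have "a UNIV * m (\<Phi> x) = D a x + m (\<Phi> (ract x a))"
      using invariant_form_translate[OF m(1) a \<Phi>[OF x]] m(1)
        m_add[OF dual_closed(2)[OF one_dual] \<Phi>[OF ract[OF x a]]] m_scale[OF one_dual]
      by (simp add: invariant_form_def)
    moreover have "\<Phi> (vscale X (a UNIV) x) = (\<lambda>b. a UNIV * \<Phi> x b)"
      using dualD(2)[OF D x] by (auto simp: \<Phi>_def)
    ultimately show ?thesis
      using x a ract[OF x a] cnsD(3)[OF X x] m_scale[OF \<Phi>[OF x]]
      by (simp add: y_def dual_lact_def dual_ract_def lact_x[OF a])
  qed
  then show "inner_derivation MK (dual X) (dual_lact X ract) (dual_ract X lact) D"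
    unfolding inner_derivation_def using y_dual by (intro bexI[of _ y]) (auto simp: fun_eq_iff)
qed

text \<open>The quotient of \<open>M(K)*\<close> by the constants is realised as the space of functionals vanishing
  at a fixed point mass \<open>\<pi>\<close>, with the projection \<open>\<phi> \<mapsto> \<phi> - \<phi> \<pi> * one_functional\<close>.\<close>

lemma invariant_form_if_left_amenable:
  assumes am: "left_amenable TYPE('a cmeas \<Rightarrow> complex) MK conv one_functional"
  shows "\<exists>m. invariant_form m"
proof -
  define \<pi> where "\<pi> = dirac (undefined :: 'a)"
  have \<pi>P: "\<pi> \<in> PK" by (simp add: \<pi>_def)
  note \<pi> = PK_D(2)[OF \<pi>P] and \<pi>1 = PK_D(3)[OF \<pi>P]
  define X where "X = (dual MK)\<lparr>carr := {\<phi> \<in> carr (dual (MK :: 'a cmeas cnspace)). \<phi> \<pi> = 0}\<rparr>"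
  have X_simps [simp]: "carr X = {\<phi> \<in> carr (dual MK). \<phi> \<pi> = 0}" "vadd X \<phi> \<psi> = (\<lambda>x. \<phi> x + \<psi> x)"
    "vscale X c \<phi> = (\<lambda>x. c * \<phi> x)" "vzero X = (\<lambda>x. 0)" "vnorm X \<phi> = vnorm (dual MK) \<phi>" for \<phi> \<psi> c
    by (simp_all add: X_def)
  define P where "P \<phi> = (\<lambda>x. \<phi> x - \<phi> \<pi> * one_functional x)" for \<phi> :: "'a cmeas \<Rightarrow> complex"
  define lact where "lact a \<phi> = (\<lambda>x. one_functional a * \<phi> x)"
    for a :: "'a cmeas" and \<phi> :: "'a cmeas \<Rightarrow> complex"
  define ract where "ract \<phi> a = P (left_translate conv a \<phi>)" for a \<phi>
  \<comment> \<open>On M(K)** the evaluation at \<pi> generates the inner derivation that sends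
    \<open>a\<close> to \<open>\<phi> (conv a \<pi>) - a UNIV * \<phi> \<pi>\<close>. Its values
    annihilate \<open>one_functional\<close> and so act on the quotient; the last term is zero on
    representatives in \<open>X\<close>.\<close>
  define D where "D a \<phi> = (if \<phi> \<in> carr X then \<phi> (conv a \<pi>) else 0)" for a \<phi>
  have one: "one_functional x = x UNIV" if "x \<in> carr MK" for x :: "'a cmeas"
    using that by (simp add: one_functional_def)
  have P_X: "P \<phi> \<in> carr X" if "\<phi> \<in> carr (dual MK)" for \<phi>
    using that dual_closed(3)[OF that dual_closed(2)[OF one_dual], of "\<phi> \<pi>"] \<pi> \<pi>1
    by (simp add: P_def one)
  have ract_X: "ract \<phi> a \<in> carr X" if "\<phi> \<in> carr (dual MK)" "a \<in> carr MK" for \<phi> a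
    unfolding ract_def using that by (intro P_X) simp
  have ract_at: "ract \<phi> a x = \<phi> (conv a x) - \<phi> (conv a \<pi>) * x UNIV" if "x \<in> carr MK" for \<phi> a x
    using that \<pi> by (simp add: ract_def P_def left_translate_def one)
  have ract_off: "ract \<phi> a x = 0" if "x \<notin> carr MK" for \<phi> a x
    using that by (simp add: ract_def P_def left_translate_def one_functional_def)
  have banach: "complex_banach_space X"
    unfolding X_def by (rule banach_dual_annihilator[OF complex_normed_MK \<pi>])
  then have normed: "complex_normed_space X" by (simp add: complex_banach_space_def)
  have conv_bound: "cmod (\<phi> (conv a x)) \<le> 16 * vnorm (dual MK) \<phi> * tv a UNIV * tv x UNIV"
    if "\<phi> \<in> carr (dual MK)" "a \<in> carr MK" "x \<in> carr MK" for \<phi> a x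
    using dual_MK_bound[OF that(1) conv_closed[OF that(2,3)]]
      mult_left_mono[OF conv_norm[OF that(2,3)] dual_norm_nonneg[OF complex_normed_MK that(1)]]
    by (simp add: mult_ac)
  have "bounded_bilinear_map MK X X lact"
    unfolding bounded_bilinear_map_def bilinear_map_def linear_map_def
  proof (intro conjI exI[of _ 1] ballI allI)
    show "vnorm X (lact a \<phi>) \<le> 1 * vnorm MK a * vnorm X \<phi>" if "a \<in> carr MK" "\<phi> \<in> carr X" for a \<phi>
      using cnsD(6)[OF complex_normed_dual[OF complex_normed_MK], of \<phi> "one_functional a"] that
        MK_norm_ge[OF that(1), of UNIV] dual_norm_nonneg[OF complex_normed_MK, of \<phi>]
      by (simp add: lact_def one mult_right_mono)
  qed (simp_all add: lact_def one distrib_left distrib_right dual_closed mult.assoc mult.left_commute)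
  moreover have "bounded_bilinear_map X MK X ract"
    unfolding bounded_bilinear_map_def bilinear_map_def linear_map_def
  proof (intro conjI exI[of _ 32] ballI allI)
    fix \<phi> and a :: "'a cmeas" assume \<phi>X: "\<phi> \<in> carr X" and a: "a \<in> carr MK"
    then have \<phi>: "\<phi> \<in> carr (dual MK)" by simp
    show "ract \<phi> a \<in> carr X" by (rule ract_X[OF \<phi> a])
    show "ract \<phi> a \<in> carr X" by (rule ract_X[OF \<phi> a])
    show "ract \<phi> (vscale MK c a) = vscale X c (ract \<phi> a)" for c
    proof
      show "ract \<phi> (vscale MK c a) x = vscale X c (ract \<phi> a) x" for x
        using a \<pi> by (cases "x \<in> carr MK")
          (simp_all add: ract_at ract_off conv_scale_left dual_MK_linear[OF \<phi>] algebra_simps)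
    qed
    show "ract \<phi> (vadd MK a b) = vadd X (ract \<phi> a) (ract \<phi> b)" if "b \<in> carr MK" for b
    proof
      show "ract \<phi> (vadd MK a b) x = vadd X (ract \<phi> a) (ract \<phi> b) x" for x
        using a that \<pi> by (cases "x \<in> carr MK")
          (simp_all add: ract_at ract_off conv_add_left dual_MK_linear[OF \<phi>] algebra_simps)
    qed
    show "ract (vadd X \<phi> \<psi>) a = vadd X (ract \<phi> a) (ract \<psi> a)" for \<psi>
    proof
      show "ract (vadd X \<phi> \<psi>) a x = vadd X (ract \<phi> a) (ract \<psi> a) x" for x
        by (cases "x \<in> carr MK") (simp_all add: ract_at ract_off algebra_simps)
    qed
    show "ract (vscale X c \<phi>) a = vscale X c (ract \<phi> a)" for c
    proof
      show "ract (vscale X c \<phi>) a x = vscale X c (ract \<phi> a) x" for x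
        by (cases "x \<in> carr MK") (simp_all add: ract_at ract_off algebra_simps)
    qed
    have nn: "0 \<le> vnorm (dual MK) \<phi>" "0 \<le> tv a UNIV"
      using \<phi> a by (auto intro: dual_norm_nonneg[OF complex_normed_MK] MK_norm_nonneg)
    \<comment> \<open>Each of the two terms of \<open>ract\<close> contributes a bound with the
      factor 16.\<close>
    have "vnorm (dual MK) (ract \<phi> a) \<le> 32 * vnorm (dual MK) \<phi> * tv a UNIV"
    proof (rule dual_norm_le[OF complex_normed_MK])
      fix x :: "'a cmeas" assume x: "x \<in> carr MK"
      have "cmod (\<phi> (conv a \<pi>) * x UNIV)
          \<le> (16 * vnorm (dual MK) \<phi> * tv a UNIV) * tv x UNIV"
        unfolding norm_mult using conv_bound[OF \<phi> a \<pi>] MK_norm_ge[OF x, of UNIV] \<pi>P nn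
        by (intro mult_mono) auto
      then show "cmod (ract \<phi> a x) \<le> 32 * vnorm (dual MK) \<phi> * tv a UNIV * vnorm MK x"
        using conv_bound[OF \<phi> a x] norm_triangle_ineq4[of "\<phi> (conv a x)" "\<phi> (conv a \<pi>) * x UNIV"]
        by (simp add: ract_at[OF x])
    qed (use nn in simp)
    then show "vnorm X (ract \<phi> a) \<le> 32 * vnorm X \<phi> * vnorm MK a" by simp
  qed
  moreover have "lact (conv a b) \<phi> = lact a (lact b \<phi>)" "ract \<phi> (conv a b) = ract (ract \<phi> a) b"
      "ract (lact a \<phi>) b = lact a (ract \<phi> b)"
    if a: "a \<in> carr MK" and b: "b \<in> carr MK" for a b \<phi>
  proof -
    show "lact (conv a b) \<phi> = lact a (lact b \<phi>)"
      using a b by (simp add: lact_def one conv_mass mult.assoc)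
    \<comment> \<open>The constants subtracted by the inner projection cancel, because mass is
      multiplicative and \<pi> has mass 1.\<close>
    show "ract \<phi> (conv a b) = ract (ract \<phi> a) b"
    proof
      show "ract \<phi> (conv a b) x = ract (ract \<phi> a) b x" for x
        using a b \<pi> \<pi>1 by (cases "x \<in> carr MK")
          (simp_all add: ract_at ract_off conv_assoc conv_mass algebra_simps)
    qed
    show "ract (lact a \<phi>) b = lact a (ract \<phi> b)"
    proof
      show "ract (lact a \<phi>) b x = lact a (ract \<phi> b) x" for x
        by (cases "x \<in> carr MK") (simp_all add: ract_at ract_off lact_def algebra_simps)
    qed
  qed
  ultimately have bim: "banach_bimodule MK conv X lact ract"
    using banach by (simp add: banach_bimodule_def)
  have lact_trivial: "\<forall>a\<in>carr MK. \<forall>\<phi>\<in>carr X. lact a \<phi> = vscale X (one_functional a) \<phi>"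
    by (simp add: lact_def)
  have D_bound: "cmod (D a \<phi>) \<le> 16 * tv a UNIV * vnorm X \<phi>" if "a \<in> carr MK" "\<phi> \<in> carr X" for a \<phi>
    using conv_bound[of \<phi> a \<pi>] that \<pi> \<pi>P by (simp add: D_def mult_ac)
  have D_dual: "D a \<in> carr (dual X)" if a: "a \<in> carr MK" for a
    by (rule dualI[OF _ _ D_bound[OF a]]) (auto simp: D_def intro: dual_closed)
  have der: "derivation MK conv (dual X) (dual_lact X ract) (dual_ract X lact) D"
    unfolding derivation_def linear_map_def
  proof (intro conjI ballI allI)
    show "D a \<in> carr (dual X)" if "a \<in> carr MK" for a by (rule D_dual[OF that])
    show "D (vadd MK a b) = vadd (dual X) (D a) (D b)" if "a \<in> carr MK" "b \<in> carr MK" for a b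
      using that \<pi> by (auto simp: D_def fun_eq_iff conv_add_left dual_MK_linear)
    show "D (vscale MK c a) = vscale (dual X) c (D a)" if "a \<in> carr MK" for c a
      using that \<pi> by (auto simp: D_def fun_eq_iff conv_scale_left dual_MK_linear)
    fix a b :: "'a cmeas" assume ab: "a \<in> carr MK" "b \<in> carr MK"
    show "D (conv a b) = vadd (dual X) (dual_ract X lact (D a) b) (dual_lact X ract a (D b))"
    proof
      fix \<phi>
      show "D (conv a b) \<phi> = vadd (dual X) (dual_ract X lact (D a) b) (dual_lact X ract a (D b)) \<phi>"
      proof (cases "\<phi> \<in> carr X")
        case True
        then have "lact b \<phi> \<in> carr X" "ract \<phi> a \<in> carr X"
          using ract_X[of \<phi> a] ab by (auto simp: lact_def intro: dual_closed)
        \<comment> \<open>The correction that the projection puts into \<open>ract\<close> cancels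
          exactly against the term from the trivial left action.\<close>
        then have "D a (lact b \<phi>) = b UNIV * \<phi> (conv a \<pi>)"
          "D b (ract \<phi> a) = \<phi> (conv a (conv b \<pi>)) - \<phi> (conv a \<pi>) * b UNIV"
          using ab \<pi> \<pi>1 by (simp_all add: D_def lact_def one ract_at conv_mass)
        then show ?thesis
          using True ab \<pi> by (simp add: dual_lact_def dual_ract_def) (simp add: D_def conv_assoc)
      qed (simp add: D_def dual_lact_def dual_ract_def del: X_simps)
    qed
  qed
  have "bounded_map MK (dual X) D"
    unfolding bounded_map_def
  proof (intro exI ballI)
    show "vnorm (dual X) (D a) \<le> 16 * vnorm MK a" if "a \<in> carr MK" for a
      using dual_norm_le[OF normed _ D_bound[OF that]] MK_norm_nonneg[OF that] by simp
  qed
  then have "inner_derivation MK (dual X) (dual_lact X ract) (dual_ract X lact) D"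
    using am bim lact_trivial der unfolding left_amenable_def by blast
  then obtain y where y: "y \<in> carr (dual X)"
    and inner: "\<And>a. a \<in> carr MK \<Longrightarrow> D a = (\<lambda>\<phi>. dual_lact X ract a y \<phi> - dual_ract X lact y a \<phi>)"
    unfolding inner_derivation_def by auto
  have y_inner: "\<phi> (conv a \<pi>) = y (ract \<phi> a) - a UNIV * y \<phi>" if a: "a \<in> carr MK" and \<phi>: "\<phi> \<in> carr X" for a \<phi>
    using fun_cong[OF inner[OF a], of \<phi>] \<phi> a dualD(2)[OF y \<phi>, of "a UNIV"]
    by (simp add: D_def dual_lact_def dual_ract_def lact_def one)
  \<comment> \<open>Evaluation at \<pi> and \<open>y\<close>, lifted to M(K)*, generate the same
    derivation, so their difference is fixed by translations. The lift of \<open>y\<close> vanishes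
    at \<open>one_functional\<close>, which leaves the value 1 there.\<close>
  define m where "m \<phi> = \<phi> \<pi> - y (P \<phi>)" for \<phi>
  have "m (\<lambda>x. \<phi> x + \<psi> x) = m \<phi> + m \<psi>" if "\<phi> \<in> carr (dual MK)" "\<psi> \<in> carr (dual MK)" for \<phi> \<psi>
  proof -
    have "P (\<lambda>x. \<phi> x + \<psi> x) = vadd X (P \<phi>) (P \<psi>)" by (simp add: P_def fun_eq_iff algebra_simps)
    then show ?thesis using dualD(1)[OF y P_X[OF that(1)] P_X[OF that(2)]] by (simp add: m_def)
  qed
  moreover have "m (\<lambda>x. c * \<phi> x) = c * m \<phi>" if "\<phi> \<in> carr (dual MK)" for c \<phi>
  proof -
    have "P (\<lambda>x. c * \<phi> x) = vscale X c (P \<phi>)" by (simp add: P_def fun_eq_iff algebra_simps)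
    then show ?thesis using dualD(2)[OF y P_X[OF that], of c] by (simp add: m_def right_diff_distrib)
  qed
  moreover have "m one_functional = 1"
  proof -
    have "P one_functional = vzero X" using \<pi> \<pi>1 by (simp add: P_def one)
    then show ?thesis using dual_at_zero[OF normed y] \<pi> \<pi>1 by (simp add: m_def one)
  qed
  moreover have "m (left_translate conv \<nu> \<phi>) = m \<phi>" if \<nu>: "\<nu> \<in> PK" and \<phi>: "\<phi> \<in> carr (dual MK)" for \<nu> \<phi>
  proof -
    note \<nu>c = PK_D(2)[OF \<nu>] and \<nu>1 = PK_D(3)[OF \<nu>]
    have P_at: "P \<phi> x = \<phi> x - \<phi> \<pi> * x UNIV" if "x \<in> carr MK" for x using that by (simp add: P_def one)
    \<comment> \<open>The action annihilates multiples of \<open>one_functional\<close>, which is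
      what makes it the action on the quotient.\<close>
    have "ract (P \<phi>) \<nu> = ract \<phi> \<nu>"
    proof
      show "ract (P \<phi>) \<nu> x = ract \<phi> \<nu> x" for x
        using \<nu>c \<nu>1 \<pi> \<pi>1 by (cases "x \<in> carr MK")
          (simp_all add: ract_at ract_off P_at conv_mass algebra_simps)
    qed
    then have "P \<phi> (conv \<nu> \<pi>) = y (ract \<phi> \<nu>) - y (P \<phi>)"
      using y_inner[OF \<nu>c P_X[OF \<phi>]] \<nu>1 by simp
    moreover have "P \<phi> (conv \<nu> \<pi>) = \<phi> (conv \<nu> \<pi>) - \<phi> \<pi>"
      using \<nu>c \<nu>1 \<pi> \<pi>1 by (simp add: P_at conv_mass)
    ultimately have "\<phi> (conv \<nu> \<pi>) - y (ract \<phi> \<nu>) = \<phi> \<pi> - y (P \<phi>)"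
      by (simp add: algebra_simps)
    moreover have "m (left_translate conv \<nu> \<phi>) = \<phi> (conv \<nu> \<pi>) - y (ract \<phi> \<nu>)"
      using \<pi> by (simp add: m_def ract_def left_translate_def)
    ultimately show ?thesis by (simp only: m_def)
  qed
  ultimately have "invariant_form m" by (simp add: invariant_form_def linear_form_def)
  then show ?thesis by blast
qed

section \<open>Closing the circle of equivalences\<close>

lemma filter_if_form:
  assumes "invariant_form m"
  shows "\<exists>F. almost_invariant_filter F"
  by (intro almost_invariant_filter_exists almost_invariance_if_form) (rule assms)

lemma bounded_form_and_TLIM_if_filter:
  assumes "almost_invariant_filter F"
  shows "\<exists>m. TLIM conv m \<and> invariant_form m"
proof -
  from almost_invariant_filter_refine[OF assms] obtain G m where "almost_invariant_filter G"
    "\<And>\<phi>. \<phi> \<in> carr (dual MK) \<Longrightarrow> ((\<lambda>\<sigma>. \<phi> \<sigma>) \<longlongrightarrow> m \<phi>) G" "\<And>\<phi>. \<phi> \<notin> carr (dual MK) \<Longrightarrow> m \<phi> = 0"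
    by auto
  from limit_is_TLIM[OF this] show ?thesis by blast
qed

lemma TLIM_iff_filter: "(\<exists>m. TLIM conv m) \<longleftrightarrow> (\<exists>F. almost_invariant_filter F)"
proof
  assume "\<exists>m. TLIM conv m"
  then obtain m where "TLIM conv m" ..
  from TLIM_imp_invariant_form[OF this] obtain m' where "invariant_form m'" ..
  then show "\<exists>F. almost_invariant_filter F" by (rule filter_if_form)
next
  assume "\<exists>F. almost_invariant_filter F"
  then obtain F where "almost_invariant_filter F" ..
  from bounded_form_and_TLIM_if_filter[OF this] show "\<exists>m. TLIM conv m" by blast
qed

lemma TLIM_if_invariant_form: "\<exists>m. invariant_form m \<Longrightarrow> \<exists>m. TLIM conv m"
  unfolding TLIM_iff_filter by (elim exE) (rule filter_if_form)

text \<open>The detour through an almost invariant filter gives a functional that is bounded and at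
  the same time normalised at \<open>one_functional\<close>, as the construction of the implementing
  element requires.\<close>

lemma bounded_form_if_TLIM:
  assumes "\<exists>m. TLIM conv m"
  shows "\<exists>m. invariant_form m \<and> m \<in> carr (dual (dual MK))"
proof -
  obtain F where "almost_invariant_filter F" using assms unfolding TLIM_iff_filter ..
  from bounded_form_and_TLIM_if_filter[OF this] show ?thesis by (auto simp: TLIM_def is_mean_def)
qed

lemma filter_iff_net:
  "(\<exists>F. almost_invariant_filter F) \<longleftrightarrow>
    (\<exists>(I :: ('a cmeas \<times> 'a cmeas set) set) le n. directed_set I le \<and> (\<forall>i\<in>I. n i \<in> PK) \<and>
      (\<forall>\<nu>\<in>PK. ((\<lambda>i. defect \<nu> (n i)) \<longlongrightarrow> 0) (tails I le)))"
proof
  assume "\<exists>F. almost_invariant_filter F"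
  then obtain F where F: "F \<noteq> bot" "eventually (\<lambda>\<sigma>. \<sigma> \<in> PK) F" "\<forall>\<nu>\<in>PK. (defect \<nu> \<longlongrightarrow> 0) F"
    by (auto simp: almost_invariant_filter_def)
  from filter_as_net[OF F(1,2)] obtain I :: "('a cmeas \<times> 'a cmeas set) set" and le n
    where net: "directed_set I le" "\<forall>i\<in>I. n i \<in> PK" "filtermap n (tails I le) = F" by blast
  have "((\<lambda>i. defect \<nu> (n i)) \<longlongrightarrow> 0) (tails I le)" if "\<nu> \<in> PK" for \<nu>
    using F(3) that unfolding net(3)[symmetric] filterlim_filtermap by blast
  then show "\<exists>(I :: ('a cmeas \<times> 'a cmeas set) set) le n. directed_set I le \<and> (\<forall>i\<in>I. n i \<in> PK) \<and>
      (\<forall>\<nu>\<in>PK. ((\<lambda>i. defect \<nu> (n i)) \<longlongrightarrow> 0) (tails I le))"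
    using net(1,2) by blast
next
  assume "\<exists>(I :: ('a cmeas \<times> 'a cmeas set) set) le n. directed_set I le \<and> (\<forall>i\<in>I. n i \<in> PK) \<and>
      (\<forall>\<nu>\<in>PK. ((\<lambda>i. defect \<nu> (n i)) \<longlongrightarrow> 0) (tails I le))"
  then obtain I :: "('a cmeas \<times> 'a cmeas set) set" and le n
    where net: "directed_set I le" "\<forall>i\<in>I. n i \<in> PK"
      "\<forall>\<nu>\<in>PK. ((\<lambda>i. defect \<nu> (n i)) \<longlongrightarrow> 0) (tails I le)" by blast
  then have "almost_invariant_filter (filtermap n (tails I le))"
    using tails_not_bot[OF net(1)] eventually_tails_in[OF net(1,2)]
    by (simp add: almost_invariant_filter_def filtermap_bot_iff eventually_filtermap filterlim_filtermap)
  then show "\<exists>F. almost_invariant_filter F" by blast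
qed

end

(* The last two conjuncts express that (1) and (5) are equivalent. Property (5) ranges over
   bimodules of arbitrary type 'x; it follows from (1) for every type 'x, and conversely the
   instance at the type of functionals on M(K) already implies (1). *)

theorem theorem3p2:
  fixes conv :: "'a::t2_space cmeas \<Rightarrow> 'a cmeas \<Rightarrow> 'a cmeas"
  assumes "semitop_semihypergroup conv"
  shows "((\<exists>m. TLIM conv m) \<longleftrightarrow>
            (\<exists>(I :: ('a cmeas \<times> 'a cmeas set) set) le n.
               directed_set I le \<and> (\<forall>i\<in>I. n i \<in> PK) \<and>
               (\<forall>\<nu>\<in>PK. ((\<lambda>i. vnorm MK (vdiff MK (conv \<nu> (n i)) (n i))) \<longlongrightarrow> 0) (tails I le)))) \<and>
         ((\<exists>m. TLIM conv m) \<longleftrightarrow>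
            (\<forall>\<mu>\<in>carr MK. cmod (\<mu> UNIV) = (INF \<nu>\<in>PK. vnorm MK (conv \<mu> \<nu>)))) \<and>
         ((\<exists>m. TLIM conv m) \<longleftrightarrow> topological_right_stationary conv) \<and>
         ((\<exists>m. TLIM conv m) \<longrightarrow>
            left_amenable TYPE('x) (MK :: 'a cmeas cnspace) conv one_functional) \<and>
         (left_amenable TYPE('a cmeas \<Rightarrow> complex) (MK :: 'a cmeas cnspace) conv one_functional \<longrightarrow>
            (\<exists>m. TLIM conv m))"
proof -
  interpret semihypergroup conv by unfold_locales (rule assms)
  show ?thesis
  proof (intro conjI)
    show "(\<exists>m. TLIM conv m) \<longleftrightarrow>
            (\<exists>(I :: ('a cmeas \<times> 'a cmeas set) set) le n.
               directed_set I le \<and> (\<forall>i\<in>I. n i \<in> PK) \<and>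
               (\<forall>\<nu>\<in>PK. ((\<lambda>i. vnorm MK (vdiff MK (conv \<nu> (n i)) (n i))) \<longlongrightarrow> 0) (tails I le)))"
      unfolding defect_eq TLIM_iff_filter by (rule filter_iff_net)
    show "(\<exists>m. TLIM conv m) \<longleftrightarrow>
            (\<forall>\<mu>\<in>carr MK. cmod (\<mu> UNIV) = (INF \<nu>\<in>PK. vnorm MK (conv \<mu> \<nu>)))"
      unfolding TLIM_iff_filter MK_simps
      using mass_eq_norm_infimum almost_invariant_filter_exists
        almost_invariance_if_norm_infimum by blast
    show "(\<exists>m. TLIM conv m) \<longleftrightarrow> topological_right_stationary conv"
      using TLIM_iff_filter topological_right_stationary_if_filter
        topological_right_stationary_imp_form TLIM_if_invariant_form by blast
    show "(\<exists>m. TLIM conv m) \<longrightarrow>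
            left_amenable TYPE('x) (MK :: 'a cmeas cnspace) conv one_functional"
      using bounded_form_if_TLIM left_amenable_if_bounded_form by blast
    show "left_amenable TYPE('a cmeas \<Rightarrow> complex) (MK :: 'a cmeas cnspace) conv one_functional \<longrightarrow>
            (\<exists>m. TLIM conv m)"
      using invariant_form_if_left_amenable TLIM_if_invariant_form by blast
  qed
qed

end
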